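(* Let $n\in\mathbb N$ and let $P,Q,R$ be $n\times n$ matrix functions on $\mathbb R_+=[0,+\infty)$ such that $P(x)$ is invertible and $P(x),Q(x)$ are Hermitian for $x\in\mathbb R_+$, and the entries of $P^{-1},Q,R$ are measurable on $\mathbb R_+$ and summable on each of its closed finite subintervals. Let $L_0$ be the minimal operator generated in $\mathcal L^2_n(\mathbb R_+)$ by $l[f]=-(P(f'-Rf))'-R^*P(f'-Rf)+Qf$, with defect numbers $d_+,d_-$. Let $\|\cdot\|$ be a self-adjoint matrix norm, and let $K(x,t)$ be the Cauchy function of the equation $l[f]=0$. Then the defect numbers of $L_0$ are not maximal (that is, it is not the case that $d_+=d_-=2n$) if and only if there exists a sequence of pairwise disjoint intervals $(a_k,b_k)\subset\mathbb R_+$, $k=1,2,\ldots$, such that $$\sum_{k=1}^{+\infty}\left(\int_{a_k}^{b_k}dx\int_{a_k}^{x}\|K(x,t)\|^2\,dt\right)^{1/2}=\infty .$$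
   Context: Quasi-derivatives: for a locally absolutely continuous $f:\mathbb R_+\to\mathbb C^n$ put $f^{[1]}:=P(f'-Rf)$; if $f^{[1]}$ is also locally absolutely continuous put $f^{[2]}:=(f^{[1]})'+R^*f^{[1]}-Qf$ and $l[f]:=-f^{[2]}$. The domain $\Delta$ of $l$ is the set of all $f$ with $f$ and $f^{[1]}$ locally absolutely continuous on $\mathbb R_+$; $l[f]$ is defined a.e. The equation $l[f]=\lambda f$ is equivalent to the first-order system $Y'=\begin{pmatrix}R&P^{-1}\\ Q-\lambda I&-R^*\end{pmatrix}Y$ for $Y=(f,f^{[1]})^t$, so Cauchy problems at any point of $\mathbb R_+$ (prescribing $f$ and $f^{[1]}$) are uniquely solvable on $\mathbb R_+$. $\mathcal L^2_n(\mathbb R_+)$ is the Hilbert space of (classes of) measurable $f:\mathbb R_+\to\mathbb C^n$ with $\int_0^\infty\sum_{s=1}^n|f_s|^2dx<\infty$. The maximal operator $L_1$ is $f\mapsto l[f]$ on $\{f\in\Delta\cap\mathcal L^2_n(\mathbb R_+): l[f]\in\mathcal L^2_n(\mathbb R_+)\}$; the minimal operator $L_0$ is the closure of the restriction of $L_1$ to functions in its domain with compact support in $(0,+\infty)$. $L_0$ is a closed densely defined symmetric operator. Its defect numbers $d_+$ and $d_-$ equal the maximal number of linearly independent solutions of $l[f]=\lambda f$ lying in $\mathcal L^2_n(\mathbb R_+)$ for $\Im\lambda>0$ and $\Im\lambda<0$ respectively; $n\le d_\pm\le 2n$, and $d_+=2n$ if and only if $d_-=2n$. "Defect numbers are maximal"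 means $d_+=d_-=2n$; this holds if and only if all solutions of $l[f]=\lambda f$ lie in $\mathcal L^2_n(\mathbb R_+)$ for every $\lambda\in\mathbb C$. The Cauchy function $K(x,t)$ of $l[f]=0$ is the $n\times n$ matrix function which, for each fixed $t$, is a (columnwise) solution of $l[f]=0$ in the variable $x$ with $K(x,t)|_{x=t}=O$ and $K^{[1]}(x,t)|_{x=t}=I$ (quasi-derivative in $x$), where $O,I$ are the zero and identity matrices. A self-adjoint matrix norm is a (submultiplicative) norm on $n\times n$ complex matrices with $\|A^*\|=\|A\|$. *)

theory Defs
  imports "HOL-Analysis.Analysis"
begin

section \<open>Matrices\<close>

definition conj_transpose :: "complex^'n^'m \<Rightarrow> complex^'m^'n" where
  "conj_transpose A = (\<chi> i j. cnj (A $ j $ i))"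

definition hermitian_matrix :: "complex^'n^'n \<Rightarrow> bool" where
  "hermitian_matrix A \<longleftrightarrow> conj_transpose A = A"

definition self_adjoint_matrix_norm :: "(complex^'n^'n \<Rightarrow> real) \<Rightarrow> bool" where
  "self_adjoint_matrix_norm N \<longleftrightarrow>
     (\<forall>A. 0 \<le> N A) \<and>
     (\<forall>A. N A = 0 \<longleftrightarrow> A = 0) \<and>
     (\<forall>c A. N (\<chi> i j. c * A $ i $ j) = cmod c * N A) \<and>
     (\<forall>A B. N (A + B) \<le> N A + N B) \<and>
     (\<forall>A B. N (A ** B) \<le> N A * N B) \<and>
     (\<forall>A. N (conj_transpose A) = N A)"

definition locally_summable_entries :: "(real \<Rightarrow> complex^'n^'n) \<Rightarrow> bool" where
  "locally_summable_entries M \<longleftrightarrow>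
     (\<forall>i j a b. 0 \<le> a \<longrightarrow> a \<le> b \<longrightarrow> (\<lambda>x. M x $ i $ j) absolutely_integrable_on {a..b})"


section \<open>Absolute continuity\<close>

definition abs_continuous_on_interval ::
    "real \<Rightarrow> real \<Rightarrow> (real \<Rightarrow> 'a::real_normed_vector) \<Rightarrow> bool" where
  "abs_continuous_on_interval a b f \<longleftrightarrow>
     (\<forall>\<epsilon>>0. \<exists>\<delta>>0. \<forall>(m::nat) u v.
        (\<forall>i<m. a \<le> u i \<and> u i \<le> v i \<and> v i \<le> b) \<longrightarrow>
        disjoint_family_on (\<lambda>i. {u i<..<v i}) {..<m} \<longrightarrow>
        (\<Sum>i<m. v i - u i) < \<delta> \<longrightarrow>
        (\<Sum>i<m. norm (f (v i) - f (u i))) < \<epsilon>)"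

definition locally_abs_continuous :: "(real \<Rightarrow> 'a::real_normed_vector) \<Rightarrow> bool" where
  "locally_abs_continuous f \<longleftrightarrow>
     (\<forall>a b. 0 \<le> a \<longrightarrow> a \<le> b \<longrightarrow> abs_continuous_on_interval a b f)"


section \<open>Quasi-derivatives and the differential expression\<close>

text \<open>
  Functions on the half-line are total functions on the reals, of which only the values at
  \<open>x \<ge> 0\<close> matter. The formula \<open>P (f' - R f)\<close> determines \<open>f\<^sup>[\<^sup>1\<^sup>]\<close> only almost everywhere, so
  the first quasi-derivative is given as a relation: \<open>g\<close> is the locally absolutely continuous,
  hence unique, representative. Thus \<open>f\<close> belongs to the domain \<open>\<Delta>\<close> of the expression if and only if
  \<open>quasi_derivative P R f g\<close> holds for some \<open>g\<close>.
\<close>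

definition quasi_derivative ::
    "(real \<Rightarrow> complex^'n^'n) \<Rightarrow> (real \<Rightarrow> complex^'n^'n)
      \<Rightarrow> (real \<Rightarrow> complex^'n) \<Rightarrow> (real \<Rightarrow> complex^'n) \<Rightarrow> bool" where
  "quasi_derivative P R f g \<longleftrightarrow>
     locally_abs_continuous f \<and> locally_abs_continuous g \<and>
     (AE x in lebesgue_on {0..}. \<exists>f'. (f has_vector_derivative f') (at x) \<and>
        g x = P x *v (f' - R x *v f x))"

text \<open>
  \<open>l_value P Q R f h\<close>: \<open>f \<in> \<Delta>\<close> and \<open>h = l[f] = - f\<^sup>[\<^sup>2\<^sup>]\<close> almost everywhere on the half-line.
\<close>

definition l_value ::
    "(real \<Rightarrow> complex^'n^'n) \<Rightarrow> (real \<Rightarrow> complex^'n^'n) \<Rightarrow> (real \<Rightarrow> complex^'n^'n)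
      \<Rightarrow> (real \<Rightarrow> complex^'n) \<Rightarrow> (real \<Rightarrow> complex^'n) \<Rightarrow> bool" where
  "l_value P Q R f h \<longleftrightarrow>
     (\<exists>g. quasi_derivative P R f g \<and>
       (AE x in lebesgue_on {0..}. \<exists>g'. (g has_vector_derivative g') (at x) \<and>
          h x = - (g' + conj_transpose (R x) *v g x - Q x *v f x)))"


section \<open>Square-integrable vector functions\<close>

text \<open>
  Elements of the Hilbert space are represented by functions; classes modulo equality almost
  everywhere are accounted for in the notions below.
\<close>

definition square_integrable :: "(real \<Rightarrow> complex^'n) \<Rightarrow> bool" where
  "square_integrable f \<longleftrightarrow>
     f \<in> borel_measurable (lebesgue_on {0..}) \<and>
     integrable (lebesgue_on {0..}) (\<lambda>x. \<Sum>s\<in>UNIV. (cmod (f x $ s))\<^sup>2)"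

definition l2_inner :: "(real \<Rightarrow> complex^'n) \<Rightarrow> (real \<Rightarrow> complex^'n) \<Rightarrow> complex" where
  "l2_inner f g = (LINT x|lebesgue_on {0..}. (\<Sum>s\<in>UNIV. f x $ s * cnj (g x $ s)))"

definition l2_norm :: "(real \<Rightarrow> complex^'n) \<Rightarrow> real" where
  "l2_norm f = sqrt (LINT x|lebesgue_on {0..}. (\<Sum>s\<in>UNIV. (cmod (f x $ s))\<^sup>2))"

definition independent_ae :: "nat \<Rightarrow> (nat \<Rightarrow> real \<Rightarrow> complex^'n) \<Rightarrow> bool" where
  "independent_ae m F \<longleftrightarrow>
     (\<forall>c. (AE x in lebesgue_on {0..}. (\<Sum>i<m. c i *s F i x) = 0) \<longrightarrow> (\<forall>i<m. c i = 0))"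

text \<open>
  For a linear subspace \<open>V\<close> of square-integrable functions, the dimension of the corresponding
  subspace of classes.
\<close>

definition dim_ae :: "(real \<Rightarrow> complex^'n) set \<Rightarrow> enat" where
  "dim_ae V = Sup {enat m |m. \<exists>F. (\<forall>i<m. F i \<in> V) \<and> independent_ae m F}"


section \<open>Maximal and minimal operators, defect numbers\<close>

text \<open>Operators are given by their graphs.\<close>

definition maximal_operator ::
    "(real \<Rightarrow> complex^'n^'n) \<Rightarrow> (real \<Rightarrow> complex^'n^'n) \<Rightarrow> (real \<Rightarrow> complex^'n^'n)
      \<Rightarrow> ((real \<Rightarrow> complex^'n) \<times> (real \<Rightarrow> complex^'n)) set" where
  "maximal_operator P Q R =
     {(f, h). square_integrable f \<and> square_integrable h \<and> l_value P Q R f h}"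

definition compact_support_in_pos :: "(real \<Rightarrow> complex^'n) \<Rightarrow> bool" where
  "compact_support_in_pos f \<longleftrightarrow>
     compact (closure {x. 0 \<le> x \<and> f x \<noteq> 0}) \<and> closure {x. 0 \<le> x \<and> f x \<noteq> 0} \<subseteq> {0<..}"

definition graph_closure ::
    "((real \<Rightarrow> complex^'n) \<times> (real \<Rightarrow> complex^'n)) set
      \<Rightarrow> ((real \<Rightarrow> complex^'n) \<times> (real \<Rightarrow> complex^'n)) set" where
  "graph_closure G =
     {(f, h). square_integrable f \<and> square_integrable h \<and>
        (\<exists>F H. (\<forall>k::nat. (F k, H k) \<in> G) \<and>
           (\<lambda>k. l2_norm (\<lambda>x. F k x - f x)) \<longlonglongrightarrow> 0 \<and>
           (\<lambda>k. l2_norm (\<lambda>x. H k x - h x)) \<longlonglongrightarrow> 0)}"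

definition minimal_operator ::
    "(real \<Rightarrow> complex^'n^'n) \<Rightarrow> (real \<Rightarrow> complex^'n^'n) \<Rightarrow> (real \<Rightarrow> complex^'n^'n)
      \<Rightarrow> ((real \<Rightarrow> complex^'n) \<times> (real \<Rightarrow> complex^'n)) set" where
  "minimal_operator P Q R =
     graph_closure {(f, h) \<in> maximal_operator P Q R. compact_support_in_pos f}"

text \<open>
  The orthogonal complement of the range of \<open>T - cnj \<mu>\<close>, that is, the kernel of \<open>T\<^sup>* - \<mu>\<close>.
\<close>

definition defect_subspace ::
    "((real \<Rightarrow> complex^'n) \<times> (real \<Rightarrow> complex^'n)) set \<Rightarrow> complex \<Rightarrow> (real \<Rightarrow> complex^'n) set" where
  "defect_subspace T \<mu> =
     {g. square_integrable g \<and> (\<forall>(f, h)\<in>T. l2_inner (\<lambda>x. h x - cnj \<mu> *s f x) g = 0)}"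

text \<open>
  For a closed symmetric operator the dimension of the defect subspace is constant in each of the
  open half-planes, so the points \<open>\<i>\<close> and \<open>- \<i>\<close> serve as representatives.
\<close>

definition defect_number_plus ::
    "((real \<Rightarrow> complex^'n) \<times> (real \<Rightarrow> complex^'n)) set \<Rightarrow> enat" where
  "defect_number_plus T = dim_ae (defect_subspace T \<i>)"

definition defect_number_minus ::
    "((real \<Rightarrow> complex^'n) \<times> (real \<Rightarrow> complex^'n)) set \<Rightarrow> enat" where
  "defect_number_minus T = dim_ae (defect_subspace T (- \<i>))"


section \<open>The Cauchy function\<close>

definition cauchy_function ::
    "(real \<Rightarrow> complex^'n^'n) \<Rightarrow> (real \<Rightarrow> complex^'n^'n) \<Rightarrow> (real \<Rightarrow> complex^'n^'n)
      \<Rightarrow> (real \<Rightarrow> real \<Rightarrow> complex^'n^'n) \<Rightarrow> bool" where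
  "cauchy_function P Q R K \<longleftrightarrow>
     (\<forall>t\<ge>0. \<exists>K1.
        (\<forall>j. l_value P Q R (\<lambda>x. column j (K x t)) (\<lambda>x. 0) \<and>
             quasi_derivative P R (\<lambda>x. column j (K x t)) (\<lambda>x. column j (K1 x))) \<and>
        K t t = 0 \<and> K1 t = mat 1)"

end

theory Submission
  imports Defs
begin

text \<open>
  Write a solution of \<open>l[f] = \<lambda>f\<close> as the block vector \<open>Y = (f, f\<^sup>[\<^sup>1\<^sup>])\<close>. By the Lagrange identity the
  bracket \<open>\<langle>f, v\<^sup>[\<^sup>1\<^sup>]\<rangle> - \<langle>f\<^sup>[\<^sup>1\<^sup>], v\<rangle>\<close> of a solution \<open>f\<close> for \<open>\<lambda>\<close> and a solution \<open>v\<close> for the conjugate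
  parameter is constant. Hence fundamental matrices \<open>F\<close> and \<open>G\<close> for the two parameters satisfy
  \<open>G\<^sup>* J F = J\<close> with the symplectic matrix \<open>J\<close>. This gives uniqueness, the inverse of \<open>F\<close>, and
  \<open>K(x,t) = T(x) J T(t)\<^sup>*\<close>, where \<open>T\<close> is the upper block of the fundamental matrix for \<open>\<lambda> = 0\<close>.
  That matrix exists because the columns of all \<open>K(0,t)\<close> span the space of initial values: a vector
  orthogonal to them is the initial quasi-derivative of a solution that vanishes identically.

  For another parameter the fundamental matrix is \<open>F C\<close> with \<open>C' = M C\<close>, where \<open>|M|\<close> is at most a
  constant times the product of the norms of the upper blocks of \<open>F\<close> and \<open>G\<close>. So \<open>C\<close> is bounded if
  these are square integrable, and all solutions are square integrable for \<open>\<lambda> = 0\<close> if and only if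
  they are for \<open>\<lambda> = \<plusminus>\<i>\<close>. As the defect subspaces consist of the square-integrable solutions, the
  defect numbers are maximal if and only if \<open>\<integral>|T|\<^sup>2 < \<infinity>\<close>.

  In that case the square root of the double integral over an interval is at most a constant times
  the integral of \<open>|T|\<^sup>2\<close> over the interval, and the series converges. Otherwise,
  \<open>\<integral>\<^bsub>a\<^esub>\<^bsup>a+1\<^esup> \<parallel>K(x,t)\<parallel>\<^sup>2 dt \<ge> \<delta> |T(x)|\<^sup>2\<close> with some \<open>\<delta> > 0\<close> depending on \<open>a\<close>, so that to the right of
  every point there is an interval with double integral at least 1.
\<close>

section \<open>Absolutely continuous functions\<close>

text \<open>The coefficients are merely locally summable, so the first-order system has no classical
  solutions. The solutions for the parameter 0 are therefore taken from the Cauchy function, and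
  other parameters are reached by variation of constants. The matrix \<open>M\<close> of the
  resulting system contains only upper blocks of known fundamental matrices. It is continuous, and
  ordinary Picard iteration applies. Since solutions are differentiable only almost everywhere, the
  constancy of the bracket rests on a fundamental theorem of calculus for absolutely continuous
  functions with a negligible exceptional set. The change of parameter pairs \<open>F\<close> for a
  parameter with \<open>G\<close> for its conjugate. The parameter 0 is its own conjugate, but the
  way back from \<open>\<i>\<close> to 0 uses the solutions for \<open>- \<i>\<close> as well; hence
  both defect numbers are treated jointly. That a defect subspace contains nothing but solutions is
  extracted from compactly supported functions: step functions, corrected by a solution on a finite
  interval, lie in the range of the shifted minimal operator.\<close>

lemma abs_continuous_onD_finite:
  assumes "abs_continuous_on_interval a b f" "0 < \<epsilon>"
  shows "\<exists>\<delta>>0. \<forall>(I :: 'i set) u v. finite I \<longrightarrow>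
       (\<forall>i\<in>I. a \<le> u i \<and> u i \<le> v i \<and> v i \<le> b) \<longrightarrow>
       disjoint_family_on (\<lambda>i. {u i<..<v i}) I \<longrightarrow> (\<Sum>i\<in>I. v i - u i) < \<delta> \<longrightarrow>
       (\<Sum>i\<in>I. norm (f (v i) - f (u i))) < \<epsilon>"
proof -
  obtain \<delta> where \<delta>: "0 < \<delta>" "\<And>(m::nat) u v. (\<forall>i<m. a \<le> u i \<and> u i \<le> v i \<and> v i \<le> b) \<Longrightarrow>
        disjoint_family_on (\<lambda>i. {u i<..<v i}) {..<m} \<Longrightarrow>
        (\<Sum>i<m. v i - u i) < \<delta> \<Longrightarrow> (\<Sum>i<m. norm (f (v i) - f (u i))) < \<epsilon>"
    using assms unfolding abs_continuous_on_interval_def by meson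
  show ?thesis
  proof (intro exI[of _ \<delta>] conjI \<delta>(1) allI impI)
    fix I :: "'i set" and u v
    assume I: "finite I" "\<forall>i\<in>I. a \<le> u i \<and> u i \<le> v i \<and> v i \<le> b"
      "disjoint_family_on (\<lambda>i. {u i<..<v i}) I" "(\<Sum>i\<in>I. v i - u i) < \<delta>"
    obtain h where h: "bij_betw h {..<card I} I"
      using ex_bij_betw_nat_finite[OF I(1)] by (auto simp: atLeast0LessThan)
    have "(\<Sum>i<card I. norm (f (v (h i)) - f (u (h i)))) < \<epsilon>"
    proof (rule \<delta>(2))
      show "\<forall>i<card I. a \<le> u (h i) \<and> u (h i) \<le> v (h i) \<and> v (h i) \<le> b"
        using h I(2) by (auto simp: bij_betw_def)
      show "disjoint_family_on (\<lambda>i. {u (h i)<..<v (h i)}) {..<card I}"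
        using I(3) h unfolding disjoint_family_on_def bij_betw_def inj_on_def
        by (metis imageI)
      show "(\<Sum>i<card I. v (h i) - u (h i)) < \<delta>"
        using sum.reindex_bij_betw[OF h, of "\<lambda>i. v i - u i"] I(4) by simp
    qed
    then show "(\<Sum>i\<in>I. norm (f (v i) - f (u i))) < \<epsilon>"
      using sum.reindex_bij_betw[OF h, of "\<lambda>i. norm (f (v i) - f (u i))"] by simp
  qed
qed

lemma abs_continuous_imp_continuous_on:
  assumes "abs_continuous_on_interval a b f"
  shows "continuous_on {a..b} f"
proof (rule continuous_onI)
  fix x \<epsilon> assume x: "x \<in> {a..b}" and "0 < (\<epsilon>::real)"
  obtain \<delta> where \<delta>: "0 < \<delta>" "\<forall>(I :: unit set) u v. finite I \<longrightarrow>
       (\<forall>i\<in>I. a \<le> u i \<and> u i \<le> v i \<and> v i \<le> b) \<longrightarrow>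
       disjoint_family_on (\<lambda>i. {u i<..<v i}) I \<longrightarrow> (\<Sum>i\<in>I. v i - u i) < \<delta> \<longrightarrow>
       (\<Sum>i\<in>I. norm (f (v i) - f (u i))) < \<epsilon>"
    using abs_continuous_onD_finite[OF assms \<open>0 < \<epsilon>\<close>] by blast
  have *: "norm (f v - f u) < \<epsilon>" if "a \<le> u" "u \<le> v" "v \<le> b" "v - u < \<delta>" for u v
    using \<delta>(2)[rule_format, of "{()}" "\<lambda>_. u" "\<lambda>_. v"] that by (simp add: disjoint_family_on_def)
  have "dist (f y) (f x) \<le> \<epsilon>" if "y \<in> {a..b}" "dist y x < \<delta>" for y
    using *[of x y] *[of y x] that x
    by (cases "x \<le> y") (auto simp: dist_norm norm_minus_commute intro: less_imp_le)
  then show "\<exists>d>0. \<forall>y\<in>{a..b}. dist y x < d \<longrightarrow> dist (f y) (f x) \<le> \<epsilon>"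
    using \<delta>(1) by blast
qed

text \<open>The exceptional set may be uncountable, so the increments at tags in \<open>S\<close>
  cannot be absorbed one by one. Instead \<open>S\<close> is covered by an open set of small
  measure, and absolute continuity bounds the total increment of \<open>f\<close> over the intervals
  tagged there. At the other tags differentiability gives the usual straddle estimate.\<close>

theorem fundamental_theorem_of_calculus_abs_continuous:
  fixes f :: "real \<Rightarrow> 'a::euclidean_space"
  assumes "a \<le> b" and ac: "abs_continuous_on_interval a b f" and "negligible S"
    and der: "\<And>x. x \<in> {a..b} - S \<Longrightarrow> (f has_vector_derivative f' x) (at x within {a..b})"
  shows "(f' has_integral f b - f a) {a..b}"
proof -
  \<comment> \<open>With the value 0 on \<open>S\<close>, the error terms at tags in
    \<open>S\<close> are bare increments of \<open>f\<close>.\<close>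
  define g where "g x = (if x \<in> S then 0 else f' x)" for x
  have "(g has_integral f b - f a) {a..b}"
    unfolding has_integral_factor_content_real
  proof (cases "a = b")
    case True
    then show "\<forall>e>0. \<exists>d. gauge d \<and> (\<forall>p. p tagged_division_of {a..b} \<and> d fine p \<longrightarrow>
      norm ((\<Sum>(x, k)\<in>p. measure lborel k *\<^sub>R g x) - (f b - f a)) \<le> e * measure lborel {a..b})"
      using sum_content_null[of a a] by (intro allI impI exI[of _ "\<lambda>x. ball x 1"]) auto
  next
    case False
    then have "a < b" using assms(1) by simp
    show "\<forall>e>0. \<exists>d. gauge d \<and> (\<forall>p. p tagged_division_of {a..b} \<and> d fine p \<longrightarrow>
      norm ((\<Sum>(x, k)\<in>p. measure lborel k *\<^sub>R g x) - (f b - f a)) \<le> e * measure lborel {a..b})"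
    proof safe
      fix e :: real assume "0 < e"
      \<comment> \<open>One half of the admissible error is reserved for the tags in
        \<open>S\<close>, the other half for the remaining tags.\<close>
      define \<epsilon> where "\<epsilon> = e * (b - a) / 2"
      have "\<epsilon> > 0" using \<open>0 < e\<close> \<open>a < b\<close> by (simp add: \<epsilon>_def)
      obtain \<delta> where \<delta>: "0 < \<delta>" "\<forall>(I :: (real \<times> real set) set) u v. finite I \<longrightarrow>
       (\<forall>i\<in>I. a \<le> u i \<and> u i \<le> v i \<and> v i \<le> b) \<longrightarrow>
       disjoint_family_on (\<lambda>i. {u i<..<v i}) I \<longrightarrow> (\<Sum>i\<in>I. v i - u i) < \<delta> \<longrightarrow>
       (\<Sum>i\<in>I. norm (f (v i) - f (u i))) < \<epsilon>"
        using abs_continuous_onD_finite[OF ac \<open>0 < \<epsilon>\<close>] by blast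
      have Sl: "S \<in> sets lebesgue" "emeasure lebesgue S = 0"
        using \<open>negligible S\<close> by (auto simp: negligible_iff_null_sets)
      obtain G where G: "open G" "S \<subseteq> G" "(G - S) \<in> lmeasurable" "emeasure lebesgue (G - S) < ennreal \<delta>"
        using sets_lebesgue_outer_open[OF Sl(1) \<delta>(1)] by metis
      have "emeasure lebesgue G < ennreal \<delta>"
      proof -
        have "G = (G - S) \<union> S" using G(2) by blast
        then have "emeasure lebesgue G \<le> emeasure lebesgue (G - S) + emeasure lebesgue S"
          using emeasure_subadditive[of "G - S" lebesgue S] G(3) Sl(1) by (metis fmeasurableD)
        then show ?thesis using Sl(2) G(4) by simp
      qed
      then have mG: "emeasure lborel G < ennreal \<delta>" using G(1) by simp
      \<comment> \<open>The gauge serves two purposes: around points of \<open>S\<close> its balls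
        stay inside the small open set \<open>G\<close>, around the other points they are small
        enough for the linear approximation of \<open>f\<close>.\<close>
      have "\<forall>x. \<exists>d>0. (x \<in> S \<longrightarrow> ball x d \<subseteq> G) \<and> (x \<in> {a..b} - S \<longrightarrow>
         (\<forall>y\<in>{a..b}. norm (y-x) < d \<longrightarrow> norm (f y - f x - (y-x) *\<^sub>R f' x) \<le> (e/2) * norm (y-x)))"
      proof
        fix x
        show "\<exists>d>0. (x \<in> S \<longrightarrow> ball x d \<subseteq> G) \<and> (x \<in> {a..b} - S \<longrightarrow>
         (\<forall>y\<in>{a..b}. norm (y-x) < d \<longrightarrow> norm (f y - f x - (y-x) *\<^sub>R f' x) \<le> (e/2) * norm (y-x)))"
        proof (cases "x \<in> S")
          case True
          then show ?thesis using G(1,2) open_contains_ball by (metis Diff_iff subsetD)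
        next
          case False
          have "\<forall>e>0. \<exists>d>0. \<forall>y\<in>{a..b}. norm (y-x) < d \<longrightarrow> norm (f y - f x - (y-x) *\<^sub>R f' x) \<le> e * norm (y-x)"
            if "x \<in> {a..b}"
            using der[of x] False that
            unfolding has_vector_derivative_def has_derivative_within_alt by blast
          from this[rule_format, of "e/2"] show ?thesis using False \<open>0 < e\<close>
            by (cases "x \<in> {a..b}") (auto intro: exI[of _ 1])
        qed
      qed
      then obtain d where d: "\<And>x. 0 < d x" "\<And>x. x \<in> S \<Longrightarrow> ball x (d x) \<subseteq> G"
        "\<And>x y. \<lbrakk>x \<in> {a..b}; x \<notin> S; y \<in> {a..b}; norm (y-x) < d x\<rbrakk>
                        \<Longrightarrow> norm (f y - f x - (y-x) *\<^sub>R f' x) \<le> (e/2) * norm (y-x)"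
        by (metis DiffI)
      show "\<exists>d. gauge d \<and> (\<forall>p. p tagged_division_of {a..b} \<and> d fine p \<longrightarrow>
        norm ((\<Sum>(x, k)\<in>p. measure lborel k *\<^sub>R g x) - (f b - f a)) \<le> e * measure lborel {a..b})"
      proof (rule exI, safe)
        show "gauge (\<lambda>x. ball x (d x))"
          using d(1) gauge_ball_dependent by blast
      next
        fix p assume p: "p tagged_division_of {a..b}" and fine: "(\<lambda>x. ball x (d x)) fine p"
        have ba: "b - a = (\<Sum>(x,K)\<in>p. Sup K - Inf K)" "f b - f a = (\<Sum>(x,K)\<in>p. f(Sup K) - f(Inf K))"
          using additive_tagged_division_1[where f= "\<lambda>x. x"] additive_tagged_division_1[where f= f]
            \<open>a \<le> b\<close> p by auto
        have K: "\<exists>u v. K = {u..v} \<and> Inf K = u \<and> Sup K = v \<and> u \<le> x \<and> x \<le> v \<and> a \<le> u \<and> v \<le> b \<and> 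
            K \<subseteq> ball x (d x) \<and> x \<in> {a..b} \<and> measure lborel K = v - u"
          if xK: "(x, K) \<in> p" for x K
        proof -
          obtain u v where uv: "K = cbox u v" using p xK by (meson tagged_division_ofD(4))
          have "x \<in> K" "K \<subseteq> {a..b}" using p xK by (auto dest: tagged_division_ofD)
          moreover have "K \<subseteq> ball x (d x)" using fine xK unfolding fine_def by blast
          ultimately show ?thesis using uv by (intro exI[of _ u] exI[of _ v]) auto
        qed
        have int: "interior K = {Inf K<..<Sup K}" if "(x, K) \<in> p" for x K
          using K[OF that] by (metis interior_atLeastAtMost_real)
        have fp: "finite p" using p by blast
        define p1 where "p1 = {(x,K) \<in> p. x \<in> S}"
        have p1: "p1 \<subseteq> p" "finite p1" using fp by (auto simp: p1_def intro: finite_subset)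
        define D where "D = (\<lambda>(x, K). measure lborel K *\<^sub>R g x - (f (Sup K) - f (Inf K)))"
        \<comment> \<open>The intervals tagged in \<open>S\<close> do not overlap and lie in
          \<open>G\<close>, so their total length is below the \<open>\<delta>\<close> of absolute
          continuity.\<close>
        have "(\<Sum>i\<in>p1. norm (f (Sup (snd i)) - f (Inf (snd i)))) < \<epsilon>"
        proof (rule \<delta>(2)[rule_format])
          show dj: "disjoint_family_on (\<lambda>i. {Inf (snd i)<..<Sup (snd i)}) p1"
            unfolding disjoint_family_on_def
          proof (intro ballI impI)
            fix i j assume ij: "i \<in> p1" "j \<in> p1" "i \<noteq> j"
            obtain x K y L where [simp]: "i = (x,K)" "j = (y,L)" by (cases i; cases j)
            have "interior K \<inter> interior L = {}"
              using ij p1 p tagged_division_ofD(5)[OF p, of x K y L] by auto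
            moreover have "interior K = {Inf K<..<Sup K}" "interior L = {Inf L<..<Sup L}"
              using int[of x K] int[of y L] ij p1 by auto
            ultimately show "{Inf (snd i)<..<Sup (snd i)} \<inter> {Inf (snd j)<..<Sup (snd j)} = {}" by simp
          qed
          have "ennreal (\<Sum>i\<in>p1. Sup (snd i) - Inf (snd i)) = (\<Sum>i\<in>p1. emeasure lborel {Inf (snd i)<..<Sup (snd i)})"
          proof (subst sum_ennreal[symmetric])
            fix i assume "i \<in> p1" then show "0 \<le> Sup (snd i) - Inf (snd i)" using K[of "fst i" "snd i"] p1 by force
          next
            show "(\<Sum>i\<in>p1. ennreal (Sup (snd i) - Inf (snd i))) = (\<Sum>i\<in>p1. emeasure lborel {Inf (snd i)<..<Sup (snd i)})"
            proof (rule sum.cong)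
              fix i assume "i \<in> p1" 
              then have "Inf (snd i) \<le> Sup (snd i)" using K[of "fst i" "snd i"] p1 by force
              then show "ennreal (Sup (snd i) - Inf (snd i)) = emeasure lborel {Inf (snd i)<..<Sup (snd i)}" by simp
            qed simp
          qed
          also have "\<dots> = emeasure lborel (\<Union>i\<in>p1. {Inf (snd i)<..<Sup (snd i)})"
            by (rule sum_emeasure[OF _ dj p1(2)]) auto
          also have "\<dots> \<le> emeasure lborel G"
          proof (rule emeasure_mono)
            have "snd i \<subseteq> G" if "i \<in> p1" for i
              using K[of "fst i" "snd i"] d(2)[of "fst i"] that p1 by (force simp: p1_def)
            moreover have "{Inf (snd i)<..<Sup (snd i)} \<subseteq> snd i" if "i \<in> p1" for i
              using K[of "fst i" "snd i"] that p1 by force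
            ultimately show "(\<Union>i\<in>p1. {Inf (snd i)<..<Sup (snd i)}) \<subseteq> G" by blast
          qed (use G(1) in simp)
          finally have "ennreal (\<Sum>i\<in>p1. Sup (snd i) - Inf (snd i)) < ennreal \<delta>" using mG by simp
          then show "(\<Sum>i\<in>p1. Sup (snd i) - Inf (snd i)) < \<delta>"
            by (metis ennreal_leI leI not_le)
        next
          fix i assume "i \<in> p1"
          then show "a \<le> Inf (snd i) \<and> Inf (snd i) \<le> Sup (snd i) \<and> Sup (snd i) \<le> b"
            using K[of "fst i" "snd i"] p1 by force
        qed (fact p1(2))
        moreover have "norm (D i) = norm (f (Sup (snd i)) - f (Inf (snd i)))" if "i \<in> p1" for i
          using that by (auto simp: D_def p1_def g_def norm_minus_commute)
        ultimately have b1: "(\<Sum>i\<in>p1. norm (D i)) \<le> \<epsilon>" by simp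
        have "(\<Sum>i\<in>p - p1. norm (D i)) \<le> (\<Sum>i\<in>p - p1. (e/2) * (Sup (snd i) - Inf (snd i)))"
        proof (rule sum_mono)
          fix i assume i: "i \<in> p - p1"
          obtain x L where [simp]: "i = (x,L)" by (cases i)
          have xS: "x \<notin> S" "(x,L) \<in> p" using i by (auto simp: p1_def)
          obtain u v where uv: "L = {u..v}" "Inf L = u" "Sup L = v" "u \<le> x" "x \<le> v" "a \<le> u" "v \<le> b"
            "L \<subseteq> ball x (d x)" "x \<in> {a..b}" "measure lborel L = v - u" using K[OF xS(2)] by blast
          have "u \<in> L" "v \<in> L" using uv by auto
          then have "norm (u - x) < d x" "norm (v - x) < d x" using uv(8) by (auto simp: dist_norm norm_minus_commute)
          then have "norm (f u - f x - (u-x) *\<^sub>R f' x) \<le> (e/2) * norm (u-x)"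
            "norm (f v - f x - (v-x) *\<^sub>R f' x) \<le> (e/2) * norm (v-x)"
            using d(3)[of x u] d(3)[of x v] uv xS by auto
          \<comment> \<open>The value at the tag cancels: the error is the difference of the
            remainders of the linear approximation at the two ends.\<close>
          moreover have "D i = (f u - f x - (u-x) *\<^sub>R f' x) - (f v - f x - (v-x) *\<^sub>R f' x)"
            using xS uv by (simp add: D_def g_def algebra_simps)
          ultimately have "norm (D i) \<le> (e/2) * norm (u-x) + (e/2) * norm (v-x)"
            by (smt (verit) norm_triangle_ineq4)
          also have "\<dots> = (e/2) * (v - u)" using uv by (simp add: field_simps)
          finally show "norm (D i) \<le> (e/2) * (Sup (snd i) - Inf (snd i))" using uv by simp
        qed
        also have "\<dots> \<le> (\<Sum>i\<in>p. (e/2) * (Sup (snd i) - Inf (snd i)))"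
        proof (rule sum_mono2[OF fp])
          fix i assume "i \<in> p - (p - p1)"
          then show "0 \<le> (e/2) * (Sup (snd i) - Inf (snd i))"
            using K[of "fst i" "snd i"] \<open>0 < e\<close> by force
        qed auto
        also have "\<dots> = (e/2) * (b - a)" unfolding ba(1) by (subst sum_distrib_left) (simp add: case_prod_unfold)
        also have "\<dots> = \<epsilon>" by (simp add: \<epsilon>_def)
        finally have b2: "(\<Sum>i\<in>p - p1. norm (D i)) \<le> \<epsilon>" .
        have "(\<Sum>(x, k)\<in>p. measure lborel k *\<^sub>R g x) - (f b - f a) = (\<Sum>i\<in>p. D i)"
          unfolding ba(2) D_def by (simp add: sum_subtractf case_prod_unfold)
        also have "norm \<dots> \<le> (\<Sum>i\<in>p. norm (D i))" by (rule norm_sum)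
        also have "\<dots> = (\<Sum>i\<in>p - p1. norm (D i)) + (\<Sum>i\<in>p1. norm (D i))"
          using sum.subset_diff[OF p1(1) fp] by simp
        also have "\<dots> \<le> e * (b - a)" using b1 b2 by (simp add: \<epsilon>_def)
        finally show "norm ((\<Sum>(x, k)\<in>p. measure lborel k *\<^sub>R g x) - (f b - f a)) \<le> e * measure lborel {a..b}"
          using \<open>a \<le> b\<close> by simp
      qed
    qed
  qed
  then show ?thesis
    by (rule has_integral_spike[OF \<open>negligible S\<close>, rotated]) (simp add: g_def)
qed

section \<open>Closure properties of absolute continuity\<close>

text \<open>A bound on increments is all that absolute continuity asks for, so this single criterion
  yields Lipschitz functions, linear images, products and sums. A single dominating function is
  entered twice with half the constant.\<close>

lemma abs_continuous_on_dominated: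
  assumes f: "abs_continuous_on_interval a b f" and g: "abs_continuous_on_interval a b g"
    and dom: "\<And>u v. a \<le> u \<Longrightarrow> u \<le> v \<Longrightarrow> v \<le> b \<Longrightarrow>
      norm (h v - h u) \<le> B * (norm (f v - f u) + norm (g v - g u))"
  shows "abs_continuous_on_interval a b h"
  unfolding abs_continuous_on_interval_def
proof (intro allI impI)
  fix \<epsilon> :: real assume "0 < \<epsilon>"
  define C where "C = \<bar>B\<bar> + 1"
  define e where "e = \<epsilon> / (2 * C)"
  have "0 < C" "B \<le> C" "0 < e" using \<open>0 < \<epsilon>\<close> by (auto simp: C_def e_def)
  obtain \<delta>1 where d1: "\<delta>1 > 0" "\<And>(m::nat) u v. (\<forall>i<m. a \<le> u i \<and> u i \<le> v i \<and> v i \<le> b) \<Longrightarrow>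
        disjoint_family_on (\<lambda>i. {u i<..<v i}) {..<m} \<Longrightarrow>
        (\<Sum>i<m. v i - u i) < \<delta>1 \<Longrightarrow> (\<Sum>i<m. norm (f (v i) - f (u i))) < e"
    using f \<open>0 < e\<close> unfolding abs_continuous_on_interval_def by meson
  obtain \<delta>2 where d2: "\<delta>2 > 0" "\<And>(m::nat) u v. (\<forall>i<m. a \<le> u i \<and> u i \<le> v i \<and> v i \<le> b) \<Longrightarrow>
        disjoint_family_on (\<lambda>i. {u i<..<v i}) {..<m} \<Longrightarrow>
        (\<Sum>i<m. v i - u i) < \<delta>2 \<Longrightarrow> (\<Sum>i<m. norm (g (v i) - g (u i))) < e"
    using g \<open>0 < e\<close> unfolding abs_continuous_on_interval_def by meson
  show "\<exists>\<delta>>0. \<forall>(m::nat) u v. (\<forall>i<m. a \<le> u i \<and> u i \<le> v i \<and> v i \<le> b) \<longrightarrow>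
        disjoint_family_on (\<lambda>i. {u i<..<v i}) {..<m} \<longrightarrow>
        (\<Sum>i<m. v i - u i) < \<delta> \<longrightarrow> (\<Sum>i<m. norm (h (v i) - h (u i))) < \<epsilon>"
  proof (intro exI[of _ "min \<delta>1 \<delta>2"] conjI allI impI)
    fix m :: nat and u v
    assume A: "\<forall>i<m. a \<le> u i \<and> u i \<le> v i \<and> v i \<le> b"
      "disjoint_family_on (\<lambda>i. {u i<..<v i}) {..<m}" "(\<Sum>i<m. v i - u i) < min \<delta>1 \<delta>2"
    have "(\<Sum>i<m. norm (h (v i) - h (u i)))
        \<le> (\<Sum>i<m. C * (norm (f (v i) - f (u i)) + norm (g (v i) - g (u i))))"
    proof (rule sum_mono)
      fix i assume "i \<in> {..<m}"
      then have "norm (h (v i) - h (u i)) \<le> B * (norm (f (v i) - f (u i)) + norm (g (v i) - g (u i)))"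
        using A(1) by (intro dom) auto
      also have "\<dots> \<le> C * (norm (f (v i) - f (u i)) + norm (g (v i) - g (u i)))"
        using \<open>B \<le> C\<close> by (intro mult_right_mono) auto
      finally show "norm (h (v i) - h (u i)) \<le> C * (norm (f (v i) - f (u i)) + norm (g (v i) - g (u i)))" .
    qed
    also have "\<dots> = C * ((\<Sum>i<m. norm (f (v i) - f (u i))) + (\<Sum>i<m. norm (g (v i) - g (u i))))"
      by (simp add: sum_distrib_left[symmetric] sum.distrib)
    also have "\<dots> < C * (e + e)"
      using add_strict_mono[OF d1(2)[OF A(1,2)] d2(2)[OF A(1,2)]] A(3) \<open>0 < C\<close> by simp
    also have "\<dots> = \<epsilon>" using \<open>0 < C\<close> by (simp add: e_def)
    finally show "(\<Sum>i<m. norm (h (v i) - h (u i))) < \<epsilon>" .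
  qed (use d1 d2 in simp)
qed

lemma abs_continuous_on_id: "abs_continuous_on_interval a b (\<lambda>x. x)"
  unfolding abs_continuous_on_interval_def
proof (intro allI impI)
  fix \<epsilon> :: real assume "0 < \<epsilon>"
  show "\<exists>\<delta>>0. \<forall>(m::nat) u v. (\<forall>i<m. a \<le> u i \<and> u i \<le> v i \<and> v i \<le> b) \<longrightarrow>
        disjoint_family_on (\<lambda>i. {u i<..<v i}) {..<m} \<longrightarrow>
        (\<Sum>i<m. v i - u i) < \<delta> \<longrightarrow> (\<Sum>i<m. norm (v i - u i)) < \<epsilon>"
    using \<open>0 < \<epsilon>\<close> by (intro exI[of _ \<epsilon>]) auto
qed

lemma locally_abs_continuous_lipschitz:
  assumes "\<And>b. 0 \<le> b \<Longrightarrow> \<exists>B. \<forall>u v. 0 \<le> u \<longrightarrow> u \<le> v \<longrightarrow> v \<le> b \<longrightarrow> norm (h v - h u) \<le> B * (v - u)"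
  shows "locally_abs_continuous h"
  unfolding locally_abs_continuous_def
proof (intro allI impI)
  fix a b :: real assume ab: "0 \<le> a" "a \<le> b"
  then obtain B where B: "\<And>u v. 0 \<le> u \<Longrightarrow> u \<le> v \<Longrightarrow> v \<le> b \<Longrightarrow> norm (h v - h u) \<le> B * (v - u)"
    using assms[of b] by auto
  show "abs_continuous_on_interval a b h"
  proof (rule abs_continuous_on_dominated[OF abs_continuous_on_id abs_continuous_on_id, of _ _ _ "B / 2"])
    fix u v assume "a \<le> u" "u \<le> v" "v \<le> b"
    then show "norm (h v - h u) \<le> B / 2 * (norm (v - u) + norm (v - u))"
      using B[of u v] ab by (simp add: algebra_simps)
  qed
qed

lemma locally_abs_continuous_continuous_on:
  assumes "locally_abs_continuous f"
  shows "continuous_on {0..} f"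
proof -
  have "continuous (at x within {0..}) f" if "x \<in> {0..}" for x
  proof -
    \<comment> \<open>The interval reaches beyond \<open>x\<close>, which makes it a neighbourhood
      of \<open>x\<close> in the half-line.\<close>
    have "continuous_on {0..x+1} f"
      using assms abs_continuous_imp_continuous_on[of 0 "x+1" f] that
      unfolding locally_abs_continuous_def by auto
    then have "continuous (at x within {0..x+1}) f"
      using that by (simp add: continuous_on_eq_continuous_within)
    moreover have "at x within {0..x+1} = at x within {0..}"
      using that by (intro at_within_nhd[of _ "{..<x+1}"]) auto
    ultimately show ?thesis by simp
  qed
  then show ?thesis by (simp add: continuous_on_eq_continuous_within)
qed

lemma locally_abs_continuous_linear:
  assumes "locally_abs_continuous f" "bounded_linear L"
  shows "locally_abs_continuous (\<lambda>x. L (f x))"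
  unfolding locally_abs_continuous_def
proof (intro allI impI)
  fix a b :: real assume ab: "0 \<le> a" "a \<le> b"
  obtain B where B: "\<And>x. norm (L x) \<le> norm x * B" "0 < B"
    using bounded_linear.pos_bounded[OF assms(2)] by auto
  have f: "abs_continuous_on_interval a b f" using assms(1) ab by (auto simp: locally_abs_continuous_def)
  show "abs_continuous_on_interval a b (\<lambda>x. L (f x))"
  proof (rule abs_continuous_on_dominated[OF f f, of _ "B / 2"])
    fix u v
    have "L (f v) - L (f u) = L (f v - f u)"
      using assms(2) by (simp add: bounded_linear.linear linear_diff)
    then show "norm (L (f v) - L (f u)) \<le> B / 2 * (norm (f v - f u) + norm (f v - f u))"
      using B(1)[of "f v - f u"] by (simp add: mult.commute)
  qed
qed

lemma locally_abs_continuous_bilinear: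
  assumes f: "locally_abs_continuous f" and g: "locally_abs_continuous g"
    and "bounded_bilinear p"
  shows "locally_abs_continuous (\<lambda>x. p (f x) (g x))"
  unfolding locally_abs_continuous_def
proof (intro allI impI)
  fix a b :: real assume ab: "0 \<le> a" "a \<le> b"
  interpret bounded_bilinear p by fact
  obtain K where K: "\<And>x y. norm (p x y) \<le> norm x * norm y * K" "0 < K" using pos_bounded by auto
  have F: "abs_continuous_on_interval a b f" and G: "abs_continuous_on_interval a b g"
    using f g ab by (auto simp: locally_abs_continuous_def)
  have "bounded (f ` {a..b})" "bounded (g ` {a..b})"
    using abs_continuous_imp_continuous_on[OF F] abs_continuous_imp_continuous_on[OF G]
    by (auto intro!: compact_imp_bounded compact_continuous_image)
  then obtain M1 M2 where M: "\<And>x. x \<in> {a..b} \<Longrightarrow> norm (f x) \<le> M1" "\<And>x. x \<in> {a..b} \<Longrightarrow> norm (g x) \<le> M2"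
    unfolding bounded_iff by blast
  define M where "M = max M1 M2"
  have M: "\<And>x. x \<in> {a..b} \<Longrightarrow> norm (f x) \<le> M" "\<And>x. x \<in> {a..b} \<Longrightarrow> norm (g x) \<le> M"
    using M by (auto simp: M_def le_max_iff_disj)
  show "abs_continuous_on_interval a b (\<lambda>x. p (f x) (g x))"
  proof (rule abs_continuous_on_dominated[OF F G, of _ "K * M"])
    fix u v assume uv: "a \<le> u" "u \<le> v" "v \<le> b"
    have "p (f v) (g v) - p (f u) (g u) = p (f v - f u) (g v) + p (f u) (g v - g u)"
      by (simp add: diff_left diff_right)
    then have "norm (p (f v) (g v) - p (f u) (g u)) \<le> norm (p (f v - f u) (g v)) + norm (p (f u) (g v - g u))"
      by (metis norm_triangle_ineq)
    also have "\<dots> \<le> norm (f v - f u) * norm (g v) * K + norm (f u) * norm (g v - g u) * K"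
      by (intro add_mono K(1))
    also have "\<dots> \<le> norm (f v - f u) * M * K + M * norm (g v - g u) * K"
      using uv M K(2) by (intro add_mono mult_right_mono mult_left_mono) auto
    finally show "norm (p (f v) (g v) - p (f u) (g u)) \<le> K * M * (norm (f v - f u) + norm (g v - g u))"
      by (simp add: algebra_simps)
  qed
qed

lemma locally_abs_continuous_add:
  assumes f: "locally_abs_continuous f" and g: "locally_abs_continuous g"
  shows "locally_abs_continuous (\<lambda>x. f x + g x)"
  unfolding locally_abs_continuous_def
proof (intro allI impI)
  fix a b :: real assume ab: "0 \<le> a" "a \<le> b"
  have F: "abs_continuous_on_interval a b f" and G: "abs_continuous_on_interval a b g"
    using f g ab by (auto simp: locally_abs_continuous_def)
  show "abs_continuous_on_interval a b (\<lambda>x. f x + g x)"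
    by (rule abs_continuous_on_dominated[OF F G, of _ 1])
       (simp add: add_diff_add norm_triangle_ineq)
qed

section \<open>The Hermitian product and block vectors\<close>

definition cdot :: "complex^'n \<Rightarrow> complex^'n \<Rightarrow> complex" where
  "cdot x y = (\<Sum>s\<in>UNIV. x $ s * cnj (y $ s))"

lemma cdot_simps:
  "cdot (x + y) z = cdot x z + cdot y z" "cdot z (x + y) = cdot z x + cdot z y"
  "cdot (x - y) z = cdot x z - cdot y z" "cdot z (x - y) = cdot z x - cdot z y"
  "cdot (- x) z = - cdot x z" "cdot z (- x) = - cdot z x"
  "cdot (c *s x) z = c * cdot x z" "cdot z (c *s x) = cnj c * cdot z x"
  "cdot 0 z = 0" "cdot z 0 = 0"
  by (auto simp: cdot_def sum.distrib sum_subtractf sum_negf sum_distrib_left algebra_simps)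

lemma norm_vec_squared: "(norm (x :: complex^'n))\<^sup>2 = (\<Sum>s\<in>UNIV. (cmod (x $ s))\<^sup>2)"
  by (simp add: norm_vec_def L2_set_def sum_nonneg)

lemma cdot_self: "cdot x x = of_real ((norm x)\<^sup>2)"
  unfolding norm_vec_squared cdot_def of_real_sum complex_norm_square ..

lemma norm_cdot_le: "cmod (cdot x y) \<le> norm x * norm y"
proof -
  have "cmod (cdot x y) \<le> (\<Sum>s\<in>UNIV. \<bar>cmod (x $ s)\<bar> * \<bar>cmod (y $ s)\<bar>)"
    unfolding cdot_def by (rule order_trans[OF norm_sum]) (simp add: norm_mult)
  also have "\<dots> \<le> norm x * norm y"
    unfolding norm_vec_def by (rule L2_set_mult_ineq)
  finally show ?thesis .
qed

text \<open>Boundedness refers to real scalars, so the conjugate linearity in the second argument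
  does no harm. Product rule, continuity and integration for the Hermitian product all come from
  here.\<close>

lemma bounded_bilinear_cdot: "bounded_bilinear cdot"
proof
  fix r x y show "cdot (r *\<^sub>R x) y = r *\<^sub>R cdot x y"
    by (simp add: cdot_def scaleR_sum_right)
  fix r x y show "cdot x (r *\<^sub>R y) = r *\<^sub>R cdot x y"
    by (simp add: cdot_def scaleR_sum_right)
  show "\<exists>K. \<forall>a b. norm (cdot a b) \<le> norm a * norm b * K"
    using norm_cdot_le by (intro exI[of _ 1]) auto
qed (auto simp: cdot_simps)

lemma cdot_matrix_left: "cdot (A *v x) y = cdot x (conj_transpose A *v y)"
proof -
  have "cdot (A *v x) y = (\<Sum>i\<in>UNIV. \<Sum>j\<in>UNIV. A $ i $ j * x $ j * cnj (y $ i))"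
    by (simp add: cdot_def matrix_vector_mult_def sum_distrib_right)
  also have "\<dots> = (\<Sum>j\<in>UNIV. \<Sum>i\<in>UNIV. A $ i $ j * x $ j * cnj (y $ i))" by (rule sum.swap)
  also have "\<dots> = cdot x (conj_transpose A *v y)"
    by (simp add: cdot_def matrix_vector_mult_def conj_transpose_def sum_distrib_left mult.assoc mult.left_commute)
  finally show ?thesis .
qed

lemma conj_transpose_involutive: "conj_transpose (conj_transpose A) = A"
  by (simp add: conj_transpose_def vec_eq_iff)

lemma cdot_matrix_right: "cdot x (A *v y) = cdot (conj_transpose A *v x) y"
  by (simp add: cdot_matrix_left conj_transpose_involutive)

lemma conj_transpose_mult: "conj_transpose (A ** B) = conj_transpose B ** conj_transpose A"
  by (simp add: conj_transpose_def matrix_matrix_mult_def vec_eq_iff mult.commute)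

lemma cdot_eqI: "(\<And>z. cdot x z = cdot y z) \<Longrightarrow> x = y"
  using cdot_self[of "x - y"] by (simp add: cdot_simps)

lemma bounded_bilinear_matrix_vector:
  "bounded_bilinear (\<lambda>(A :: complex^'m^'n) x. A *v x)"
  unfolding bilinear_conv_bounded_bilinear[symmetric] bilinear_def
  by (auto intro!: linearI simp: matrix_vector_mult_def vec_eq_iff sum.distrib algebra_simps scaleR_sum_right)

lemma bounded_bilinear_matrix_matrix:
  "bounded_bilinear (\<lambda>(A :: complex^'m^'n) (B :: complex^'k^'m). A ** B)"
  unfolding bilinear_conv_bounded_bilinear[symmetric] bilinear_def
  by (auto intro!: linearI simp: matrix_matrix_mult_def vec_eq_iff sum.distrib algebra_simps scaleR_sum_right)

lemma bounded_linear_conj_transpose: "bounded_linear (conj_transpose :: complex^'m^'n \<Rightarrow> _)"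
  unfolding linear_conv_bounded_linear[symmetric]
  by (auto intro!: linearI simp: conj_transpose_def vec_eq_iff)

section \<open>Block vectors, block matrices and the symplectic matrix\<close>

text \<open>The entry type is left open on purpose: a matrix is a vector of rows, and its
  \<open>upper\<close> is the block of its first n rows.\<close>

definition upper :: "'a^('n + 'n) \<Rightarrow> 'a^'n" where "upper Y = (\<chi> i. Y $ Inl i)"
definition lower :: "'a^('n + 'n) \<Rightarrow> 'a^'n" where "lower Y = (\<chi> i. Y $ Inr i)"
definition stack :: "'a^'n \<Rightarrow> 'a^'n \<Rightarrow> 'a^('n + 'n)" where
  "stack f g = (\<chi> k. case k of Inl i \<Rightarrow> f $ i | Inr i \<Rightarrow> g $ i)"

lemma upper_stack [simp]: "upper (stack f g) = f"
  and lower_stack [simp]: "lower (stack f g) = g"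
  by (simp_all add: upper_def lower_def stack_def vec_eq_iff)

lemma block_eqI: "upper Y = upper Z \<Longrightarrow> lower Y = lower Z \<Longrightarrow> Y = Z"
  by (simp add: upper_def lower_def vec_eq_iff) (metis sum.exhaust)

lemma stack_upper_lower [simp]: "stack (upper Y) (lower Y) = Y"
  by (rule block_eqI) simp_all

lemma bounded_linear_upper: "bounded_linear (upper :: 'a::euclidean_space^('n::finite + 'n) \<Rightarrow> _)"
  and bounded_linear_lower: "bounded_linear (lower :: 'a::euclidean_space^('n::finite + 'n) \<Rightarrow> _)"
  unfolding linear_conv_bounded_linear[symmetric]
  by (auto intro!: linearI simp: upper_def lower_def vec_eq_iff)

lemma bounded_linear_stack:
  "bounded_linear (\<lambda>g :: 'a::euclidean_space^'n. stack 0 g)"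
  "bounded_linear (\<lambda>g :: 'a::euclidean_space^'n. stack g 0)"
  unfolding linear_conv_bounded_linear[symmetric]
  by (auto intro!: linearI simp: stack_def vec_eq_iff split: sum.split)

lemma block_simps:
  "upper (x + y) = upper x + upper y" "lower (x + y) = lower x + lower y"
  "upper (x - y) = upper x - upper y" "lower (x - y) = lower x - lower y"
  "upper (- x) = - upper x" "lower (- x) = - lower x"
  "upper 0 = 0" "lower 0 = 0"
  by (auto simp: upper_def lower_def vec_eq_iff)

lemma block_scale: "upper (c *s x) = c *s upper x" "lower (c *s x) = c *s lower x"
  by (auto simp: upper_def lower_def vec_eq_iff)

lemma block_mult: "upper (F *v c) = upper F *v c" "lower (F *v c) = lower F *v c"
  "upper (F ** C) = upper F ** C"
  by (simp_all add: upper_def lower_def matrix_vector_mult_def matrix_matrix_mult_def vec_eq_iff)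

lemma sum_UNIV_sum:
  "(\<Sum>k\<in>(UNIV :: ('a::finite + 'b::finite) set). f k) = (\<Sum>i\<in>UNIV. f (Inl i)) + (\<Sum>i\<in>UNIV. f (Inr i))"
proof -
  have "sum f (UNIV <+> UNIV) = (\<Sum>i\<in>UNIV. f (Inl i)) + (\<Sum>i\<in>UNIV. f (Inr i))"
    by (subst sum.Plus) (simp_all add: comp_def)
  then show ?thesis by (simp only: UNIV_Plus_UNIV)
qed

lemma cdot_block: "cdot Y Z = cdot (upper Y) (upper Z) + cdot (lower Y) (lower Z)"
  by (simp add: cdot_def upper_def lower_def sum_UNIV_sum)

definition symplectic :: "complex^('n::finite + 'n)^('n + 'n)" where
  "symplectic = (\<chi> a b. case a of Inl i \<Rightarrow> (case b of Inl j \<Rightarrow> 0 | Inr j \<Rightarrow> if i = j then -1 else 0)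
      | Inr i \<Rightarrow> (case b of Inl j \<Rightarrow> if i = j then 1 else 0 | Inr j \<Rightarrow> 0))"

lemma symplectic_mult: "symplectic *v Y = stack (- lower Y) (upper Y)"
  by (rule block_eqI)
     (simp_all add: symplectic_def matrix_vector_mult_def vec_eq_iff upper_def lower_def stack_def sum_UNIV_sum
        if_distrib if_distribR cong: if_cong)

lemma matrix_eqI: "(\<And>x. A *v x = B *v x) \<Longrightarrow> A = (B :: complex^'m^'n)"
  by (simp add: matrix_eq)

lemma symplectic_square: "symplectic ** symplectic = - mat 1"
proof (rule matrix_eqI)
  fix x :: "complex^('a + 'a)"
  have "(- mat 1) *v x = - x"
    using bounded_bilinear.minus_left[OF bounded_bilinear_matrix_vector, of "mat 1" x] by simp
  then show "(symplectic ** symplectic) *v x = (- mat 1) *v x"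
    by (auto intro!: block_eqI simp: matrix_vector_mul_assoc[symmetric] symplectic_mult block_simps)
qed

lemma conj_transpose_symplectic: "conj_transpose symplectic = - symplectic"
  by (auto simp: conj_transpose_def symplectic_def vec_eq_iff split: sum.splits)

text \<open>The boundary form of the Lagrange identity, for \<open>Y\<close> and \<open>Z\<close>
  consisting of a function and its first quasi-derivative.\<close>

definition bracket :: "complex^('n::finite + 'n) \<Rightarrow> complex^('n + 'n) \<Rightarrow> complex" where
  "bracket Y Z = cdot (upper Y) (lower Z) - cdot (lower Y) (upper Z)"

lemma bracket_symplectic: "bracket Y Z = cdot (symplectic *v Y) Z"
  by (simp add: bracket_def cdot_block symplectic_mult cdot_simps)

interpretation mv: bounded_bilinear "(*v) :: complex^'m^'n \<Rightarrow> complex^'m \<Rightarrow> complex^'n"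
  by (rule bounded_bilinear_matrix_vector)
interpretation mm: bounded_bilinear "(**) :: complex^'m^'n \<Rightarrow> complex^'k^'m \<Rightarrow> complex^'k^'n"
  by (rule bounded_bilinear_matrix_matrix)
interpretation cdot: bounded_bilinear cdot
  by (rule bounded_bilinear_cdot)
lemma mv_scale: "A *v (c *s x) = c *s (A *v x)" for A :: "complex^'m^'n"
  by (simp add: matrix_vector_mult_def vec_eq_iff sum_distrib_left mult.left_commute)

lemma mat_mult_vec: "mat c *v x = c *s (x :: complex^'n)"
  by (simp add: matrix_vector_mult_def mat_def vec_eq_iff if_distrib if_distribR cong: if_cong)

lemma bounded_linear_scale: "bounded_linear (\<lambda>x. c *s (x :: complex^'k))"
  unfolding linear_conv_bounded_linear[symmetric]
  by (auto intro!: linearI simp: vec_eq_iff algebra_simps)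

lemma locally_abs_continuous_const: "locally_abs_continuous (\<lambda>x. c)"
  by (rule locally_abs_continuous_lipschitz) (auto intro: exI[of _ 0])

lemma locally_abs_continuous_sum:
  assumes "finite I" "\<And>i. i \<in> I \<Longrightarrow> locally_abs_continuous (f i)"
  shows "locally_abs_continuous (\<lambda>x. \<Sum>i\<in>I. f i x)"
  using assms by (induction I) (auto intro!: locally_abs_continuous_const locally_abs_continuous_add)

section \<open>Solutions and the Lagrange identity\<close>

lemma AE_halfline_iff:
  "(AE x in lebesgue_on {0..}. p x) \<longleftrightarrow> (\<exists>S. negligible S \<and> (\<forall>x::real. 0 \<le> x \<longrightarrow> x \<notin> S \<longrightarrow> p x))"
proof -
  have "(AE x in lebesgue_on {0..}. p x) \<longleftrightarrow> (AE x in lebesgue. x \<in> {0..} \<longrightarrow> p x)"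
    by (rule AE_restrict_space_iff) simp
  also have "\<dots> \<longleftrightarrow> (\<exists>S. negligible S \<and> (\<forall>x::real. 0 \<le> x \<longrightarrow> x \<notin> S \<longrightarrow> p x))"
    unfolding eventually_ae_filter negligible_iff_null_sets by auto
  finally show ?thesis .
qed

text \<open>A nonempty open interval is not negligible, so the points outside \<open>S\<close> are
  dense, and continuity extends the equality to all of the interval including its ends.\<close>

lemma continuous_eq_from_negligible:
  fixes f g :: "real \<Rightarrow> 'a::real_normed_vector"
  assumes "negligible S" "a < b" "continuous_on {a..b} f" "continuous_on {a..b} g"
    "\<And>x. a < x \<Longrightarrow> x < b \<Longrightarrow> x \<notin> S \<Longrightarrow> f x = g x" "x \<in> {a..b}"
  shows "f x = g x"
proof -
  have sub: "closure ({a<..<b} - S) \<subseteq> {a..b}"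
    by (rule closure_minimal) auto
  have xc: "x \<in> closure ({a<..<b} - S)"
    unfolding closure_approachable
  proof (intro allI impI)
    fix e :: real assume "0 < e"
    define I where "I = {max a (x - e)<..<min b (x + e)}"
    have "max a (x - e) < min b (x + e)" using \<open>0 < e\<close> assms(2,6) by auto
    then have "I \<noteq> {}" by (simp only: I_def greaterThanLessThan_empty_iff not_le not_False_eq_True)
    then have "\<not> negligible I" by (simp add: open_not_negligible I_def)
    then obtain y where "y \<in> I" "y \<notin> S" using negligible_subset[OF assms(1)] by blast
    then show "\<exists>y\<in>{a<..<b} - S. dist y x < e"
      by (intro bexI[of _ y]) (auto simp: I_def dist_real_def)
  qed
  have c: "continuous_on (closure ({a<..<b} - S)) (\<lambda>x. f x - g x)"
    by (intro continuous_on_diff continuous_on_subset[OF _ sub] assms)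
  have "f x - g x = 0"
    by (rule continuous_constant_on_closure[OF c _ xc]) (use assms(5) in auto)
  then show ?thesis by simp
qed

lemma has_vector_derivative_zero_interval:
  assumes "(f has_vector_derivative f') (at x)" "a < x" "x < b" "\<And>y. a < y \<Longrightarrow> y < b \<Longrightarrow> f y = 0"
  shows "f' = 0"
proof -
  have "((\<lambda>x. 0) has_vector_derivative f') (at x)"
    by (rule has_vector_derivative_transform_within_open[OF assms(1), of "{a<..<b}"]) (use assms in auto)
  then show ?thesis
    by (metis has_vector_derivative_const vector_derivative_unique_at)
qed

section \<open>Quasi-derivatives, solutions and the constant bracket\<close>

locale quasi_expression =
  fixes P Q R :: "real \<Rightarrow> complex^'n^'n"
  assumes hermitian_P: "\<And>x. 0 \<le> x \<Longrightarrow> conj_transpose (P x) = P x"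
    and hermitian_Q: "\<And>x. 0 \<le> x \<Longrightarrow> conj_transpose (Q x) = Q x"
begin

text \<open>This is \<open>l_value\<close> with the quasi-derivative named instead of quantified
  away, because brackets and initial values depend on it.\<close>

definition image_pair :: "(real \<Rightarrow> complex^'n) \<Rightarrow> (real \<Rightarrow> complex^'n) \<Rightarrow> (real \<Rightarrow> complex^'n) \<Rightarrow> bool" where
  "image_pair f g h \<longleftrightarrow> quasi_derivative P R f g \<and>
       (AE x in lebesgue_on {0..}. \<exists>g'. (g has_vector_derivative g') (at x) \<and>
          h x = - (g' + conj_transpose (R x) *v g x - Q x *v f x))"

text \<open>Both almost-everywhere relations at one point, sharing the derivatives. They then need
  only one exceptional set, which can be united with those of other functions.\<close>

definition pointwise_image :: "real \<Rightarrow> (real \<Rightarrow> complex^'n) \<Rightarrow> (real \<Rightarrow> complex^'n) \<Rightarrow> complex^'n \<Rightarrow> bool" where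
  "pointwise_image x f g h \<longleftrightarrow> (\<exists>f' g'. (f has_vector_derivative f') (at x) \<and> (g has_vector_derivative g') (at x) \<and>
     g x = P x *v (f' - R x *v f x) \<and> h = - (g' + conj_transpose (R x) *v g x - Q x *v f x))"

lemma l_value_iff: "l_value P Q R f h \<longleftrightarrow> (\<exists>g. image_pair f g h)"
  by (simp add: l_value_def image_pair_def)

lemma image_pair_iff:
  "image_pair f g h \<longleftrightarrow> locally_abs_continuous f \<and> locally_abs_continuous g \<and>
     (\<exists>S. negligible S \<and> (\<forall>x\<ge>0. x \<notin> S \<longrightarrow> pointwise_image x f g (h x)))"
proof -
  have "image_pair f g h \<longleftrightarrow> locally_abs_continuous f \<and> locally_abs_continuous g \<and>
     (AE x in lebesgue_on {0..}. pointwise_image x f g (h x))"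
    unfolding image_pair_def quasi_derivative_def pointwise_image_def conj_assoc AE_conj_iff[symmetric]
    by (intro conj_cong refl AE_cong) blast
  then show ?thesis unfolding AE_halfline_iff by simp
qed

definition solves :: "complex \<Rightarrow> (real \<Rightarrow> complex^('n + 'n)) \<Rightarrow> bool" where
  "solves \<mu> Y \<longleftrightarrow> image_pair (\<lambda>x. upper (Y x)) (\<lambda>x. lower (Y x)) (\<lambda>x. \<mu> *s upper (Y x))"

text \<open>In the derivative of the bracket the terms with \<open>P\<close> and \<open>Q\<close>
  cancel by symmetry and those with \<open>R\<close> cancel against those with its adjoint; what is
  left is the integrand.\<close>

lemma lagrange:
  assumes "image_pair f g h" "image_pair u v k" "0 \<le> a" "a \<le> b"
  shows "((\<lambda>x. cdot (h x) (u x) - cdot (f x) (k x)) has_integral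
      (cdot (f b) (v b) - cdot (g b) (u b)) - (cdot (f a) (v a) - cdot (g a) (u a))) {a..b}"
proof -
  obtain S1 where 1: "negligible S1" "\<forall>x\<ge>0. x \<notin> S1 \<longrightarrow> pointwise_image x f g (h x)"
    "locally_abs_continuous f" "locally_abs_continuous g"
    using assms(1) unfolding image_pair_iff by blast
  obtain S2 where 2: "negligible S2" "\<forall>x\<ge>0. x \<notin> S2 \<longrightarrow> pointwise_image x u v (k x)"
    "locally_abs_continuous u" "locally_abs_continuous v"
    using assms(2) unfolding image_pair_iff by blast
  have minus: "locally_abs_continuous (\<lambda>x. - cdot (g x) (u x))"
    by (rule locally_abs_continuous_linear[OF locally_abs_continuous_bilinear[OF 1(4) 2(3) bounded_bilinear_cdot]])
       (simp add: bounded_linear_minus)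
  have "locally_abs_continuous (\<lambda>x. cdot (f x) (v x) - cdot (g x) (u x))"
    using locally_abs_continuous_add[OF locally_abs_continuous_bilinear[OF 1(3) 2(4) bounded_bilinear_cdot] minus]
    by simp
  then have ac: "abs_continuous_on_interval a b (\<lambda>x. cdot (f x) (v x) - cdot (g x) (u x))"
    using assms unfolding locally_abs_continuous_def by blast
  show ?thesis
  proof (rule fundamental_theorem_of_calculus_abs_continuous[OF assms(4) ac, of "S1 \<union> S2"])
    fix x assume "x \<in> {a..b} - (S1 \<union> S2)"
    then have x: "0 \<le> x" "x \<notin> S1" "x \<notin> S2" using assms by auto
    obtain f' g' where fg: "(f has_vector_derivative f') (at x)" "(g has_vector_derivative g') (at x)"
       "g x = P x *v (f' - R x *v f x)" "h x = - (g' + conj_transpose (R x) *v g x - Q x *v f x)"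
      using 1(2) x unfolding pointwise_image_def by blast
    obtain u' v' where uv: "(u has_vector_derivative u') (at x)" "(v has_vector_derivative v') (at x)"
       "v x = P x *v (u' - R x *v u x)" "k x = - (v' + conj_transpose (R x) *v v x - Q x *v u x)"
      using 2(2) x unfolding pointwise_image_def by blast
    \<comment> \<open>Both quasi-derivatives have the factor \<open>P x\<close>, which moves across
      the product because it is Hermitian. This handles the derivatives \<open>f'\<close> and
      \<open>u'\<close> without inverting \<open>P\<close>.\<close>
    have "cdot (f' - R x *v f x) (v x) = cdot (g x) (u' - R x *v u x)"
      unfolding fg(3) uv(3) using hermitian_P[OF x(1)] by (simp add: cdot_matrix_right)
    moreover have "cdot (Q x *v f x) (u x) = cdot (f x) (Q x *v u x)"
      using hermitian_Q[OF x(1)] by (simp add: cdot_matrix_right)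
    moreover have "cdot (R x *v f x) (v x) = cdot (f x) (conj_transpose (R x) *v v x)"
      by (rule cdot_matrix_left)
    moreover have "cdot (g x) (R x *v u x) = cdot (conj_transpose (R x) *v g x) (u x)"
      by (rule cdot_matrix_right)
    ultimately have "cdot (h x) (u x) - cdot (f x) (k x)
      = (cdot (f x) v' + cdot f' (v x)) - (cdot (g x) u' + cdot g' (u x))"
      unfolding fg(4) uv(4) by (simp add: cdot_simps algebra_simps) 
    moreover have "((\<lambda>x. cdot (f x) (v x) - cdot (g x) (u x)) has_vector_derivative
       (cdot (f x) v' + cdot f' (v x)) - (cdot (g x) u' + cdot g' (u x))) (at x)"
      by (intro has_vector_derivative_diff cdot.has_vector_derivative fg uv)
    ultimately show "((\<lambda>x. cdot (f x) (v x) - cdot (g x) (u x)) has_vector_derivative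
      cdot (h x) (u x) - cdot (f x) (k x)) (at x within {a..b})"
      by (metis has_vector_derivative_at_within)
  qed (use 1 2 in auto)
qed

lemma image_pair_continuous:
  assumes "image_pair f g h"
  shows "continuous_on {0..} f" "continuous_on {0..} g"
  using assms by (auto simp: image_pair_iff intro: locally_abs_continuous_continuous_on)

text \<open>Where \<open>f\<close> vanishes on an open interval its derivative vanishes too, so
  \<open>g\<close> is zero almost everywhere there. Continuity carries this to the end points, where
  boundary and initial values are read off.\<close>

lemma quasi_derivative_zero:
  assumes fg: "quasi_derivative P R f g" and "0 \<le> a" "a < b" "\<And>x. a < x \<Longrightarrow> x < b \<Longrightarrow> f x = 0" "x \<in> {a..b}"
  shows "f x = 0" "g x = 0"
proof -
  obtain S where S: "negligible S" "\<And>x. 0 \<le> x \<Longrightarrow> x \<notin> S \<Longrightarrow>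
      \<exists>f'. (f has_vector_derivative f') (at x) \<and> g x = P x *v (f' - R x *v f x)"
    using fg unfolding quasi_derivative_def AE_halfline_iff by blast
  have c: "continuous_on {a..b} f" "continuous_on {a..b} g"
    using fg assms(2) unfolding quasi_derivative_def
    by (auto intro!: continuous_on_subset[OF locally_abs_continuous_continuous_on])
  show "f x = 0"
    by (rule continuous_eq_from_negligible[of "{}" a b f "\<lambda>_. 0"]) (use assms c in auto)
  have "g y = 0" if y: "a < y" "y < b" "y \<notin> S" for y
  proof -
    obtain f' where f': "(f has_vector_derivative f') (at y)" "g y = P y *v (f' - R y *v f y)"
      using S(2)[of y] y assms(2) by auto
    then have "f' = 0" using has_vector_derivative_zero_interval[OF f'(1) y(1,2)] assms by auto
    then show ?thesis using f'(2) assms(4) y by (simp add: mv.zero_right)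
  qed
  then show "g x = 0"
    using continuous_eq_from_negligible[of S a b g "\<lambda>_. 0" x] S(1) assms c by simp
qed

text \<open>Two representatives agree almost everywhere to the right of \<open>x\<close>, hence at
  \<open>x\<close> by continuity; looking only to the right includes the point 0.\<close>

lemma quasi_derivative_unique:
  assumes "quasi_derivative P R f g1" "quasi_derivative P R f g2" "0 \<le> x"
  shows "g1 x = g2 x"
proof -
  obtain S1 where S1: "negligible S1" "\<And>x. 0 \<le> x \<Longrightarrow> x \<notin> S1 \<Longrightarrow>
      \<exists>f'. (f has_vector_derivative f') (at x) \<and> g1 x = P x *v (f' - R x *v f x)"
    using assms(1) unfolding quasi_derivative_def AE_halfline_iff by blast
  obtain S2 where S2: "negligible S2" "\<And>x. 0 \<le> x \<Longrightarrow> x \<notin> S2 \<Longrightarrow>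
      \<exists>f'. (f has_vector_derivative f') (at x) \<and> g2 x = P x *v (f' - R x *v f x)"
    using assms(2) unfolding quasi_derivative_def AE_halfline_iff by blast
  show ?thesis
  proof (rule continuous_eq_from_negligible[of "S1 \<union> S2" x "x + 1" g1 g2 x])
    show "continuous_on {x..x + 1} g1" "continuous_on {x..x + 1} g2"
      using assms unfolding quasi_derivative_def
      by (auto intro!: continuous_on_subset[OF locally_abs_continuous_continuous_on])
    show "g1 y = g2 y" if "x < y" "y < x + 1" "y \<notin> S1 \<union> S2" for y
      using S1(2)[of y] S2(2)[of y] that assms(3) vector_derivative_unique_at by force
  qed (use S1 S2 in auto)
qed

text \<open>Conjugating the second parameter compensates the conjugate linearity of the second
  argument, so that the integrand of the Lagrange identity is zero.\<close>

lemma solves_bracket_const: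
  assumes "solves \<mu> Y" "solves (cnj \<mu>) Z" "0 \<le> x" "0 \<le> y"
  shows "bracket (Y x) (Z x) = bracket (Y y) (Z y)"
proof -
  have *: "bracket (Y b) (Z b) = bracket (Y 0) (Z 0)" if "0 \<le> b" for b
  proof -
    have "((\<lambda>x. 0) has_integral bracket (Y b) (Z b) - bracket (Y 0) (Z 0)) {0..b}"
      using lagrange[OF assms(1,2)[unfolded solves_def] order_refl that]
      by (simp add: cdot_simps bracket_def)
    then show ?thesis by (metis has_integral_0_eq right_minus_eq)
  qed
  show ?thesis using *[OF assms(3)] *[OF assms(4)] by simp
qed

lemma solves_add:
  assumes "solves \<mu> Y" "solves \<mu> Z"
  shows "solves \<mu> (\<lambda>x. Y x + Z x)"
proof -
  obtain S1 where 1: "negligible S1" "\<And>x. 0 \<le> x \<Longrightarrow> x \<notin> S1 \<Longrightarrow>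
       pointwise_image x (\<lambda>x. upper (Y x)) (\<lambda>x. lower (Y x)) (\<mu> *s upper (Y x))"
    "locally_abs_continuous (\<lambda>x. upper (Y x))" "locally_abs_continuous (\<lambda>x. lower (Y x))"
    using assms(1) unfolding image_pair_iff solves_def by blast
  obtain S2 where 2: "negligible S2" "\<And>x. 0 \<le> x \<Longrightarrow> x \<notin> S2 \<Longrightarrow>
       pointwise_image x (\<lambda>x. upper (Z x)) (\<lambda>x. lower (Z x)) (\<mu> *s upper (Z x))"
    "locally_abs_continuous (\<lambda>x. upper (Z x))" "locally_abs_continuous (\<lambda>x. lower (Z x))"
    using assms(2) unfolding image_pair_iff solves_def by blast
  show ?thesis
    unfolding solves_def image_pair_iff block_simps
  proof (intro conjI exI[of _ "S1 \<union> S2"] allI impI)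
    fix x assume x: "0 \<le> x" "x \<notin> S1 \<union> S2"
    obtain f' g' where fg: "((\<lambda>x. upper (Y x)) has_vector_derivative f') (at x)" "((\<lambda>x. lower (Y x)) has_vector_derivative g') (at x)"
       "lower (Y x) = P x *v (f' - R x *v upper (Y x))" "\<mu> *s upper (Y x) = - (g' + conj_transpose (R x) *v lower (Y x) - Q x *v upper (Y x))"
      using 1(2) x unfolding pointwise_image_def by blast
    obtain u' v' where uv: "((\<lambda>x. upper (Z x)) has_vector_derivative u') (at x)" "((\<lambda>x. lower (Z x)) has_vector_derivative v') (at x)"
       "lower (Z x) = P x *v (u' - R x *v upper (Z x))" "\<mu> *s upper (Z x) = - (v' + conj_transpose (R x) *v lower (Z x) - Q x *v upper (Z x))"
      using 2(2) x unfolding pointwise_image_def by blast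
    show "pointwise_image x (\<lambda>x. upper (Y x) + upper (Z x)) (\<lambda>x. lower (Y x) + lower (Z x)) (\<mu> *s (upper (Y x) + upper (Z x)))"
      unfolding pointwise_image_def
    proof (intro exI conjI)
      show "((\<lambda>x. upper (Y x) + upper (Z x)) has_vector_derivative f' + u') (at x)"
        "((\<lambda>x. lower (Y x) + lower (Z x)) has_vector_derivative g' + v') (at x)"
        by (intro has_vector_derivative_add fg uv)+
      show "lower (Y x) + lower (Z x) = P x *v (f' + u' - R x *v (upper (Y x) + upper (Z x)))"
        by (subst fg(3), subst uv(3)) (simp add: mv.add_right mv.diff_right)
      show "\<mu> *s (upper (Y x) + upper (Z x)) = - (g' + v' + conj_transpose (R x) *v (lower (Y x) + lower (Z x)) - Q x *v (upper (Y x) + upper (Z x)))"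
        unfolding vector_add_ldistrib fg(4) uv(4) by (simp add: mv.add_right)
    qed
  qed (use 1 2 in \<open>auto intro: locally_abs_continuous_add\<close>)
qed

lemma solves_scale:
  assumes "solves \<mu> Y"
  shows "solves \<mu> (\<lambda>x. c *s Y x)"
proof -
  obtain S1 where 1: "negligible S1" "\<And>x. 0 \<le> x \<Longrightarrow> x \<notin> S1 \<Longrightarrow>
       pointwise_image x (\<lambda>x. upper (Y x)) (\<lambda>x. lower (Y x)) (\<mu> *s upper (Y x))"
    "locally_abs_continuous (\<lambda>x. upper (Y x))" "locally_abs_continuous (\<lambda>x. lower (Y x))"
    using assms(1) unfolding image_pair_iff solves_def by blast
  show ?thesis
    unfolding solves_def image_pair_iff block_scale
  proof (intro conjI exI[of _ S1] allI impI)
    fix x assume x: "0 \<le> x" "x \<notin> S1"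
    obtain f' g' where fg: "((\<lambda>x. upper (Y x)) has_vector_derivative f') (at x)" "((\<lambda>x. lower (Y x)) has_vector_derivative g') (at x)"
       "lower (Y x) = P x *v (f' - R x *v upper (Y x))" "\<mu> *s upper (Y x) = - (g' + conj_transpose (R x) *v lower (Y x) - Q x *v upper (Y x))"
      using 1(2) x unfolding pointwise_image_def by blast
    show "pointwise_image x (\<lambda>x. c *s upper (Y x)) (\<lambda>x. c *s lower (Y x)) (\<mu> *s (c *s upper (Y x)))"
      unfolding pointwise_image_def
    proof (intro exI conjI)
      show "((\<lambda>x. c *s upper (Y x)) has_vector_derivative c *s f') (at x)"
        "((\<lambda>x. c *s lower (Y x)) has_vector_derivative c *s g') (at x)"
        by (intro bounded_linear.has_vector_derivative[OF bounded_linear_scale] fg)+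
      show "c *s lower (Y x) = P x *v (c *s f' - R x *v (c *s upper (Y x)))"
        by (subst fg(3)) (simp add: mv_scale mv.diff_right vec_eq_iff algebra_simps)
      have "\<mu> *s (c *s upper (Y x)) = c *s (\<mu> *s upper (Y x))" by (simp add: vec_eq_iff)
      then show "\<mu> *s (c *s upper (Y x)) = - (c *s g' + conj_transpose (R x) *v (c *s lower (Y x)) - Q x *v (c *s upper (Y x)))"
        unfolding fg(4) by (simp add: mv_scale vec_eq_iff algebra_simps)
    qed
  qed (use 1 in \<open>auto intro: locally_abs_continuous_linear[OF _ bounded_linear_scale]\<close>)
qed

end

section \<open>Fundamental matrices\<close>

text \<open>A matrix is the sum of its single columns, so absolute continuity and derivatives pass
  from columns to the matrix through these linear maps.\<close>

lemma bounded_linear_single_column: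
  "bounded_linear (\<lambda>v :: complex^'n. (\<chi> i j. if j = k then v $ i else 0) :: complex^'m^'n)"
  unfolding linear_conv_bounded_linear[symmetric]
  by (auto intro!: linearI simp: vec_eq_iff)

lemma column_mult_axis: "F *v axis k 1 = column k (F :: complex^'m^'n)"
  by (simp add: column_def vec_eq_iff matrix_vector_mult_def axis_def if_distrib cong: if_cong)

context quasi_expression
begin

text \<open>The equations of \<open>solves\<close> for all columns at once, with a common
  exceptional set and normalised at 0.\<close>

definition fundamental :: "complex \<Rightarrow> (real \<Rightarrow> complex^('n + 'n)^('n + 'n)) \<Rightarrow> bool" where
  "fundamental \<mu> F \<longleftrightarrow> F 0 = mat 1 \<and> locally_abs_continuous F \<and>
     (\<exists>S. negligible S \<and> (\<forall>x\<ge>0. x \<notin> S \<longrightarrow> (\<exists>F'. (F has_vector_derivative F') (at x) \<and>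
        lower (F x) = P x ** (upper F' - R x ** upper (F x)) \<and>
        mat \<mu> ** upper (F x) = - (lower F' + conj_transpose (R x) ** lower (F x) - Q x ** upper (F x)))))"

text \<open>
  Variation of constants. The coefficient vector \<open>c\<close> need not be constant, but its contribution
  \<open>F c'\<close> to the derivative may only enter the equation for the quasi-derivative.
\<close>

lemma fundamental_variation:
  assumes F: "fundamental \<mu> F" and c: "locally_abs_continuous c" "negligible S0"
    and c': "\<And>x. 0 \<le> x \<Longrightarrow> x \<notin> S0 \<Longrightarrow> \<exists>c'. (c has_vector_derivative c') (at x) \<and> F x *v c' = stack 0 (- h x)"
  shows "image_pair (\<lambda>x. upper (F x *v c x)) (\<lambda>x. lower (F x *v c x)) (\<lambda>x. \<mu> *s upper (F x *v c x) + h x)"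
proof -
  obtain S where S: "negligible S" "\<And>x. 0 \<le> x \<Longrightarrow> x \<notin> S \<Longrightarrow> \<exists>F'. (F has_vector_derivative F') (at x) \<and>
        lower (F x) = P x ** (upper F' - R x ** upper (F x)) \<and>
        mat \<mu> ** upper (F x) = - (lower F' + conj_transpose (R x) ** lower (F x) - Q x ** upper (F x))"
    "locally_abs_continuous F"
    using F unfolding fundamental_def by blast
  have ac: "locally_abs_continuous (\<lambda>x. F x *v c x)"
    by (rule locally_abs_continuous_bilinear[OF S(3) c(1) bounded_bilinear_matrix_vector])
  show ?thesis
    unfolding image_pair_iff
  proof (intro conjI exI[of _ "S \<union> S0"] allI impI)
    fix x assume x: "0 \<le> x" "x \<notin> S \<union> S0"
    obtain F' where F': "(F has_vector_derivative F') (at x)" 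
        "lower (F x) = P x ** (upper F' - R x ** upper (F x))"
        "mat \<mu> ** upper (F x) = - (lower F' + conj_transpose (R x) ** lower (F x) - Q x ** upper (F x))"
      using S(2)[of x] x by blast
    obtain c' where c': "(c has_vector_derivative c') (at x)" "F x *v c' = stack 0 (- h x)"
      using c'[of x] x by blast
    have d: "((\<lambda>x. F x *v c x) has_vector_derivative F x *v c' + F' *v c x) (at x)"
      by (intro mv.has_vector_derivative F' c')
    have e1: "lower (F x *v c x) = P x *v (upper (F' *v c x) - R x *v upper (F x *v c x))"
      unfolding block_mult F'(2) by (simp add: matrix_vector_mul_assoc[symmetric] mv.diff_left)
    have e2: "\<mu> *s upper (F x *v c x) = - (lower (F' *v c x) + conj_transpose (R x) *v lower (F x *v c x) - Q x *v upper (F x *v c x))"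
    proof -
      have "\<mu> *s upper (F x *v c x) = (mat \<mu> ** upper (F x)) *v c x"
        by (simp add: block_mult mat_mult_vec matrix_vector_mul_assoc[symmetric])
      then show ?thesis unfolding F'(3) block_mult
        by (simp add: mv.diff_left mv.add_left mv.minus_left matrix_vector_mul_assoc[symmetric])
    qed
    show "pointwise_image x (\<lambda>x. upper (F x *v c x)) (\<lambda>x. lower (F x *v c x)) (\<mu> *s upper (F x *v c x) + h x)"
      unfolding pointwise_image_def
    proof (intro exI conjI)
      show "((\<lambda>x. upper (F x *v c x)) has_vector_derivative upper (F' *v c x)) (at x)"
        using bounded_linear.has_vector_derivative[OF bounded_linear_upper d] c'(2) by (simp add: block_simps)
      show "((\<lambda>x. lower (F x *v c x)) has_vector_derivative lower (F' *v c x) - h x) (at x)"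
        using bounded_linear.has_vector_derivative[OF bounded_linear_lower d] c'(2) by (simp add: block_simps)
    qed (use e1 e2 in simp_all)
  qed (use S c in \<open>auto intro!: locally_abs_continuous_linear[OF ac] bounded_linear_upper bounded_linear_lower\<close>)
qed

lemma fundamental_solves:
  assumes "fundamental \<mu> F"
  shows "solves \<mu> (\<lambda>x. F x *v c)"
proof -
  have "stack 0 0 = (0 :: complex^('n + 'n))" by (rule block_eqI) (simp_all add: block_simps)
  then have "\<exists>c'. ((\<lambda>x. c) has_vector_derivative c') (at x) \<and> F x *v c' = stack 0 (- 0)" for x
    by (intro exI[of _ 0]) (simp add: mv.zero_right)
  from fundamental_variation[OF assms locally_abs_continuous_const[of c] negligible_empty this]
  show ?thesis unfolding solves_def by simp
qed

lemma fundamental_continuous: "fundamental \<mu> F \<Longrightarrow> continuous_on {0..} F"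
  unfolding fundamental_def by (auto intro: locally_abs_continuous_continuous_on)

lemma fundamental_symplectic:
  assumes "fundamental \<mu> F" "fundamental (cnj \<mu>) G" "0 \<le> x"
  shows "conj_transpose (G x) ** symplectic ** F x = symplectic"
proof (intro matrix_eqI cdot_eqI)
  fix c d
  have "F 0 = mat 1" "G 0 = mat 1" using assms by (auto simp: fundamental_def)
  then have "bracket (F x *v c) (G x *v d) = bracket c d"
    using solves_bracket_const[OF fundamental_solves[OF assms(1), of c] fundamental_solves[OF assms(2), of d] assms(3) order_refl]
    by simp
  then show "cdot ((conj_transpose (G x) ** symplectic ** F x) *v c) d = cdot (symplectic *v c) d"
    by (simp add: bracket_symplectic cdot_matrix_right matrix_vector_mul_assoc matrix_mul_assoc)
qed

text \<open>The relation \<open>conj_transpose G ** symplectic ** F = symplectic\<close> solved for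
  the inverse of \<open>F\<close>, where \<open>- symplectic\<close> is the inverse of
  \<open>symplectic\<close>.\<close>

definition fundamental_inverse :: "complex^('n + 'n)^('n + 'n) \<Rightarrow> complex^('n + 'n)^('n + 'n)" where
  "fundamental_inverse G = - (symplectic ** conj_transpose G ** symplectic)"

lemma fundamental_inverse:
  assumes "fundamental \<mu> F" "fundamental (cnj \<mu>) G" "0 \<le> x"
  shows "fundamental_inverse (G x) ** F x = mat 1" "F x ** fundamental_inverse (G x) = mat 1"
proof -
  have "fundamental_inverse (G x) ** F x = - (symplectic ** (conj_transpose (G x) ** symplectic ** F x))"
    by (simp add: fundamental_inverse_def matrix_mul_assoc mm.minus_left)
  also have "\<dots> = mat 1" unfolding fundamental_symplectic[OF assms] symplectic_square by simp
  finally show "fundamental_inverse (G x) ** F x = mat 1" .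
  then show "F x ** fundamental_inverse (G x) = mat 1" by (simp add: matrix_left_right_inverse)
qed

text \<open>
  The solutions of the adjoint problem separate initial values through the constant bracket, which
  replaces Gronwall's inequality in the proof of uniqueness.
\<close>

lemma fundamental_unique:
  assumes "fundamental \<mu> F" "fundamental (cnj \<mu>) G" "solves \<mu> Y" "0 \<le> x"
  shows "Y x = F x *v Y 0"
proof -
  have G0: "G 0 = mat 1" using assms by (auto simp: fundamental_def)
  have "(conj_transpose (G x) ** symplectic) *v Y x = symplectic *v Y 0"
  proof (rule cdot_eqI)
    fix d
    have "bracket (Y x) (G x *v d) = bracket (Y 0) d"
      using solves_bracket_const[OF assms(3) fundamental_solves[OF assms(2), of d] assms(4) order_refl] G0 by simp
    then show "cdot ((conj_transpose (G x) ** symplectic) *v Y x) d = cdot (symplectic *v Y 0) d"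
      by (simp add: bracket_symplectic cdot_matrix_right matrix_vector_mul_assoc)
  qed
  then have "fundamental_inverse (G x) *v Y x = - (symplectic *v (symplectic *v Y 0))"
    by (simp add: fundamental_inverse_def mv.minus_left matrix_vector_mul_assoc matrix_mul_assoc)
       (metis matrix_mul_assoc matrix_vector_mul_assoc)
  also have "\<dots> = Y 0" by (simp add: matrix_vector_mul_assoc symplectic_square mv.minus_left)
  finally have "F x *v (fundamental_inverse (G x) *v Y x) = F x *v Y 0" by simp
  then show ?thesis
    by (simp add: matrix_vector_mul_assoc fundamental_inverse(2)[OF assms(1,2,4)])
qed

text \<open>Solutions are given through their two halves. These are first glued to absolutely
  continuous block vectors, and the matrix is then assembled as a sum of single columns; the
  exceptional sets of the finitely many columns are united.\<close>

lemma fundamentalI: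
  assumes Y: "\<And>k. solves \<mu> (Y k)" "\<And>k. Y k 0 = axis k 1"
  shows "fundamental \<mu> (\<lambda>x. \<chi> i k. Y k x $ i)"
proof -
  let ?F = "\<lambda>x. (\<chi> i k. Y k x $ i) :: complex^('n + 'n)^('n + 'n)"
  have "\<forall>k. \<exists>S. negligible S \<and> (\<forall>x. 0 \<le> x \<longrightarrow> x \<notin> S \<longrightarrow>
       pointwise_image x (\<lambda>x. upper (Y k x)) (\<lambda>x. lower (Y k x)) (\<mu> *s upper (Y k x)))"
    using Y(1) unfolding image_pair_iff solves_def by blast
  then obtain S where S: "\<And>k. negligible (S k)" "\<And>k x. 0 \<le> x \<Longrightarrow> x \<notin> S k \<Longrightarrow>
       pointwise_image x (\<lambda>x. upper (Y k x)) (\<lambda>x. lower (Y k x)) (\<mu> *s upper (Y k x))" by metis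
  have ac: "locally_abs_continuous (Y k)" for k
  proof -
    have split: "Y k x = stack (upper (Y k x)) 0 + stack 0 (lower (Y k x))" for x
      by (rule block_eqI) (simp_all add: block_simps)
    have "locally_abs_continuous (\<lambda>x. upper (Y k x))" "locally_abs_continuous (\<lambda>x. lower (Y k x))"
      using Y(1)[of k] unfolding image_pair_iff solves_def by auto
    then have "locally_abs_continuous (\<lambda>x. stack (upper (Y k x)) 0 + stack 0 (lower (Y k x)))"
      by (intro locally_abs_continuous_add locally_abs_continuous_linear[OF _ bounded_linear_stack(1)]
          locally_abs_continuous_linear[OF _ bounded_linear_stack(2)])
    then show ?thesis by (simp add: split[symmetric])
  qed
  have F: "?F x = (\<Sum>k\<in>UNIV. (\<chi> i j. if j = k then Y k x $ i else 0))" for x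
    by (simp add: vec_eq_iff)
  show ?thesis
    unfolding fundamental_def
  proof (intro conjI exI[of _ "\<Union>k. S k"] allI impI)
    show "?F 0 = mat 1" by (simp add: Y(2) vec_eq_iff mat_def axis_def)
    show "locally_abs_continuous ?F" unfolding F
      by (intro locally_abs_continuous_sum locally_abs_continuous_linear[OF ac bounded_linear_single_column]) simp
    show "negligible (\<Union>k. S k)" by (intro negligible_Union) (auto simp: S)
    fix x :: real assume x: "0 \<le> x" "x \<notin> (\<Union>k. S k)"
    have "\<forall>k. \<exists>f' g'. ((\<lambda>x. upper (Y k x)) has_vector_derivative f') (at x) \<and> ((\<lambda>x. lower (Y k x)) has_vector_derivative g') (at x) \<and>
     lower (Y k x) = P x *v (f' - R x *v upper (Y k x)) \<and> \<mu> *s upper (Y k x) = - (g' + conj_transpose (R x) *v lower (Y k x) - Q x *v upper (Y k x))"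
      using S(2) x unfolding pointwise_image_def by blast
    then obtain f' g' where fg: "\<And>k. ((\<lambda>x. upper (Y k x)) has_vector_derivative f' k) (at x)" "\<And>k. ((\<lambda>x. lower (Y k x)) has_vector_derivative g' k) (at x)"
     "\<And>k. lower (Y k x) = P x *v (f' k - R x *v upper (Y k x))" "\<And>k. \<mu> *s upper (Y k x) = - (g' k + conj_transpose (R x) *v lower (Y k x) - Q x *v upper (Y k x))"
      by metis
    have dY: "(Y k has_vector_derivative stack (f' k) (g' k)) (at x)" for k
    proof -
      have *: "stack u v = stack u 0 + stack 0 v" for u v :: "complex^'n"
        by (rule block_eqI) (simp_all add: block_simps)
      have "((\<lambda>x. stack (upper (Y k x)) 0 + stack 0 (lower (Y k x))) has_vector_derivative stack (f' k) 0 + stack 0 (g' k)) (at x)"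
        by (intro has_vector_derivative_add bounded_linear.has_vector_derivative[OF bounded_linear_stack(1)]
          bounded_linear.has_vector_derivative[OF bounded_linear_stack(2)] fg)
      then show ?thesis unfolding *[symmetric] by simp
    qed
    let ?F' = "(\<chi> i k. stack (f' k) (g' k) $ i) :: complex^('n + 'n)^('n + 'n)"
    have F': "?F' = (\<Sum>k\<in>UNIV. (\<chi> i j. if j = k then stack (f' k) (g' k) $ i else 0))"
      by (simp add: vec_eq_iff)
    have dF: "(?F has_vector_derivative ?F') (at x)"
      unfolding F F' by (intro has_vector_derivative_sum bounded_linear.has_vector_derivative[OF bounded_linear_single_column] dY)
    have colF: "?F x *v axis k 1 = Y k x" "?F' *v axis k 1 = stack (f' k) (g' k)" for k
      by (simp_all add: column_mult_axis column_def vec_eq_iff)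
    \<comment> \<open>Testing on the unit vectors reduces both matrix equations to those of the
      single columns.\<close>
    have ext: "A = B" if "\<And>k. A *v axis k 1 = B *v axis k 1" for A B :: "complex^('n + 'n)^'n"
      using that by (simp add: column_mult_axis column_def vec_eq_iff)
    show "\<exists>F'. (?F has_vector_derivative F') (at x) \<and>
        lower (?F x) = P x ** (upper F' - R x ** upper (?F x)) \<and>
        mat \<mu> ** upper (?F x) = - (lower F' + conj_transpose (R x) ** lower (?F x) - Q x ** upper (?F x))"
    proof (intro exI[of _ ?F'] conjI dF ext)
      fix k
      show "lower (?F x) *v axis k 1 = (P x ** (upper ?F' - R x ** upper (?F x))) *v axis k 1"
        unfolding matrix_vector_mul_assoc[symmetric] mv.diff_left block_mult[symmetric] colF
        using fg(3) by simp
      show "(mat \<mu> ** upper (?F x)) *v axis k 1 = (- (lower ?F' + conj_transpose (R x) ** lower (?F x) - Q x ** upper (?F x))) *v axis k 1"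
        unfolding matrix_vector_mul_assoc[symmetric] mv.diff_left mv.add_left mv.minus_left block_mult[symmetric] colF mat_mult_vec
        using fg(4) by simp
    qed
  qed
qed

end

section \<open>Linear systems with continuous coefficients\<close>

text \<open>Local boundedness makes the indefinite integral locally Lipschitz. Continuity of
  \<open>h\<close> is deliberately not assumed, since the test functions for the defect subspace
  have jumps.\<close>

lemma indefinite_integral_locally_abs_continuous:
  fixes h :: "real \<Rightarrow> 'a::euclidean_space"
  assumes int: "\<And>b. 0 \<le> b \<Longrightarrow> h integrable_on {0..b}"
    and bdd: "\<And>b. 0 \<le> b \<Longrightarrow> \<exists>B. \<forall>t\<in>{0..b}. norm (h t) \<le> B"
  shows "locally_abs_continuous (\<lambda>x. integral {0..x} h)"
proof (rule locally_abs_continuous_lipschitz)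
  fix b :: real assume "0 \<le> b"
  then obtain B where B: "\<And>t. t \<in> {0..b} \<Longrightarrow> norm (h t) \<le> B" using bdd by blast
  have "norm (integral {0..v} h - integral {0..u} h) \<le> B * (v - u)" if uv: "0 \<le> u" "u \<le> v" "v \<le> b" for u v
  proof -
    have "integral {0..u} h + integral {u..v} h = integral {0..v} h"
      by (rule Henstock_Kurzweil_Integration.integral_combine) (use uv int in auto)
    then have "norm (integral {0..v} h - integral {0..u} h) = norm (integral {u..v} h)"
      by (metis add_diff_cancel_left')
    also have "\<dots> \<le> integral {u..v} (\<lambda>_. B)"
    proof (rule Henstock_Kurzweil_Integration.integral_norm_bound_integral)
      show "h integrable_on {u..v}"
        using int[of v] uv by (auto intro: integrable_subinterval_real)
    qed (use uv B in auto)
    also have "\<dots> = B * (v - u)" using uv by simp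
    finally show ?thesis .
  qed
  then show "\<exists>B. \<forall>u v. 0 \<le> u \<longrightarrow> u \<le> v \<longrightarrow> v \<le> b \<longrightarrow> norm (integral {0..v} h - integral {0..u} h) \<le> B * (v - u)"
    by blast
qed

lemma indefinite_integral_has_vector_derivative:
  fixes h :: "real \<Rightarrow> 'a::euclidean_space"
  assumes "\<And>b. 0 \<le> b \<Longrightarrow> h integrable_on {0..b}" "0 < x" "isCont h x"
  shows "((\<lambda>x. integral {0..x} h) has_vector_derivative h x) (at x)"
proof -
  have "((\<lambda>u. integral {0..u} h) has_vector_derivative h x) (at x within ({0..x+1} - {}))"
    by (rule integral_has_vector_derivative_continuous_at)
       (use assms in \<open>auto intro: continuous_at_imp_continuous_at_within\<close>)
  moreover have "at x within {0..x+1} = at x"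
    by (rule at_within_interior) (use assms in \<open>simp add: interior_atLeastAtMost_real\<close>)
  ultimately show ?thesis by simp
qed

lemma continuous_halfline_facts:
  fixes f :: "real \<Rightarrow> 'a::euclidean_space"
  assumes "continuous_on {0..} f"
  shows "0 \<le> a \<Longrightarrow> continuous_on {a..b} f"
    and "0 \<le> a \<Longrightarrow> f integrable_on {a..b}"
    and "0 < x \<Longrightarrow> isCont f x"
    and "0 \<le> b \<Longrightarrow> \<exists>B. \<forall>t\<in>{0..b}. norm (f t) \<le> B"
    and "continuous_on {0..} (\<lambda>x. integral {0..x} f)"
proof -
  show c: "continuous_on {a..b} f" if "0 \<le> a" for a b
    by (rule continuous_on_subset[OF assms]) (use that in auto)
  show i: "f integrable_on {a..b}" if "0 \<le> a" for a b
    using c[OF that] by (rule integrable_continuous_real)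
  show "isCont f x" if "0 < x"
    using continuous_on_interior[OF assms] that by (simp add: interior_real_atLeast)
  show B: "\<exists>B. \<forall>t\<in>{0..b}. norm (f t) \<le> B" for b
    using compact_imp_bounded[OF compact_continuous_image[OF c[of 0 b] compact_Icc]]
    by (auto simp: bounded_iff)
  show "continuous_on {0..} (\<lambda>x. integral {0..x} f)"
    by (intro locally_abs_continuous_continuous_on indefinite_integral_locally_abs_continuous i B) auto
qed

text \<open>The solution is a Picard series. Its bound depends on \<open>M\<close> only through the
  integral of the norm, so an integrable \<open>M\<close> gives a solution bounded on the whole
  half-line; the change of the spectral parameter relies on this.\<close>

theorem linear_system_exists:
  fixes M :: "real \<Rightarrow> complex^'m^'m"
  assumes cM: "continuous_on {0..} M"
  shows "\<exists>C k. C 0 = mat 1 \<and> locally_abs_continuous C \<and>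
    (\<forall>x>0. (C has_vector_derivative M x ** C x) (at x)) \<and>
    0 < k \<and> (\<forall>x\<ge>0. norm (C x) \<le> k * exp (k * integral {0..x} (\<lambda>t. norm (M t))))"
proof -
  obtain k0 where k0: "k0 > 0" "\<And>(A :: complex^'m^'m) (B :: complex^'m^'m). norm (A ** B) \<le> norm A * norm B * k0"
    using mm.pos_bounded by blast
  define n0 where "n0 = norm (mat 1 :: complex^'m^'m)"
  \<comment> \<open>One constant serves as factor in the product estimate (\<open>k0\<close>) and as
    bound for the start of the iteration (\<open>n0\<close>).\<close>
  define k where "k = max k0 (max n0 1)"
  have k: "k > 0" "n0 \<le> k" "0 \<le> n0" using k0 by (auto simp: k_def n0_def)
  have kb: "norm (A ** B) \<le> k * norm A * norm B" for A B :: "complex^'m^'m"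
  proof -
    have "norm A * norm B * k0 \<le> norm A * norm B * k" by (intro mult_left_mono) (auto simp: k_def)
    then show ?thesis using k0(2)[of A B] by (simp add: mult_ac)
  qed
  define m where "m x = k * integral {0..x} (\<lambda>t. norm (M t))" for x
  have cN: "continuous_on {0..} (\<lambda>t. norm (M t))" by (intro continuous_on_norm cM)
  have cm: "continuous_on {0..} m" unfolding m_def by (intro continuous_intros continuous_halfline_facts(5) cN)
  have m_nonneg: "0 \<le> m x" if "0 \<le> x" for x
    unfolding m_def using k by (intro mult_nonneg_nonneg integral_nonneg continuous_halfline_facts(2) cN) auto
  have dm: "(m has_real_derivative k * norm (M x)) (at x)" if "0 < x" for x
    unfolding m_def has_real_derivative_iff_has_vector_derivative
    by (intro has_vector_derivative_mult_right indefinite_integral_has_vector_derivative continuous_halfline_facts(2,3) cN that) auto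
  have m_mono: "m x \<le> m y" if "0 \<le> x" "x \<le> y" for x y
    unfolding m_def using that k
    by (intro mult_left_mono integral_subset_le continuous_halfline_facts(2) cN) auto
  \<comment> \<open>The i-th term is the i-fold iterated integral, that is, the increment of the
    i-th Picard step.\<close>
  define c where "c = rec_nat (\<lambda>x. mat 1 :: complex^'m^'m) (\<lambda>i f x. integral {0..x} (\<lambda>t. M t ** f t))"
  have c_simps: "c 0 = (\<lambda>x. mat 1)" "c (Suc i) = (\<lambda>x. integral {0..x} (\<lambda>t. M t ** c i t))" for i
    by (simp_all add: c_def)
  have cc: "continuous_on {0..} (c i)" for i
  proof (induction i)
    case (Suc i)
    then show ?case unfolding c_simps by (intro continuous_halfline_facts(5) mm.continuous_on cM)
  qed (simp add: c_simps)
  have cMc: "continuous_on {0..} (\<lambda>t. M t ** c i t)" for i by (intro mm.continuous_on cM cc)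
  have bound: "norm (c i x) \<le> k * (m x ^ i / fact i)" if "0 \<le> x" for i x
    using that
  proof (induction i arbitrary: x)
    case 0 then show ?case using k by (simp add: c_simps n0_def)
  next
    case (Suc i)
    \<comment> \<open>The bound obtained by inserting the induction hypothesis is an exact
      derivative, because \<open>m\<close> has derivative \<open>k * norm (M t)\<close>.\<close>
    have FTC: "((\<lambda>t. k * (k * norm (M t)) * (m t ^ i / fact i)) has_integral
       k * (m x ^ Suc i / fact (Suc i)) - k * (m 0 ^ Suc i / fact (Suc i))) {0..x}"
    proof (rule fundamental_theorem_of_calculus_interior[OF Suc.prems])
      show "continuous_on {0..x} (\<lambda>t. k * (m t ^ Suc i / fact (Suc i)))"
        by (intro continuous_intros continuous_halfline_facts(1) cm) auto
      fix t assume t: "t \<in> {0<..<x}"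
      have "((\<lambda>t. m t ^ Suc i) has_real_derivative real (Suc i) * (k * norm (M t)) * m t ^ i) (at t)"
        using DERIV_power[OF dm, of t "Suc i"] t by (simp add: mult_ac del: of_nat_Suc power_Suc)
      then have "((\<lambda>t. k * (m t ^ Suc i / fact (Suc i))) has_real_derivative
          k * ((real (Suc i) * (k * norm (M t)) * m t ^ i) / fact (Suc i))) (at t)"
        by (intro DERIV_cmult DERIV_cdivide)
      moreover have e: "real (Suc i) / fact (Suc i) = 1 / (fact i :: real)"
        unfolding fact_Suc by (simp del: of_nat_Suc)
      have "k * ((real (Suc i) * (k * norm (M t)) * m t ^ i) / fact (Suc i)) 
          = k * (k * norm (M t)) * (m t ^ i * (real (Suc i) / fact (Suc i)))"
        by (simp del: of_nat_Suc fact_Suc)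
      then have "k * ((real (Suc i) * (k * norm (M t)) * m t ^ i) / fact (Suc i)) = k * (k * norm (M t)) * (m t ^ i / fact i)"
        unfolding e by simp
      ultimately show "((\<lambda>t. k * (m t ^ Suc i / fact (Suc i))) has_vector_derivative k * (k * norm (M t)) * (m t ^ i / fact i)) (at t)"
        by (simp only: has_real_derivative_iff_has_vector_derivative)
    qed
    have "norm (c (Suc i) x) \<le> integral {0..x} (\<lambda>t. k * (k * norm (M t)) * (m t ^ i / fact i))"
      unfolding c_simps
    proof (rule Henstock_Kurzweil_Integration.integral_norm_bound_integral)
      show "(\<lambda>t. k * (k * norm (M t)) * (m t ^ i / fact i)) integrable_on {0..x}" using FTC by blast
      show "(\<lambda>t. M t ** c i t) integrable_on {0..x}" using continuous_halfline_facts(2)[OF cMc] by simp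
      fix t assume "t \<in> {0..x}"
      then have "norm (c i t) \<le> k * (m t ^ i / fact i)" using Suc.IH by simp
      then have "k * norm (M t) * norm (c i t) \<le> k * norm (M t) * (k * (m t ^ i / fact i))"
        using k by (intro mult_left_mono) auto
      then show "norm (M t ** c i t) \<le> k * (k * norm (M t)) * (m t ^ i / fact i)"
        using kb[of "M t" "c i t"] by (simp add: mult_ac)
    qed
    also have "\<dots> = k * (m x ^ Suc i / fact (Suc i))"
      using integral_unique[OF FTC] by (simp add: m_def)
    finally show ?case .
  qed
  define C where "C x = (\<Sum>i. c i x)" for x
  have ex: "(\<lambda>i. k * (r ^ i / fact i)) sums (k * exp r)" for r :: real
    using exp_converges[of r] by (intro sums_mult) (simp add: field_simps)
  have summ: "summable (\<lambda>i. c i x)" if "0 \<le> x" for x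
    by (rule summable_comparison_test[OF _ sums_summable[OF ex[of "m x"]]]) (use bound that in auto)
  have Cb: "norm (C x) \<le> k * exp (m x)" if "0 \<le> x" for x
  proof -
    have sn: "summable (\<lambda>i. norm (c i x))"
      by (rule summable_comparison_test[OF _ sums_summable[OF ex[of "m x"]]]) (use bound that in auto)
    have "norm (C x) \<le> (\<Sum>i. norm (c i x))" unfolding C_def by (rule summable_norm[OF sn])
    also have "\<dots> \<le> (\<Sum>i. k * (m x ^ i / fact i))"
      by (intro suminf_le sn sums_summable[OF ex] bound that)
    also have "\<dots> = k * exp (m x)" using sums_unique[OF ex[of "m x"]] by simp
    finally show ?thesis .
  qed
  \<comment> \<open>Since \<open>m\<close> increases, its value at \<open>b\<close> gives a summable
    majorant that is uniform on the interval.\<close>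
  have b1: "norm (c i t) \<le> k * (m b ^ i / fact i)" if "t \<in> {0..b}" for i t b
  proof -
    have "norm (c i t) \<le> k * (m t ^ i / fact i)" using bound that by auto
    also have "\<dots> \<le> k * (m b ^ i / fact i)"
      using that m_mono[of t b] m_nonneg[of t] k by (intro mult_left_mono divide_right_mono power_mono) auto
    finally show ?thesis .
  qed
  \<comment> \<open>The series is integrated term by term, which shifts the index by one and removes
    the initial term.\<close>
  have eq: "C x = mat 1 + integral {0..x} (\<lambda>t. M t ** C t)" if x0: "0 \<le> x" for x
  proof -
    obtain B where B: "\<And>t. t \<in> {0..x} \<Longrightarrow> norm (M t) \<le> B" "0 \<le> x"
      using continuous_halfline_facts(4)[OF cM x0] x0 by blast
    have "0 \<le> B" using order_trans[OF norm_ge_zero B(1)[of 0]] x0 by simp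
    have ul: "uniform_limit {0..x} (\<lambda>n t. \<Sum>i<n. M t ** c i t) (\<lambda>t. \<Sum>i. M t ** c i t) sequentially"
    proof (rule Weierstrass_m_test)
      show "summable (\<lambda>i. (k * B) * (k * (m x ^ i / fact i)))"
        by (intro summable_mult sums_summable[OF ex])
      fix i t assume t: "t \<in> {0..x}"
      have "norm (M t ** c i t) \<le> k * norm (M t) * norm (c i t)" by (rule kb)
      also have "\<dots> \<le> (k * B) * (k * (m x ^ i / fact i))"
        using k B(1)[OF t] b1[OF t] \<open>0 \<le> B\<close> by (intro mult_mono) auto
      finally show "norm (M t ** c i t) \<le> (k * B) * (k * (m x ^ i / fact i))" .
    qed
    have lim: "(\<Sum>i. M t ** c i t) = M t ** C t" if "t \<in> {0..x}" for t
      unfolding C_def using bounded_linear.suminf[OF mm.bounded_linear_right summ[of t], of "M t"] that by simp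
    have cs: "continuous_on {0..x} (\<lambda>t. \<Sum>i<n. M t ** c i t)" for n
      by (intro continuous_on_sum continuous_halfline_facts(1)[OF cMc]) simp
    obtain I J where IJ: "\<And>n. ((\<lambda>t. \<Sum>i<n. M t ** c i t) has_integral I n) {0..x}"
      "((\<lambda>t. \<Sum>i. M t ** c i t) has_integral J) {0..x}" "I \<longlonglongrightarrow> J"
      by (rule uniform_limit_integral[OF ul cs sequentially_bot]) (use that in blast)
    have "I = (\<lambda>n. \<Sum>i<n. c (Suc i) x)"
    proof
      fix n
      have "((\<lambda>t. \<Sum>i<n. M t ** c i t) has_integral (\<Sum>i<n. c (Suc i) x)) {0..x}"
        unfolding c_simps
        by (intro has_integral_sum integrable_integral continuous_halfline_facts(2) cMc) auto
      then show "I n = (\<Sum>i<n. c (Suc i) x)" by (rule has_integral_unique[OF IJ(1)])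
    qed
    moreover have "(\<lambda>i. c (Suc i) x) sums (C x - c 0 x)"
      unfolding C_def using summable_sums[OF summ[OF x0]] by (subst sums_Suc_iff) (simp add: c_simps)
    ultimately have "I \<longlonglongrightarrow> C x - c 0 x" by (simp add: sums_def)
    then have "J = C x - mat 1" using LIMSEQ_unique[OF IJ(3)] by (simp add: c_simps(1))
    moreover have "integral {0..x} (\<lambda>t. M t ** C t) = J"
      using integral_unique[OF IJ(2)] integral_cong[of "{0..x}" "\<lambda>t. \<Sum>i. M t ** c i t" "\<lambda>t. M t ** C t"] lim by simp
    ultimately show ?thesis by simp
  qed
  have cC: "continuous_on {0..b} C" if "0 \<le> b" for b
  proof (rule uniform_limit_theorem[OF _ _ sequentially_bot])
    show "uniform_limit {0..b} (\<lambda>n t. \<Sum>i<n. c i t) C sequentially"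
      unfolding C_def by (rule Weierstrass_m_test[OF b1 sums_summable[OF ex[of "m b"]]])
    show "\<forall>\<^sub>F n in sequentially. continuous_on {0..b} (\<lambda>t. \<Sum>i<n. c i t)"
      by (intro always_eventually allI continuous_on_sum continuous_halfline_facts(1) cc) auto
  qed
  have cMC: "continuous_on {0..b} (\<lambda>t. M t ** C t)" if "0 \<le> b" for b
    by (rule mm.continuous_on[OF continuous_halfline_facts(1)[OF cM order_refl] cC[OF that]])
  have int: "(\<lambda>t. M t ** C t) integrable_on {0..b}" if "0 \<le> b" for b
    by (intro integrable_continuous_real cMC that)
  \<comment> \<open>The integral form is the witness instead of the series \<open>C\<close>, which
    it equals for \<open>x \<ge> 0\<close>: its absolute continuity and differentiability come from
    the lemmas on indefinite integrals.\<close>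
  let ?I = "\<lambda>x. mat 1 + integral {0..x} (\<lambda>t. M t ** C t)"
  have "\<exists>B. \<forall>t\<in>{0..b}. norm (M t ** C t) \<le> B" if "0 \<le> b" for b
    using compact_imp_bounded[OF compact_continuous_image[OF cMC[OF that] compact_Icc]]
    unfolding bounded_iff by simp
  then have acI: "locally_abs_continuous ?I"
    by (intro locally_abs_continuous_add locally_abs_continuous_const
        indefinite_integral_locally_abs_continuous int)
  have dI: "(?I has_vector_derivative M x ** ?I x) (at x)" if "0 < x" for x
  proof -
    have "isCont (\<lambda>t. M t ** C t) x"
      using continuous_on_interior[OF cMC[of "x+1"], of x] that by (simp add: interior_atLeastAtMost_real)
    then have "((\<lambda>x. integral {0..x} (\<lambda>t. M t ** C t)) has_vector_derivative M x ** C x) (at x)"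
      by (intro indefinite_integral_has_vector_derivative int that)
    then have "(?I has_vector_derivative 0 + M x ** C x) (at x)"
      by (intro has_vector_derivative_add has_vector_derivative_const)
    then show ?thesis using eq[of x] that by simp
  qed
  have "norm (?I x) \<le> k * exp (k * integral {0..x} (\<lambda>t. norm (M t)))" if "0 \<le> x" for x
    using Cb[OF that] eq[OF that] unfolding m_def by simp
  then show ?thesis
    using acI dI k(1) by (intro exI[of _ ?I] exI[of _ k] conjI allI impI) simp_all
qed

section \<open>Change of the spectral parameter\<close>

text \<open>For continuous functions this is square integrability on the half-line, put in the form
  in which the estimates over finite intervals deliver it.\<close>

definition bounded_energy :: "(real \<Rightarrow> 'a::real_normed_vector) \<Rightarrow> bool" where
  "bounded_energy T \<longleftrightarrow> (\<exists>B. \<forall>b\<ge>0. integral {0..b} (\<lambda>x. (norm (T x))\<^sup>2) \<le> B)"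

lemma bounded_energy_mono:
  fixes S :: "real \<Rightarrow> 'a::euclidean_space" and T :: "real \<Rightarrow> 'b::euclidean_space"
  assumes "bounded_energy T" "continuous_on {0..} S" "continuous_on {0..} T"
    "\<And>x. 0 \<le> x \<Longrightarrow> norm (S x) \<le> c * norm (T x)"
  shows "bounded_energy S"
proof -
  obtain B where B: "\<And>b. 0 \<le> b \<Longrightarrow> integral {0..b} (\<lambda>x. (norm (T x))\<^sup>2) \<le> B"
    using assms(1) by (auto simp: bounded_energy_def)
  have "integral {0..b} (\<lambda>x. (norm (S x))\<^sup>2) \<le> c\<^sup>2 * B" if "0 \<le> b" for b
  proof -
    have "integral {0..b} (\<lambda>x. (norm (S x))\<^sup>2) \<le> integral {0..b} (\<lambda>x. c\<^sup>2 * (norm (T x))\<^sup>2)"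
    proof (rule integral_le)
      show "(\<lambda>x. (norm (S x))\<^sup>2) integrable_on {0..b}" "(\<lambda>x. c\<^sup>2 * (norm (T x))\<^sup>2) integrable_on {0..b}"
        using assms(2,3) by (auto intro!: continuous_halfline_facts(2) continuous_intros)
      fix x assume "x \<in> {0..b}"
      then have "(norm (S x))\<^sup>2 \<le> (c * norm (T x))\<^sup>2" using assms(4) by (intro power_mono) auto
      then show "(norm (S x))\<^sup>2 \<le> c\<^sup>2 * (norm (T x))\<^sup>2" by (simp add: power_mult_distrib)
    qed
    also have "\<dots> = c\<^sup>2 * integral {0..b} (\<lambda>x. (norm (T x))\<^sup>2)" by simp
    also have "\<dots> \<le> c\<^sup>2 * B" using B[OF that] by (intro mult_left_mono) auto
    finally show ?thesis .
  qed
  then show ?thesis unfolding bounded_energy_def by blast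
qed

lemma integral_norm_product_bounded:
  fixes S T :: "real \<Rightarrow> 'a::euclidean_space"
  assumes "bounded_energy S" "bounded_energy T" "continuous_on {0..} S" "continuous_on {0..} T"
  shows "\<exists>B. \<forall>b\<ge>0. integral {0..b} (\<lambda>x. norm (S x) * norm (T x)) \<le> B"
proof -
  obtain B1 B2 where B: "\<And>b. 0 \<le> b \<Longrightarrow> integral {0..b} (\<lambda>x. (norm (S x))\<^sup>2) \<le> B1"
    "\<And>b. 0 \<le> b \<Longrightarrow> integral {0..b} (\<lambda>x. (norm (T x))\<^sup>2) \<le> B2"
    using assms(1,2) by (auto simp: bounded_energy_def)
  have "integral {0..b} (\<lambda>x. norm (S x) * norm (T x)) \<le> B1 + B2" if "0 \<le> b" for b
  proof -
    have int: "(\<lambda>x. (norm (S x))\<^sup>2) integrable_on {0..b}" "(\<lambda>x. (norm (T x))\<^sup>2) integrable_on {0..b}"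
      "(\<lambda>x. norm (S x) * norm (T x)) integrable_on {0..b}"
      using assms(3,4) by (auto intro!: continuous_halfline_facts(2) continuous_intros)
    have "integral {0..b} (\<lambda>x. norm (S x) * norm (T x)) \<le> integral {0..b} (\<lambda>x. (norm (S x))\<^sup>2 + (norm (T x))\<^sup>2)"
    proof (rule integral_le)
      fix x
      have "2 * (norm (S x) * norm (T x)) \<le> (norm (S x))\<^sup>2 + (norm (T x))\<^sup>2"
        using sum_squares_bound[of "norm (S x)" "norm (T x)"] by simp
      moreover have "0 \<le> norm (S x) * norm (T x)" by simp
      ultimately show "norm (S x) * norm (T x) \<le> (norm (S x))\<^sup>2 + (norm (T x))\<^sup>2" by linarith
    qed (intro int Henstock_Kurzweil_Integration.integrable_add)+
    also have "\<dots> = integral {0..b} (\<lambda>x. (norm (S x))\<^sup>2) + integral {0..b} (\<lambda>x. (norm (T x))\<^sup>2)"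
      by (intro Henstock_Kurzweil_Integration.integral_add int)
    finally show ?thesis using B[OF that] by simp
  qed
  then show ?thesis by blast
qed

lemma conj_transpose_stack: "conj_transpose G *v stack w 0 = conj_transpose (upper G) *v w"
  by (rule cdot_eqI) (simp add: cdot_matrix_left conj_transpose_involutive cdot_block block_mult cdot_simps)

context quasi_expression
begin

text \<open>The symplectic matrix moves \<open>v\<close> into the upper slot, where the adjoint of
  \<open>G\<close> sees only its upper block. For this reason \<open>M\<close> and the Cauchy
  function contain no quasi-derivatives.\<close>

lemma fundamental_inverse_stack:
  "fundamental_inverse G *v stack 0 v = symplectic *v (conj_transpose (upper G) *v v)"
proof -
  have "symplectic *v stack 0 v = - stack v 0"
    by (rule block_eqI) (simp_all add: symplectic_mult block_simps)
  then show ?thesis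
    by (simp add: fundamental_inverse_def mv.minus_left mv.minus_right conj_transpose_stack
        matrix_vector_mul_assoc[symmetric])
qed

text \<open>Variation of constants: with the ansatz \<open>F x ** C x\<close> the equation for
  \<open>\<mu>\<close> becomes \<open>C' = M C\<close>, where \<open>M\<close> is continuous
  although \<open>P\<close>, \<open>Q\<close> and \<open>R\<close> need not be. Finite energies make
  \<open>M\<close> integrable and \<open>C\<close> bounded.\<close>

lemma fundamental_transfer:
  assumes F: "fundamental \<nu> F" and G: "fundamental (cnj \<nu>) G"
  shows "\<exists>F'. fundamental \<mu> F' \<and> (bounded_energy (\<lambda>x. upper (F x)) \<longrightarrow> bounded_energy (\<lambda>x. upper (G x)) \<longrightarrow> bounded_energy (\<lambda>x. upper (F' x)))"
proof -
  \<comment> \<open>This is the inverse of \<open>F\<close> applied to the lower-slot vector with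
    entry \<open>(\<nu> - \<mu>)\<close> times the upper block of \<open>F\<close>, written out with
    \<open>fundamental_inverse_stack\<close>.\<close>
  define M where "M x = symplectic ** (conj_transpose (upper (G x)) ** (mat (\<nu> - \<mu>) ** upper (F x)))" for x
  have cF: "continuous_on {0..} F" "continuous_on {0..} G"
    using F G fundamental_continuous by blast+
  have cU: "continuous_on {0..} (\<lambda>x. upper (F x))" "continuous_on {0..} (\<lambda>x. upper (G x))"
    by (intro bounded_linear.continuous_on[OF bounded_linear_upper] cF)+
  have cM: "continuous_on {0..} M"
    unfolding M_def by (intro mm.continuous_on continuous_on_const bounded_linear.continuous_on[OF bounded_linear_conj_transpose] cU)
  have FM: "F x *v (M x *v c) = stack 0 (- ((\<mu> - \<nu>) *s upper (F x *v c)))" if "0 \<le> x" for x c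
  proof -
    have "M x *v c = fundamental_inverse (G x) *v stack 0 ((\<nu> - \<mu>) *s upper (F x *v c))"
      by (simp add: fundamental_inverse_stack M_def matrix_vector_mul_assoc[symmetric] mat_mult_vec block_mult)
    then have "F x *v (M x *v c) = (F x ** fundamental_inverse (G x)) *v stack 0 ((\<nu> - \<mu>) *s upper (F x *v c))"
      by (simp add: matrix_vector_mul_assoc)
    then show ?thesis unfolding fundamental_inverse(2)[OF F G that]
      by (simp add: vec_eq_iff algebra_simps stack_def split: sum.splits)
  qed
  obtain C k where C: "C 0 = mat 1" "locally_abs_continuous C"
    "\<And>x. 0 < x \<Longrightarrow> (C has_vector_derivative M x ** C x) (at x)" "0 < k"
    "\<And>x. 0 \<le> x \<Longrightarrow> norm (C x) \<le> k * exp (k * integral {0..x} (\<lambda>t. norm (M t)))"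
    using linear_system_exists[OF cM] by blast
  have sol: "solves \<mu> (\<lambda>x. F x *v (C x *v c))" for c
  proof -
    \<comment> \<open>Read as an equation for \<open>\<nu>\<close>, the equation for
      \<open>\<mu>\<close> has the inhomogeneity \<open>\<mu> - \<nu>\<close> times the solution.
      The point 0 is exceptional because \<open>C\<close> is known to be differentiable only to its
      right.\<close>
    have "image_pair (\<lambda>x. upper (F x *v (C x *v c))) (\<lambda>x. lower (F x *v (C x *v c)))
      (\<lambda>x. \<nu> *s upper (F x *v (C x *v c)) + (\<mu> - \<nu>) *s upper (F x *v (C x *v c)))"
    proof (rule fundamental_variation[OF F, of _ "{0}"])
      show "locally_abs_continuous (\<lambda>x. C x *v c)"
        by (rule locally_abs_continuous_linear[OF C(2) mv.bounded_linear_left])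
      fix x :: real assume "0 \<le> x" "x \<notin> {0}"
      then have "((\<lambda>x. C x *v c) has_vector_derivative (M x ** C x) *v c) (at x)"
        by (intro bounded_linear.has_vector_derivative[OF mv.bounded_linear_left] C) auto
      then show "\<exists>c'. ((\<lambda>x. C x *v c) has_vector_derivative c') (at x) \<and> F x *v c' = stack 0 (- ((\<mu> - \<nu>) *s upper (F x *v (C x *v c))))"
        using FM[OF \<open>0 \<le> x\<close>, of "C x *v c"] by (auto simp: matrix_vector_mul_assoc matrix_mul_assoc)
    qed simp
    moreover have "\<nu> *s v + (\<mu> - \<nu>) *s v = \<mu> *s v" for v :: "complex^'n"
      by (simp add: vec_eq_iff algebra_simps)
    ultimately show ?thesis unfolding solves_def by simp
  qed
  have "F 0 = mat 1" using F by (simp add: fundamental_def)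
  then have "fundamental \<mu> (\<lambda>x. \<chi> i k. (F x *v (C x *v axis k 1)) $ i)"
    by (intro fundamentalI sol) (simp add: C(1))
  moreover have "(\<chi> i k. (F x *v (C x *v axis k 1)) $ i) = F x ** C x" for x
  proof -
    have "F x *v (C x *v axis k 1) = column k (F x ** C x)" for k
      using column_mult_axis[of "F x ** C x" k] by (simp only: matrix_vector_mul_assoc)
    then show ?thesis by (simp add: vec_eq_iff column_def)
  qed
  ultimately have fund: "fundamental \<mu> (\<lambda>x. F x ** C x)" by simp
  moreover have "bounded_energy (\<lambda>x. upper (F x ** C x))"
    if e: "bounded_energy (\<lambda>x. upper (F x))" "bounded_energy (\<lambda>x. upper (G x))"
  proof -
    obtain B where B: "\<And>b. 0 \<le> b \<Longrightarrow> integral {0..b} (\<lambda>x. norm (upper (G x)) * norm (upper (F x))) \<le> B"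
      using integral_norm_product_bounded[OF e(2,1) cU(2,1)] by blast
    obtain q where q: "0 \<le> q" "\<And>x. norm (M x) \<le> q * (norm (upper (G x)) * norm (upper (F x)))"
    proof -
      obtain k1 where k1: "0 < k1" "\<And>B. norm ((symplectic :: complex^('n + 'n)^('n + 'n)) ** (B :: complex^('n + 'n)^('n + 'n))) \<le> norm B * k1"
        using bounded_linear.pos_bounded[OF mm.bounded_linear_right[of symplectic]] by blast
      obtain k2 where k2: "0 < k2" "\<And>(A :: complex^'n^('n + 'n)) (B :: complex^('n + 'n)^'n). norm (A ** B) \<le> norm A * norm B * k2"
        using mm.pos_bounded by blast
      obtain k3 where k3: "0 < k3" "\<And>A :: complex^('n + 'n)^'n. norm (conj_transpose A) \<le> norm A * k3"
        using bounded_linear.pos_bounded[OF bounded_linear_conj_transpose] by blast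
      obtain k4 where k4: "0 < k4" "\<And>(B :: complex^('n + 'n)^'n). norm (mat (\<nu> - \<mu>) ** B) \<le> norm B * k4"
        using bounded_linear.pos_bounded[OF mm.bounded_linear_right[of "mat (\<nu> - \<mu>)"]] by blast
      show thesis
      proof (rule that[of "k1 * k2 * k3 * k4"])
        show "0 \<le> k1 * k2 * k3 * k4" using k1 k2 k3 k4 by simp
        fix x
        have "norm (M x) \<le> norm (conj_transpose (upper (G x)) ** (mat (\<nu> - \<mu>) ** upper (F x))) * k1"
          unfolding M_def by (rule k1)
        also have "\<dots> \<le> (norm (conj_transpose (upper (G x))) * norm (mat (\<nu> - \<mu>) ** upper (F x)) * k2) * k1"
          using k1(1) by (intro mult_right_mono k2) auto
        also have "\<dots> \<le> ((norm (upper (G x)) * k3) * (norm (upper (F x)) * k4) * k2) * k1"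
          using k1(1) k2(1) k3(1) by (intro mult_right_mono mult_mono k3 k4) auto
        finally show "norm (M x) \<le> k1 * k2 * k3 * k4 * (norm (upper (G x)) * norm (upper (F x)))"
          by (simp add: mult_ac)
      qed
    qed
    \<comment> \<open>The product of the two upper blocks is integrable by the finite energies, so
      the exponent in the bound for \<open>C\<close> does not grow.\<close>
    have Mint: "integral {0..x} (\<lambda>t. norm (M t)) \<le> q * B" if "0 \<le> x" for x
    proof -
      have "integral {0..x} (\<lambda>t. norm (M t)) \<le> integral {0..x} (\<lambda>t. q * (norm (upper (G t)) * norm (upper (F t))))"
        using cM cU q by (intro integral_le continuous_halfline_facts(2) continuous_intros) auto
      also have "\<dots> \<le> q * B" using B[OF that] q(1) by (simp add: mult_left_mono)
      finally show ?thesis .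
    qed
    have Cb: "norm (C x) \<le> k * exp (k * (q * B))" if "0 \<le> x" for x
      using C(5)[OF that] Mint[OF that] C(4)
      by (smt (verit) exp_le_cancel_iff mult_left_mono)
    obtain k5 where k5: "0 < k5" "\<And>(A :: complex^('n + 'n)^'n) (B :: complex^('n + 'n)^('n + 'n)). norm (A ** B) \<le> norm A * norm B * k5"
      using mm.pos_bounded by blast
    show ?thesis
    proof (rule bounded_energy_mono[OF e(1) _ cU(1), of _ "k * exp (k * (q * B)) * k5"])
      show "continuous_on {0..} (\<lambda>x. upper (F x ** C x))"
        by (intro bounded_linear.continuous_on[OF bounded_linear_upper] fundamental_continuous[OF fund])
      fix x :: real assume x: "0 \<le> x"
      have "norm (upper (F x) ** C x) \<le> norm (upper (F x)) * norm (C x) * k5" by (rule k5)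
      also have "\<dots> \<le> norm (upper (F x)) * (k * exp (k * (q * B))) * k5"
        using k5(1) Cb[OF x] by (intro mult_right_mono mult_left_mono) auto
      finally show "norm (upper (F x ** C x)) \<le> k * exp (k * (q * B)) * k5 * norm (upper (F x))"
        by (simp add: block_mult mult_ac)
    qed
  qed
  ultimately show ?thesis by blast
qed

end

section \<open>The Cauchy function and the fundamental matrix for the parameter 0\<close>

locale cauchy_quasi_expression = quasi_expression P Q R for P Q R :: "real \<Rightarrow> complex^'n^'n" +
  fixes K :: "real \<Rightarrow> real \<Rightarrow> complex^'n^'n"
  assumes cauchy: "cauchy_function P Q R K"
begin

lemma cauchy_solution:
  assumes "0 \<le> t"
  shows "\<exists>Y. solves 0 Y \<and> (\<forall>x. upper (Y x) = K x t *v v) \<and> lower (Y t) = v"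
proof -
  obtain K1 where K1: "\<And>j. l_value P Q R (\<lambda>x. column j (K x t)) (\<lambda>x. 0)"
    "\<And>j. quasi_derivative P R (\<lambda>x. column j (K x t)) (\<lambda>x. column j (K1 x))" "K1 t = mat 1"
    using cauchy assms unfolding cauchy_function_def by blast
  \<comment> \<open>The quasi-derivative inside \<open>l_value\<close> need not be the one inside
    \<open>K1\<close> literally. Uniqueness identifies their values at \<open>t\<close>.\<close>
  obtain g where g: "\<And>j. image_pair (\<lambda>x. column j (K x t)) (g j) (\<lambda>x. 0)"
    using K1(1) unfolding l_value_iff by metis
  have gt: "g j t = axis j 1" for j
  proof -
    have "g j t = column j (K1 t)"
      using quasi_derivative_unique[OF _ K1(2) assms] g unfolding image_pair_def by blast
    then show ?thesis by (simp add: K1(3) column_def mat_def axis_def vec_eq_iff)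
  qed
  have s: "solves 0 (\<lambda>x. stack (column j (K x t)) (g j x))" for j
    using g[of j] unfolding solves_def by simp
  have zero: "solves 0 (\<lambda>x. 0)"
    using solves_scale[OF s, of 0] by simp
  have sum: "solves 0 (\<lambda>x. \<Sum>j\<in>I. v $ j *s stack (column j (K x t)) (g j x))" if "finite I" for I :: "'n set"
    using that
  proof induction
    case (insert i I)
    then show ?case using solves_add[OF solves_scale[OF s, of "v $ i" i] insert.IH] by simp
  qed (simp add: zero)
  define Y where "Y x = (\<Sum>j\<in>UNIV. v $ j *s stack (column j (K x t)) (g j x))" for x
  have "upper (Y x) = K x t *v v" for x
    unfolding Y_def by (simp add: upper_def stack_def vec_eq_iff matrix_vector_mult_def column_def mult.commute)
  moreover have "lower (Y t) = v"
    unfolding Y_def by (simp add: lower_def stack_def vec_eq_iff gt axis_def if_distrib cong: if_cong)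
  moreover have "solves 0 Y" unfolding Y_def using sum[of UNIV] by simp
  ultimately show ?thesis by blast
qed

lemma K_diagonal: "0 \<le> t \<Longrightarrow> K t t = 0"
  using cauchy unfolding cauchy_function_def by blast

text \<open>Compare the bracket of the solutions \<open>K x t *v v\<close> and
  \<open>K x 0 *v w\<close> at the points \<open>t\<close> and 0. Since \<open>K\<close> vanishes on
  the diagonal, one term survives at each of them.\<close>

lemma K_adjoint_at_zero:
  assumes "0 \<le> t"
  shows "cdot (K 0 t *v v) w = - cdot v (K t 0 *v w)"
proof -
  obtain Y where Y: "solves 0 Y" "\<And>x. upper (Y x) = K x t *v v" "lower (Y t) = v"
    using cauchy_solution[OF assms] by blast
  obtain Z where Z: "solves 0 Z" "\<And>x. upper (Z x) = K x 0 *v w" "lower (Z 0) = w"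
    using cauchy_solution[of 0] by blast
  have "bracket (Y t) (Z t) = bracket (Y 0) (Z 0)"
    by (rule solves_bracket_const[OF Y(1)]) (use Z assms in auto)
  then show ?thesis
    by (simp add: bracket_def Y Z K_diagonal assms mv.zero_left cdot_simps)
qed

text \<open>Only the upper half of \<open>p\<close> calls for the spanning argument. The columns of
  \<open>K x 0\<close> are zero at 0 and have arbitrary quasi-derivatives there, so they correct the
  lower half afterwards.\<close>

lemma solution_with_initial_value: "\<exists>Y. solves 0 Y \<and> Y 0 = p"
proof -
  define V where "V = {upper (Y 0) | Y. solves 0 Y}"
  have V_I: "upper (Y 0) \<in> V" if "solves 0 Y" for Y
    using that unfolding V_def by blast
  have Vadd: "x + y \<in> V" if xy: "x \<in> V" "y \<in> V" for x y
  proof -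
    obtain Y Z where "solves 0 Y" "x = upper (Y 0)" "solves 0 Z" "y = upper (Z 0)"
      using xy unfolding V_def by blast
    then show ?thesis using V_I[OF solves_add, of Y Z] by (simp add: block_simps)
  qed
  have Vscale: "c *s x \<in> V" if x: "x \<in> V" for x c
  proof -
    obtain Y where "solves 0 Y" "x = upper (Y 0)" using x unfolding V_def by blast
    then show ?thesis using V_I[OF solves_scale, of Y c] by (simp add: block_scale)
  qed
  have VK: "K 0 t *v v \<in> V" if t: "0 \<le> t" for t v
  proof -
    obtain Y where "solves 0 Y" "\<forall>x. upper (Y x) = K x t *v v" using cauchy_solution[OF t] by blast
    then show ?thesis using V_I[of Y] by simp
  qed
  have V0: "0 \<in> V" using VK[of 0 0] by (simp add: mv.zero_right)
  have sub: "subspace V"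
    unfolding subspace_def
  proof (intro conjI allI ballI V0 Vadd)
    fix c x assume "x \<in> V"
    then have "complex_of_real c *s x \<in> V" by (rule Vscale)
    moreover have "complex_of_real c *s x = c *\<^sub>R x" by (simp add: vec_eq_iff scaleR_conv_of_real[where 'a=complex])
    ultimately show "c *\<^sub>R x \<in> V" by simp
  qed
  have "V = UNIV"
  proof (rule ccontr)
    assume "V \<noteq> UNIV"
    \<comment> \<open>The span and the orthogonal vector are taken over the reals.\<close>
    then have "span V \<subset> span UNIV" using sub by (metis span_eq_iff span_UNIV top.not_eq_extremum)
    then obtain w where w: "w \<noteq> 0" "\<And>y. y \<in> span V \<Longrightarrow> orthogonal w y"
      by (rule orthogonal_to_subspace_exists_gen) (use that in blast)
    have re: "inner w y = Re (cdot y w)" for y :: "complex^'n"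
      by (simp add: inner_vec_def cdot_def inner_complex_def algebra_simps)
    have cd: "cdot y w = 0" if "y \<in> V" for y
    proof -
      \<comment> \<open>\<open>V\<close> is closed under multiplication by \<open>\<i>\<close>,
        which upgrades real orthogonality to the Hermitian one.\<close>
      have "Re (cdot y w) = 0" "Re (cdot (\<i> *s y) w) = 0"
        using w(2)[of y] w(2)[of "\<i> *s y"] that Vscale[OF that, of \<i>] span_base[of _ V] by (auto simp: orthogonal_def re)
      then show ?thesis by (simp add: cdot_simps complex_eq_iff)
    qed
    have "cdot v (K t 0 *v w) = 0" if "0 \<le> t" for t v
      using K_adjoint_at_zero[OF that, of v w] cd[OF VK[OF that]] by simp
    then have Kz: "K t 0 *v w = 0" if "0 \<le> t" for t
      using that cdot_self[of "K t 0 *v w"] by simp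
    obtain Z where Z: "solves 0 Z" "\<And>x. upper (Z x) = K x 0 *v w" "lower (Z 0) = w"
      using cauchy_solution[of 0] by blast
    have "lower (Z 0) = 0"
      by (rule quasi_derivative_zero(2)[where f = "\<lambda>x. upper (Z x)" and a = 0 and b = 1])
         (use Z Kz in \<open>auto simp: solves_def image_pair_def\<close>)
    then show False using w Z by simp
  qed
  then obtain Y where Y: "solves 0 Y" "upper p = upper (Y 0)" unfolding V_def by blast
  obtain Z where Z: "solves 0 Z" "\<And>x. upper (Z x) = K x 0 *v (lower p - lower (Y 0))" "lower (Z 0) = lower p - lower (Y 0)"
    using cauchy_solution[of 0] by blast
  have "Y 0 + Z 0 = p"
    by (rule block_eqI) (simp_all add: block_simps Y Z K_diagonal mv.zero_left)
  then show ?thesis using solves_add[OF Y(1) Z(1)] by blast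
qed

lemma fundamental_exists: "\<exists>F. fundamental 0 F"
proof -
  obtain Y where "\<And>k. solves 0 (Y k) \<and> Y k 0 = axis k 1"
    using choice[of "\<lambda>k Y. solves 0 Y \<and> Y 0 = axis k 1"] solution_with_initial_value by blast
  then show ?thesis using fundamentalI[of 0 Y] by blast
qed

text \<open>The solution \<open>K x t *v v\<close> has the data \<open>stack 0 v\<close> at the
  point \<open>t\<close>. Carrying them back to 0 by the inverse of \<open>F t\<close> and forward
  by \<open>F x\<close> gives the formula; as 0 is real, \<open>F\<close> is its own partner for the
  conjugate parameter.\<close>

lemma K_formula:
  assumes F: "fundamental 0 F" and "0 \<le> x" "0 \<le> t"
  shows "K x t = upper (F x) ** (symplectic ** conj_transpose (upper (F t)))"
proof (rule matrix_eqI)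
  fix v
  have G: "fundamental (cnj 0) F" using F by simp
  obtain Y where Y: "solves 0 Y" "\<And>x. upper (Y x) = K x t *v v" "lower (Y t) = v"
    using cauchy_solution[OF \<open>0 \<le> t\<close>] by blast
  have "Y t = stack 0 v" by (rule block_eqI) (simp_all add: Y K_diagonal assms mv.zero_left)
  then have "F t *v Y 0 = stack 0 v" using fundamental_unique[OF F G Y(1) \<open>0 \<le> t\<close>] by simp
  then have "fundamental_inverse (F t) *v (F t *v Y 0) = fundamental_inverse (F t) *v stack 0 v" by simp
  then have "Y 0 = symplectic *v (conj_transpose (upper (F t)) *v v)"
    by (simp only: fundamental_inverse_stack matrix_vector_mul_assoc fundamental_inverse(1)[OF F G \<open>0 \<le> t\<close>] matrix_vector_mul_lid)
  then have "K x t *v v = upper (F x *v (symplectic *v (conj_transpose (upper (F t)) *v v)))"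
    using fundamental_unique[OF F G Y(1) \<open>0 \<le> x\<close>] Y(2)[of x] by simp
  then show "K x t *v v = (upper (F x) ** (symplectic ** conj_transpose (upper (F t)))) *v v"
    by (simp add: block_mult matrix_vector_mul_assoc matrix_mul_assoc)
qed

end

section \<open>Square-integrable functions\<close>

abbreviation halfline :: "real measure" where "halfline \<equiv> lebesgue_on {0..}"

text \<open>The passage between Lebesgue integrals over the half-line, in which the operators are
  defined, and gauge integrals over finite intervals, in which the estimates are carried
  out.\<close>

lemma integrable_halfline_piece:
  fixes \<phi> :: "real \<Rightarrow> 'a::euclidean_space"
  assumes "continuous_on {c..d} \<phi>" "0 \<le> c"
  shows "integrable halfline (\<lambda>x. indicator {c..d} x *\<^sub>R \<phi> x)"
    and "(LINT x|halfline. indicator {c..d} x *\<^sub>R \<phi> x) = integral {c..d} \<phi>"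
proof -
  have ai: "set_integrable lebesgue {c..d} \<phi>"
    using assms(1) by (rule absolutely_integrable_continuous_real)
  have eq: "indicat_real {0..} x * indicat_real {c..d} x = indicat_real {c..d} x" for x
    using assms(2) by (auto simp: indicator_def)
  show "integrable halfline (\<lambda>x. indicator {c..d} x *\<^sub>R \<phi> x)"
    using ai by (subst integrable_restrict_space) (simp_all add: eq set_integrable_def)
  show "(LINT x|halfline. indicator {c..d} x *\<^sub>R \<phi> x) = integral {c..d} \<phi>"
    using set_lebesgue_integral_eq_integral(2)[OF ai]
    by (subst integral_restrict_space) (simp_all add: eq set_lebesgue_integral_def)
qed

lemma continuous_measurable_halfline:
  fixes \<phi> :: "real \<Rightarrow> 'a::euclidean_space"
  assumes "continuous_on {0..} \<phi>"
  shows "\<phi> \<in> borel_measurable halfline"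
  using assms by (intro continuous_imp_measurable_on_sets_lebesgue) auto

text \<open>For the converse direction monotone convergence is applied to the truncations at the
  natural numbers.\<close>

lemma integrable_halfline_iff_bounded:
  fixes g :: "real \<Rightarrow> real"
  assumes g: "continuous_on {0..} g" and nonneg: "\<And>x. 0 \<le> g x"
  shows "integrable halfline g \<longleftrightarrow> (\<exists>B. \<forall>b\<ge>0. integral {0..b} g \<le> B)"
proof
  assume i: "integrable halfline g"
  have "integral {0..b} g \<le> (LINT x|halfline. g x)" for b
  proof -
    have c: "continuous_on {0..b} g" using g by (rule continuous_on_subset) auto
    have "(LINT x|halfline. indicator {0..b} x *\<^sub>R g x) \<le> (LINT x|halfline. g x)"
      by (rule integral_mono[OF integrable_halfline_piece(1)[OF c order_refl] i])
         (use nonneg in \<open>auto simp: indicator_def\<close>)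
    then show ?thesis using integrable_halfline_piece(2)[OF c order_refl] by simp
  qed
  then show "\<exists>B. \<forall>b\<ge>0. integral {0..b} g \<le> B" by blast
next
  assume "\<exists>B. \<forall>b\<ge>0. integral {0..b} g \<le> B"
  then obtain B where B: "\<And>b. 0 \<le> b \<Longrightarrow> integral {0..b} g \<le> B" by blast
  let ?f = "\<lambda>k x. if x \<in> {0..real k} then g x else 0"
  have sub: "{0..real k} \<inter> {0..} = {0..real k}" for k by auto
  have int: "?f k integrable_on {0..}" for k
    using continuous_halfline_facts(2)[OF g, of 0 "real k"]
    by (subst integrable_restrict_Int) (simp add: sub)
  have I: "integral {0..} (?f k) = integral {0..real k} g" for k
    by (subst integral_restrict_Int) (simp add: sub)
  have "g integrable_on {0..} \<and> ((\<lambda>k. integral {0..} (?f k)) \<longlongrightarrow> integral {0..} g) sequentially"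
  proof (rule monotone_convergence_increasing)
    show "bounded (range (\<lambda>k. integral {0..} (?f k)))"
    proof -
      have "0 \<le> integral {0..real k} g" for k
        by (rule integral_nonneg[OF continuous_halfline_facts(2)[OF g]]) (use nonneg in auto)
      then have "\<bar>integral {0..} (?f k)\<bar> \<le> B" for k unfolding I using B[of "real k"] by simp
      then show ?thesis unfolding bounded_iff by auto
    qed
    fix x :: real assume "x \<in> {0..}"
    have "eventually (\<lambda>k. x \<le> real k) sequentially"
      by (rule eventually_sequentiallyI[of "nat \<lceil>x\<rceil>"]) linarith
    then have "eventually (\<lambda>k. ?f k x = g x) sequentially"
      by eventually_elim (use \<open>x \<in> {0..}\<close> in simp)
    then show "(\<lambda>k. ?f k x) \<longlonglongrightarrow> g x" by (rule tendsto_eventually)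
  qed (use int nonneg in auto)
  then have "g absolutely_integrable_on {0..}"
    by (intro nonnegative_absolutely_integrable_1) (use nonneg in auto)
  then show "integrable halfline g"
    by (subst set_integrable_eq[symmetric]) auto
qed

lemma square_integrable_iff:
  "square_integrable f \<longleftrightarrow> f \<in> borel_measurable halfline \<and> integrable halfline (\<lambda>x. (norm (f x))\<^sup>2)"
  unfolding square_integrable_def norm_vec_squared ..

lemma square_integrable_continuous_iff:
  assumes "continuous_on {0..} f"
  shows "square_integrable f \<longleftrightarrow> bounded_energy f"
proof -
  have "continuous_on {0..} (\<lambda>x. (norm (f x))\<^sup>2)" by (intro continuous_intros assms)
  then show ?thesis
    unfolding square_integrable_iff bounded_energy_def
    using continuous_measurable_halfline[OF assms] integrable_halfline_iff_bounded by simp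
qed

lemma square_integrable_cong:
  assumes "\<And>x. 0 \<le> x \<Longrightarrow> f x = g x" "square_integrable f"
  shows "square_integrable g"
proof -
  have "g \<in> borel_measurable halfline \<longleftrightarrow> f \<in> borel_measurable halfline"
    by (rule measurable_cong) (use assms in auto)
  moreover have "integrable halfline (\<lambda>x. (norm (g x))\<^sup>2) \<longleftrightarrow> integrable halfline (\<lambda>x. (norm (f x))\<^sup>2)"
    by (rule Bochner_Integration.integrable_cong) (use assms in auto)
  ultimately show ?thesis using assms(2) unfolding square_integrable_iff by blast
qed

lemma square_integrable_add:
  assumes "square_integrable f" "square_integrable g"
  shows "square_integrable (\<lambda>x. f x + g x)"
  unfolding square_integrable_iff
proof
  have m: "f \<in> borel_measurable halfline" "g \<in> borel_measurable halfline"
    and i: "integrable halfline (\<lambda>x. (norm (f x))\<^sup>2)" "integrable halfline (\<lambda>x. (norm (g x))\<^sup>2)"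
    using assms unfolding square_integrable_iff by auto
  show s: "(\<lambda>x. f x + g x) \<in> borel_measurable halfline" using m by measurable
  show "integrable halfline (\<lambda>x. (norm (f x + g x))\<^sup>2)"
  proof (rule Bochner_Integration.integrable_bound)
    show "integrable halfline (\<lambda>x. 2 * (norm (f x))\<^sup>2 + 2 * (norm (g x))\<^sup>2)" using i by simp
    show "(\<lambda>x. (norm (f x + g x))\<^sup>2) \<in> borel_measurable halfline" using s by measurable
    have "(norm (f x + g x))\<^sup>2 \<le> 2 * (norm (f x))\<^sup>2 + 2 * (norm (g x))\<^sup>2" for x
    proof -
      have "(norm (f x + g x))\<^sup>2 \<le> (norm (f x) + norm (g x))\<^sup>2"
        by (intro power_mono norm_triangle_ineq) auto
      also have "\<dots> \<le> 2 * (norm (f x))\<^sup>2 + 2 * (norm (g x))\<^sup>2"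
        using sum_squares_bound[of "norm (f x)" "norm (g x)"] by (simp add: power2_sum)
      finally show ?thesis .
    qed
    then show "AE x in halfline. norm ((norm (f x + g x))\<^sup>2) \<le> norm (2 * (norm (f x))\<^sup>2 + 2 * (norm (g x))\<^sup>2)"
      by simp
  qed
qed

lemma norm_scale: "norm (c *s x) = cmod c * norm (x :: complex^'n)"
  by (simp add: norm_vec_def L2_set_def norm_mult power_mult_distrib sum_distrib_left[symmetric] real_sqrt_mult)

lemma square_integrable_scale:
  assumes "square_integrable f"
  shows "square_integrable (\<lambda>x. c *s f x)"
  unfolding square_integrable_iff
proof
  show "(\<lambda>x. c *s f x) \<in> borel_measurable halfline"
    by (rule borel_measurable_continuous_on[OF linear_continuous_on[OF bounded_linear_scale]])
       (use assms in \<open>simp add: square_integrable_iff\<close>)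
  show "integrable halfline (\<lambda>x. (norm (c *s f x))\<^sup>2)"
    using assms unfolding square_integrable_iff norm_scale power_mult_distrib by simp
qed

lemma square_integrable_diff:
  assumes "square_integrable f" "square_integrable g"
  shows "square_integrable (\<lambda>x. f x - g x)"
proof -
  have eq: "f x + (- 1) *s g x = f x - g x" for x by (simp add: vec_eq_iff)
  show ?thesis
    using square_integrable_add[OF assms(1) square_integrable_scale[OF assms(2), of "- 1"]] by (simp only: eq)
qed

lemma square_integrable_piece:
  assumes "continuous_on {c..d} \<phi>" "0 \<le> c"
  shows "square_integrable (\<lambda>x. indicator {c..d} x *\<^sub>R \<phi> x)"
  unfolding square_integrable_iff
proof
  show "(\<lambda>x. indicator {c..d} x *\<^sub>R \<phi> x) \<in> borel_measurable halfline"
    by (rule borel_measurable_integrable[OF integrable_halfline_piece(1)[OF assms]])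
  have "integrable halfline (\<lambda>x. indicator {c..d} x *\<^sub>R (norm (\<phi> x))\<^sup>2)"
    using assms by (intro integrable_halfline_piece(1) continuous_intros)
  moreover have "indicator {c..d} x *\<^sub>R (norm (\<phi> x))\<^sup>2 = (norm (indicator {c..d} x *\<^sub>R \<phi> x))\<^sup>2" for x
    by (simp add: indicator_def)
  ultimately show "integrable halfline (\<lambda>x. (norm (indicator {c..d} x *\<^sub>R \<phi> x))\<^sup>2)" by simp
qed

lemma measurable_cdot:
  assumes "f \<in> borel_measurable M" "g \<in> borel_measurable M"
  shows "(\<lambda>x. cdot (f x) (g x)) \<in> borel_measurable M"
proof -
  have "continuous_on UNIV (\<lambda>p. cdot (fst p) (snd p))"
    by (intro cdot.continuous_on continuous_intros)
  from borel_measurable_continuous_on[OF this, of "\<lambda>x. (f x, g x)"] show ?thesis using assms by simp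
qed

lemma integrable_norm_product:
  assumes "square_integrable f" "square_integrable g"
  shows "integrable halfline (\<lambda>x. norm (f x) * norm (g x))"
proof (rule Bochner_Integration.integrable_bound)
  show "integrable halfline (\<lambda>x. (norm (f x))\<^sup>2 + (norm (g x))\<^sup>2)"
    using assms unfolding square_integrable_iff by simp
  show "(\<lambda>x. norm (f x) * norm (g x)) \<in> borel_measurable halfline"
    using assms unfolding square_integrable_iff by (intro borel_measurable_times borel_measurable_norm) auto
  have "norm (f x) * norm (g x) \<le> (norm (f x))\<^sup>2 + (norm (g x))\<^sup>2" for x
    using sum_squares_bound[of "norm (f x)" "norm (g x)"] mult_nonneg_nonneg[OF norm_ge_zero[of "f x"] norm_ge_zero[of "g x"]]
    by linarith
  then show "AE x in halfline. norm (norm (f x) * norm (g x)) \<le> norm ((norm (f x))\<^sup>2 + (norm (g x))\<^sup>2)"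
    by simp
qed

lemma integrable_cdot:
  assumes "square_integrable f" "square_integrable g"
  shows "integrable halfline (\<lambda>x. cdot (f x) (g x))"
proof (rule Bochner_Integration.integrable_bound[OF integrable_norm_product[OF assms]])
  show "(\<lambda>x. cdot (f x) (g x)) \<in> borel_measurable halfline"
    using assms measurable_cdot unfolding square_integrable_iff by blast
qed (simp add: norm_cdot_le)

lemma l2_inner_cdot: "l2_inner f g = (LINT x|halfline. cdot (f x) (g x))"
  by (simp add: l2_inner_def cdot_def)

lemma l2_norm_norm: "l2_norm f = sqrt (LINT x|halfline. (norm (f x))\<^sup>2)"
  by (simp add: l2_norm_def norm_vec_squared)

lemma l2_inner_Cauchy_Schwarz:
  assumes "square_integrable f" "square_integrable g"
  shows "cmod (l2_inner f g) \<le> l2_norm f * l2_norm g"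
proof -
  define A where "A = (LINT x|halfline. (norm (f x))\<^sup>2)"
  define B where "B = (LINT x|halfline. (norm (g x))\<^sup>2)"
  define M where "M = (LINT x|halfline. norm (f x) * norm (g x))"
  have i: "integrable halfline (\<lambda>x. (norm (f x))\<^sup>2)" "integrable halfline (\<lambda>x. (norm (g x))\<^sup>2)"
    using assms unfolding square_integrable_iff by auto
  note p = integrable_norm_product[OF assms]
  have "cmod (l2_inner f g) \<le> (LINT x|halfline. norm (cdot (f x) (g x)))"
    unfolding l2_inner_cdot by (rule integral_norm_bound)
  also have "\<dots> \<le> M"
    unfolding M_def by (intro integral_mono p integrable_norm integrable_cdot assms norm_cdot_le)
  finally have 1: "cmod (l2_inner f g) \<le> M" .
  have AB: "0 \<le> A" "0 \<le> B" "0 \<le> M" unfolding A_def B_def M_def by (auto intro!: integral_nonneg_AE)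
  \<comment> \<open>The square \<open>(t * norm (f x) - norm (g x))\<^sup>2\<close> has a
    nonnegative integral for every real \<open>t\<close>.\<close>
  have q: "2 * t * M \<le> t\<^sup>2 * A + B" for t
  proof -
    have "0 \<le> (LINT x|halfline. (t * norm (f x) - norm (g x))\<^sup>2)" by (rule integral_nonneg_AE) simp
    also have "\<dots> = (LINT x|halfline. t\<^sup>2 * (norm (f x))\<^sup>2 + (norm (g x))\<^sup>2 - (2 * t) * (norm (f x) * norm (g x)))"
      by (intro Bochner_Integration.integral_cong refl) (simp add: power2_diff power_mult_distrib mult_ac)
    also have "\<dots> = t\<^sup>2 * A + B - 2 * t * M" unfolding A_def B_def M_def using i p by simp
    finally show ?thesis by simp
  qed
  have "M\<^sup>2 \<le> A * B"
  proof (cases "A = 0")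
    case True
    have "M = 0"
    proof (rule ccontr)
      assume "M \<noteq> 0"
      \<comment> \<open>For \<open>A = 0\<close> this choice of \<open>t\<close> would give
        \<open>B + 1 \<le> B\<close>.\<close>
      then show False using q[of "(B + 1) / (2 * M)"] True by simp
    qed
    then show ?thesis using AB by simp
  next
    case False
    then show ?thesis using q[of "M / A"] AB by (simp add: power2_eq_square field_simps)
  qed
  then have "M \<le> sqrt A * sqrt B" using AB by (metis real_le_rsqrt real_sqrt_mult)
  then show ?thesis using 1 unfolding l2_norm_norm A_def B_def by linarith
qed

text \<open>The positive and the negative part are densities of two finite measures. These agree on
  all open right rays, hence everywhere, and finite densities are unique almost everywhere.\<close>

lemma AE_zero_if_halfray_integrals_zero:
  fixes \<phi> :: "real \<Rightarrow> real"
  assumes i: "integrable lebesgue \<phi>" and z: "\<And>x. (LINT y|lebesgue. indicator {x<..} y *\<^sub>R \<phi> y) = 0"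
  shows "AE x in lebesgue. \<phi> x = 0"
proof -
  \<comment> \<open>The comparison of measures takes place on the Borel sets, so a Borel
    representative replaces \<open>\<phi>\<close>.\<close>
  obtain g where g[measurable]: "g \<in> borel_measurable lborel" and ae: "AE x in lborel. \<phi> x = g x"
    using completion_ex_borel_measurable_real[of \<phi> lborel] i by blast
  have ael: "AE x in lebesgue. \<phi> x = g x" using ae by (simp add: AE_completion_iff)
  have gl: "g \<in> borel_measurable lebesgue" using g by (rule measurable_completion)
  have "integrable lebesgue g"
    by (rule Bochner_Integration.integrable_cong_AE_imp[OF i gl]) (use ael in auto)
  then have gi: "integrable lborel g" using g by (simp add: integrable_completion)
  have gz: "(LINT y|lborel. indicator {x<..} y * g y) = 0" for x
  proof -
    have "(LINT y|lborel. indicator {x<..} y * g y) = (LINT y|lebesgue. indicator {x<..} y * g y)"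
      by (rule integral_completion[symmetric]) measurable
    also have "\<dots> = (LINT y|lebesgue. indicator {x<..} y *\<^sub>R \<phi> y)"
    proof (rule integral_cong_AE)
      show "(\<lambda>y. indicator {x<..} y *\<^sub>R \<phi> y) \<in> borel_measurable lebesgue"
        using i by (intro borel_measurable_scaleR borel_measurable_indicator) auto
      show "(\<lambda>y. indicator {x<..} y * g y) \<in> borel_measurable lebesgue"
        by (rule measurable_completion) measurable
    qed (use ael in auto)
    finally show ?thesis using z by simp
  qed
  \<comment> \<open>As \<open>ennreal\<close> sends negative numbers to 0, \<open>M\<close> and
    \<open>N\<close> have the positive and the negative part of \<open>g\<close> as
    densities.\<close>
  define M where "M = density lborel (\<lambda>y. ennreal (g y))"
  define N where "N = density lborel (\<lambda>y. ennreal (- g y))"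
  have fin: "(\<integral>\<^sup>+y. ennreal (h y) * indicator A y \<partial>lborel) < \<infinity>" if "integrable lborel h" "A \<in> sets borel" for h :: "real \<Rightarrow> real" and A
  proof -
    have "(\<integral>\<^sup>+y. ennreal (h y) * indicator A y \<partial>lborel) \<le> (\<integral>\<^sup>+y. ennreal (norm (h y)) \<partial>lborel)"
      by (intro nn_integral_mono) (auto simp: indicator_def ennreal_leI)
    also have "\<dots> < \<infinity>" using that(1) by (simp add: integrable_iff_bounded)
    finally show ?thesis .
  qed
  have "M = N"
  proof (rule measure_eqI_lessThan)
    show "sets M = sets borel" "sets N = sets borel" by (simp_all add: M_def N_def)
    fix x
    have eM: "emeasure M {x<..} = (\<integral>\<^sup>+y. ennreal (g y) * indicator {x<..} y \<partial>lborel)"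
      unfolding M_def by (rule emeasure_density) auto
    have eN: "emeasure N {x<..} = (\<integral>\<^sup>+y. ennreal (- g y) * indicator {x<..} y \<partial>lborel)"
      unfolding N_def by (rule emeasure_density) auto
    show "emeasure M {x<..} < \<infinity>" unfolding eM by (rule fin[OF gi]) simp
    have N: "emeasure N {x<..} < \<infinity>" unfolding eN by (rule fin) (use gi in auto)
    have "integrable lborel (\<lambda>y. indicator {x<..} y * g y)"
      using integrable_mult_indicator[OF _ gi, of "{x<..}"] by simp
    then have "(LINT y|lborel. indicator {x<..} y * g y) = 
      enn2real (\<integral>\<^sup>+y. ennreal (indicator {x<..} y * g y) \<partial>lborel) - enn2real (\<integral>\<^sup>+y. ennreal (- (indicator {x<..} y * g y)) \<partial>lborel)"
      by (rule real_lebesgue_integral_def)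
    moreover have "(\<integral>\<^sup>+y. ennreal (indicator {x<..} y * g y) \<partial>lborel) = emeasure M {x<..}"
      unfolding eM by (intro nn_integral_cong) (auto simp: indicator_def)
    moreover have "(\<integral>\<^sup>+y. ennreal (- (indicator {x<..} y * g y)) \<partial>lborel) = emeasure N {x<..}"
      unfolding eN by (intro nn_integral_cong) (auto simp: indicator_def)
    ultimately have "enn2real (emeasure M {x<..}) = enn2real (emeasure N {x<..})" using gz[of x] by simp
    moreover have "emeasure M {x<..} < \<infinity>" unfolding eM by (rule fin[OF gi]) simp
    ultimately show "emeasure M {x<..} = emeasure N {x<..}"
      using N by (metis ennreal_enn2real infinity_ennreal_def)
  qed
  moreover have "(\<integral>\<^sup>+y. ennreal (g y) \<partial>lborel) \<noteq> \<infinity>" using fin[OF gi, of UNIV] by simp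
  ultimately have "AE x in lborel. ennreal (g x) = ennreal (- g x)"
    unfolding M_def N_def by (subst (asm) finite_density_unique) auto
  then have "AE x in lborel. g x = 0"
    by eventually_elim (smt (verit) ennreal_eq_0_iff ennreal_neg)
  then have "AE x in lborel. \<phi> x = 0" using ae by eventually_elim simp
  then show ?thesis by (simp add: AE_completion_iff)
qed

section \<open>Defect subspaces\<close>

lemma halfline_piece_integral:
  fixes \<phi> :: "real \<Rightarrow> 'a::euclidean_space"
  assumes "integrable halfline \<phi>" "0 \<le> c"
  shows "(LINT x|halfline. indicator {c..d} x *\<^sub>R \<phi> x) = integral {c..d} \<phi>"
proof -
  have "set_integrable lebesgue {0..} \<phi>" using assms(1) by (subst set_integrable_eq) auto
  then have ai: "set_integrable lebesgue {c..d} \<phi>"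
    by (rule set_integrable_subset) (use assms(2) in auto)
  have eq: "indicat_real {0..} x * indicat_real {c..d} x = indicat_real {c..d} x" for x
    using assms(2) by (auto simp: indicator_def)
  show ?thesis
    using set_lebesgue_integral_eq_integral(2)[OF ai]
    by (subst integral_restrict_space) (simp_all add: eq set_lebesgue_integral_def)
qed

lemma compact_support_bounds:
  assumes "compact_support_in_pos f"
  obtains \<alpha> \<beta> where "0 < \<alpha>" "\<alpha> < \<beta>" "\<And>x. 0 \<le> x \<Longrightarrow> f x \<noteq> 0 \<Longrightarrow> \<alpha> \<le> x \<and> x \<le> \<beta>"
proof -
  define C where "C = closure {x. 0 \<le> x \<and> f x \<noteq> 0}"
  have C: "compact C" "C \<subseteq> {0<..}"
    using assms unfolding compact_support_in_pos_def C_def by simp_all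
  have sub: "{x. 0 \<le> x \<and> f x \<noteq> 0} \<subseteq> C" unfolding C_def by (rule closure_subset)
  show thesis
  proof (cases "C = {}")
    case True
    then show ?thesis using sub by (intro that[of 1 2]) auto
  next
    case False
    then obtain s where s: "s \<in> C" "\<And>t. t \<in> C \<Longrightarrow> s \<le> t" using compact_attains_inf[OF C(1)] by blast
    obtain r where r: "r \<in> C" "\<And>t. t \<in> C \<Longrightarrow> t \<le> r" using compact_attains_sup[OF C(1) False] by blast
    have mem: "x \<in> C" if "0 \<le> x" "f x \<noteq> 0" for x using sub that by blast
    show ?thesis
    \<comment> \<open>Adding 1 keeps the two bounds distinct even if the support is a single
      point.\<close>
    proof (rule that[of s "r + 1"])
      show "0 < s" using s C by auto
      show "s < r + 1" using s(2)[OF r(1)] by simp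
      show "s \<le> x \<and> x \<le> r + 1" if "0 \<le> x" "f x \<noteq> 0" for x
        using s(2)[OF mem[OF that]] r(2)[OF mem[OF that]] by simp
    qed
  qed
qed

lemma isCont_piece:
  fixes \<phi> :: "real \<Rightarrow> 'a::real_normed_vector"
  assumes "isCont \<phi> x" "x \<noteq> c" "x \<noteq> d"
  shows "isCont (\<lambda>x. indicator {c..d} x *\<^sub>R \<phi> x) x"
proof -
  consider "x \<in> {c<..<d}" | "x \<in> {..<c} \<union> {d<..}" using assms(2,3) by fastforce
  then show ?thesis
  proof cases
    case 1
    then have "eventually (\<lambda>y. y \<in> {c<..<d}) (nhds x)" by (intro eventually_nhds_in_open) auto
    then have "eventually (\<lambda>y. indicator {c..d} y *\<^sub>R \<phi> y = \<phi> y) (nhds x)"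
      by eventually_elim auto
    then show ?thesis using isCont_cong assms(1) by fast
  next
    case 2
    then have "eventually (\<lambda>y. y \<in> {..<c} \<union> {d<..}) (nhds x)" by (intro eventually_nhds_in_open) auto
    then have "eventually (\<lambda>y. indicator {c..d} y *\<^sub>R \<phi> y = 0) (nhds x)"
      by eventually_elim auto
    then show ?thesis using isCont_cong[of _ "\<lambda>_. 0"] by fastforce
  qed
qed

lemma piece_facts:
  fixes \<phi> :: "real \<Rightarrow> 'a::euclidean_space"
  assumes "continuous_on {0..} \<phi>" "0 \<le> c"
  shows "(\<lambda>x. indicator {c..d} x *\<^sub>R \<phi> x) integrable_on {0..b}"
    and "d \<le> b \<Longrightarrow> integral {0..b} (\<lambda>x. indicator {c..d} x *\<^sub>R \<phi> x) = integral {c..d} \<phi>"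
    and "b < c \<Longrightarrow> integral {0..b} (\<lambda>x. indicator {c..d} x *\<^sub>R \<phi> x) = 0"
    and "0 \<le> b \<Longrightarrow> \<exists>B. \<forall>x\<in>{0..b}. norm (indicator {c..d} x *\<^sub>R \<phi> x) \<le> B"
proof -
  have eq: "(\<lambda>x. indicator {c..d} x *\<^sub>R \<phi> x) = (\<lambda>x. if x \<in> {c..d} then \<phi> x else 0)"
    by (auto simp: indicator_def)
  have "{c..d} \<inter> {0..b} = {c..min d b}" using assms(2) by auto
  then show "(\<lambda>x. indicator {c..d} x *\<^sub>R \<phi> x) integrable_on {0..b}"
    unfolding eq integrable_restrict_Int using continuous_halfline_facts(2)[OF assms(1), of c "min d b"] assms(2) by simp
  show "integral {0..b} (\<lambda>x. indicator {c..d} x *\<^sub>R \<phi> x) = integral {c..d} \<phi>" if "d \<le> b"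
  proof -
    have "{c..d} \<inter> {0..b} = {c..d}" using assms(2) that by auto
    then show ?thesis unfolding eq integral_restrict_Int by (simp only:)
  qed
  show "integral {0..b} (\<lambda>x. indicator {c..d} x *\<^sub>R \<phi> x) = 0" if "b < c"
  proof -
    have "{c..d} \<inter> {0..b} = {}" using that by auto
    then show ?thesis unfolding eq integral_restrict_Int by simp
  qed
  show "\<exists>B. \<forall>x\<in>{0..b}. norm (indicator {c..d} x *\<^sub>R \<phi> x) \<le> B" if b: "0 \<le> b"
  proof -
    obtain B where B: "\<And>t. t \<in> {0..b} \<Longrightarrow> norm (\<phi> t) \<le> B"
      using continuous_halfline_facts(4)[OF assms(1) b] by blast
    have "norm (indicator {c..d} x *\<^sub>R \<phi> x) \<le> B" if x: "x \<in> {0..b}" for x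
      using B[OF x] order_trans[OF norm_ge_zero B[OF x]] by (auto simp: indicator_def)
    then show ?thesis by blast
  qed
qed

text \<open>Unit vectors for \<open>v\<close> isolate the components of \<open>w\<close>, and their
  real and imaginary parts, cut off outside the interval, fall under the criterion with
  rays.\<close>

lemma AE_zero_if_interval_integrals_zero:
  fixes w :: "real \<Rightarrow> complex^'n"
  assumes w: "square_integrable w" and ab: "0 \<le> \<alpha>" "\<alpha> < \<beta>"
    and z: "\<And>c d v. \<alpha> \<le> c \<Longrightarrow> c \<le> d \<Longrightarrow> d \<le> \<beta> \<Longrightarrow>
      (LINT x|halfline. cdot (indicator {c..d} x *\<^sub>R v) (w x)) = 0"
  shows "AE x in halfline. x \<in> {\<alpha>..\<beta>} \<longrightarrow> w x = 0"
proof -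
  have comp: "AE x in lebesgue. L (indicator {\<alpha>..\<beta>} x *\<^sub>R cnj (w x $ s)) = 0"
    if L: "bounded_linear L" for s and L :: "complex \<Rightarrow> real"
  proof -
    define \<psi> where "\<psi> x = indicator {\<alpha>..\<beta>} x *\<^sub>R cnj (w x $ s)" for x
    have cd: "cdot (indicator {c..d} x *\<^sub>R axis s 1) (w x) = indicator {c..d} x *\<^sub>R cnj (w x $ s)" for c d x
      by (simp add: cdot_def axis_def if_distrib if_distribR indicator_def cong: if_cong)
    have sq: "square_integrable (\<lambda>x. indicator {c..d} x *\<^sub>R (axis s 1 :: complex^'n))" if "0 \<le> c" for c d
      using that by (intro square_integrable_piece) auto
    have int: "integrable halfline (\<lambda>x. indicator {c..d} x *\<^sub>R cnj (w x $ s))" if "0 \<le> c" for c d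
      using integrable_cdot[OF sq[OF that] w] unfolding cd .
    have ind: "indicat_real {0..} x * indicat_real {c..d} x = indicat_real {c..d} x" if "0 \<le> c" for c d x :: real
      using that by (auto simp: indicator_def)
    have intl: "integrable lebesgue (\<lambda>x. indicator {c..d} x *\<^sub>R cnj (w x $ s))" if "0 \<le> c" for c d
      using int[OF that, of d] by (subst (asm) integrable_restrict_space) (simp_all add: ind that)
    have zl: "(LINT x|lebesgue. indicator {c..d} x *\<^sub>R cnj (w x $ s)) = 0" if "\<alpha> \<le> c" "c \<le> d" "d \<le> \<beta>" for c d
      using z[OF that, of "axis s 1"] ab that unfolding cd
      by (subst (asm) integral_restrict_space) (simp_all add: ind)
    have z\<psi>: "(LINT y|lebesgue. indicator {x<..} y *\<^sub>R \<psi> y) = 0" for x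
    proof -
      \<comment> \<open>Up to the single point \<open>x\<close>, the ray meets the interval in a
        closed interval, for which the hypothesis is available.\<close>
      have e: "(LINT y|lebesgue. indicator {x<..} y *\<^sub>R \<psi> y) = (LINT y|lebesgue. indicator {max x \<alpha>..\<beta>} y *\<^sub>R cnj (w y $ s))"
      proof (rule integral_cong_AE)
        show "(\<lambda>y. indicator {x<..} y *\<^sub>R \<psi> y) \<in> borel_measurable lebesgue"
        proof (intro borel_measurable_scaleR borel_measurable_indicator)
          show "\<psi> \<in> borel_measurable lebesgue"
            using borel_measurable_integrable[OF intl[OF ab(1), of \<beta>]] unfolding \<psi>_def .
        qed auto
        show "(\<lambda>y. indicator {max x \<alpha>..\<beta>} y *\<^sub>R cnj (w y $ s)) \<in> borel_measurable lebesgue"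
          using intl[of "max x \<alpha>" \<beta>] ab by (intro borel_measurable_integrable) auto
        have "AE y in lebesgue. y \<noteq> x" by (simp add: AE_completion_iff AE_lborel_singleton)
        then show "AE y in lebesgue. indicator {x<..} y *\<^sub>R \<psi> y = indicator {max x \<alpha>..\<beta>} y *\<^sub>R cnj (w y $ s)"
          by eventually_elim (auto simp: \<psi>_def indicator_def)
      qed
      show ?thesis
      proof (cases "x \<le> \<beta>")
        case True then show ?thesis unfolding e using ab by (intro zl) auto
      next
        case False
        then have "{max x \<alpha>..\<beta>} = {}" by auto
        then show ?thesis unfolding e by (simp add: max_def)
      qed
    qed
    have "AE x in lebesgue. L (\<psi> x) = 0"
    proof (rule AE_zero_if_halfray_integrals_zero)
      have \<psi>i: "integrable lebesgue \<psi>" using intl[OF ab(1)] unfolding \<psi>_def .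
      show "integrable lebesgue (\<lambda>x. L (\<psi> x))"
        by (rule integrable_bounded_linear[OF L \<psi>i])
      fix x
      have "integrable lebesgue (\<lambda>y. indicator {x<..} y *\<^sub>R \<psi> y)"
        by (rule integrable_mult_indicator[OF _ \<psi>i]) auto
      then have "(LINT y|lebesgue. L (indicator {x<..} y *\<^sub>R \<psi> y)) = L (LINT y|lebesgue. indicator {x<..} y *\<^sub>R \<psi> y)"
        by (rule integral_bounded_linear[OF L])
      then show "(LINT y|lebesgue. indicator {x<..} y *\<^sub>R L (\<psi> y)) = 0"
        using L by (simp add: z\<psi> linear_0[OF bounded_linear.linear] linear_scale[OF bounded_linear.linear])
    qed
    then show ?thesis unfolding \<psi>_def .
  qed
  have "AE x in lebesgue. \<forall>s. Re (indicator {\<alpha>..\<beta>} x *\<^sub>R cnj (w x $ s)) = 0 \<and> Im (indicator {\<alpha>..\<beta>} x *\<^sub>R cnj (w x $ s)) = 0"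
    unfolding AE_all_countable AE_conj_iff
    using comp[OF bounded_linear_Re] comp[OF bounded_linear_Im] by blast
  then have "AE x in lebesgue. x \<in> {0..} \<longrightarrow> x \<in> {\<alpha>..\<beta>} \<longrightarrow> w x = 0"
    by eventually_elim (auto simp: vec_eq_iff complex_eq_iff)
  then show ?thesis by (subst AE_restrict_space_iff) auto
qed

lemma finite_riesz:
  fixes l :: "complex^'m \<Rightarrow> complex"
  assumes add: "\<And>x y. l (x + y) = l x + l y" and scale: "\<And>c x. l (c *s x) = c * l x"
  shows "\<exists>b. \<forall>y. l y = cdot y b"
proof -
  have l0: "l 0 = 0" using scale[of 0 0] by simp
  have lsum: "l (\<Sum>k\<in>I. y $ k *s axis k 1) = (\<Sum>k\<in>I. y $ k * l (axis k 1))" if "finite I" for I :: "'m set" and y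
    using that by induction (simp_all add: l0 add scale)
  have "l y = cdot y (\<chi> k. cnj (l (axis k 1)))" for y
  proof -
    have "l y = (\<Sum>k\<in>UNIV. y $ k * l (axis k 1))"
      using lsum[OF finite_class.finite_UNIV, of y] by (simp only: basis_expansion)
    also have "\<dots> = cdot y (\<chi> k. cnj (l (axis k 1)))" by (simp add: cdot_def)
    finally show ?thesis .
  qed
  then show ?thesis by blast
qed

section \<open>The defect subspace as the space of square-integrable solutions\<close>

context quasi_expression
begin

text \<open>A solution that vanishes on an interval has zero data at the left end, and
  \<open>G a\<close> is invertible. This provides the invertible Gram matrix below and the
  positivity in the lower estimate for the Cauchy function.\<close>

lemma fundamental_nondegenerate:
  assumes F: "fundamental (cnj \<mu>) F" and G: "fundamental \<mu> G" and "0 \<le> a" "a < b"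
    and z: "\<And>t. a < t \<Longrightarrow> t < b \<Longrightarrow> upper (G t *v x) = 0"
  shows "x = 0"
proof -
  have q: "quasi_derivative P R (\<lambda>t. upper (G t *v x)) (\<lambda>t. lower (G t *v x))"
    using fundamental_solves[OF G, of x] by (simp add: solves_def image_pair_def)
  have "upper (G a *v x) = 0" "lower (G a *v x) = 0"
    using quasi_derivative_zero[OF q assms(3,4) z, of a] assms(4) by auto
  then have "G a *v x = 0" by (intro block_eqI) (simp_all add: block_simps)
  then have "fundamental_inverse (F a) *v (G a *v x) = 0" by (simp add: mv.zero_right)
  then show ?thesis
    by (simp add: matrix_vector_mul_assoc fundamental_inverse(1)[OF G F assms(3)])
qed

text \<open>The Lagrange identity on \<open>{0..\<beta>}\<close> has no boundary terms, since
  \<open>f\<close> and its quasi-derivative vanish at 0 and at \<open>\<beta>\<close>.\<close>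

lemma compactly_supported_orthogonal:
  assumes fh: "(f, h) \<in> maximal_operator P Q R" and supp: "compact_support_in_pos f"
    and Z: "solves \<mu> Z" "square_integrable (\<lambda>x. upper (Z x))"
  shows "l2_inner (\<lambda>x. h x - cnj \<mu> *s f x) (\<lambda>x. upper (Z x)) = 0"
proof -
  obtain f1 where f1: "image_pair f f1 h" and sq: "square_integrable f" "square_integrable h"
    using fh unfolding maximal_operator_def l_value_iff by auto
  have q: "quasi_derivative P R f f1" using f1 by (simp add: image_pair_def)
  obtain \<alpha> \<beta> where ab: "0 < \<alpha>" "\<alpha> < \<beta>" "\<And>x. 0 \<le> x \<Longrightarrow> f x \<noteq> 0 \<Longrightarrow> \<alpha> \<le> x \<and> x \<le> \<beta>"
    by (rule compact_support_bounds[OF supp]) (rule that)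
  obtain S where S: "negligible S" "\<And>x. 0 \<le> x \<Longrightarrow> x \<notin> S \<Longrightarrow> pointwise_image x f f1 (h x)"
    using f1 unfolding image_pair_iff by blast
  have f0: "f x = 0" if "0 \<le> x" "x < \<alpha> \<or> \<beta> < x" for x using ab(3)[OF that(1)] that(2) by force
  have z0: "f 0 = 0" "f1 0 = 0"
    using quasi_derivative_zero[OF q order_refl ab(1) f0, of 0] ab by auto
  have zb: "f x = 0" "f1 x = 0" if "\<beta> \<le> x" for x
    using quasi_derivative_zero[OF q _ _ f0, of x "x + 1" x] ab that by auto
  \<comment> \<open>Beyond \<open>\<beta>\<close> the image vanishes almost everywhere together with
    \<open>f\<close> and \<open>f1\<close>, which reduces the inner product to a finite
    interval.\<close>
  have h0: "h x = 0" if x: "\<beta> < x" "x \<notin> S" for x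
  proof -
    obtain f' g' where "(f has_vector_derivative f') (at x)" "(f1 has_vector_derivative g') (at x)"
       "h x = - (g' + conj_transpose (R x) *v f1 x - Q x *v f x)"
      using S(2)[of x] x ab unfolding pointwise_image_def by auto
    moreover have "g' = 0"
      by (rule has_vector_derivative_zero_interval[OF calculation(2), of \<beta> "x + 1"]) (use zb x in auto)
    ultimately show ?thesis using zb[of x] x by (simp add: mv.zero_right)
  qed
  define \<phi> where "\<phi> x = cdot (h x - cnj \<mu> *s f x) (upper (Z x))" for x
  have \<phi>i: "integrable halfline \<phi>"
    unfolding \<phi>_def by (intro integrable_cdot square_integrable_diff square_integrable_scale sq Z)
  have "(LINT x|halfline. \<phi> x) = (LINT x|halfline. indicator {0..\<beta>} x *\<^sub>R \<phi> x)"
  proof (rule integral_cong_AE)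
    show "\<phi> \<in> borel_measurable halfline" using \<phi>i by (rule borel_measurable_integrable)
    then show "(\<lambda>x. indicator {0..\<beta>} x *\<^sub>R \<phi> x) \<in> borel_measurable halfline"
      by (intro borel_measurable_scaleR borel_measurable_indicator) (auto simp: sets_restrict_space)
    have "\<phi> x = indicator {0..\<beta>} x *\<^sub>R \<phi> x" if "0 \<le> x" "x \<notin> S" for x
      using h0[of x] zb[of x] that by (auto simp: \<phi>_def indicator_def cdot_simps)
    then show "AE x in halfline. \<phi> x = indicator {0..\<beta>} x *\<^sub>R \<phi> x"
      unfolding AE_halfline_iff using S(1) by blast
  qed
  also have "\<dots> = integral {0..\<beta>} \<phi>" by (rule halfline_piece_integral[OF \<phi>i order_refl])
  also have "\<dots> = 0"
  proof -
    have "((\<lambda>x. cdot (h x) (upper (Z x)) - cdot (f x) (\<mu> *s upper (Z x))) has_integral 0) {0..\<beta>}"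
      using lagrange[OF f1 Z(1)[unfolded solves_def] order_refl, of \<beta>] ab z0 zb[of \<beta>] by (simp add: cdot_simps)
    moreover have "cdot (h x) (upper (Z x)) - cdot (f x) (\<mu> *s upper (Z x)) = \<phi> x" for x
      by (simp add: \<phi>_def cdot_simps)
    ultimately show ?thesis by (simp add: integral_unique)
  qed
  finally show ?thesis by (simp add: l2_inner_cdot \<phi>_def)
qed

text \<open>Orthogonality to compactly supported pairs survives the closure: the inner product
  differs from one that is zero by terms which the Cauchy-Schwarz inequality sends to 0.\<close>

lemma solution_in_defect_subspace:
  assumes Z: "solves \<mu> Z" "square_integrable (\<lambda>x. upper (Z x))"
  shows "(\<lambda>x. upper (Z x)) \<in> defect_subspace (minimal_operator P Q R) \<mu>"
proof -
  let ?g = "\<lambda>x. upper (Z x)"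
  have "l2_inner (\<lambda>x. h x - cnj \<mu> *s f x) ?g = 0" if fh: "(f, h) \<in> minimal_operator P Q R" for f h
  proof -
    obtain F H where FH: "square_integrable f" "square_integrable h"
      "\<And>k::nat. (F k, H k) \<in> maximal_operator P Q R \<and> compact_support_in_pos (F k)"
      "(\<lambda>k. l2_norm (\<lambda>x. F k x - f x)) \<longlonglongrightarrow> 0" "(\<lambda>k. l2_norm (\<lambda>x. H k x - h x)) \<longlonglongrightarrow> 0"
      using fh unfolding minimal_operator_def graph_closure_def by auto
    have sq: "square_integrable (F k)" "square_integrable (H k)" for k
      using FH(3)[of k] unfolding maximal_operator_def by auto
    let ?X = "l2_inner (\<lambda>x. h x - cnj \<mu> *s f x) ?g"
    have b: "cmod ?X \<le> l2_norm (\<lambda>x. H k x - h x) * l2_norm ?g + cmod \<mu> * (l2_norm (\<lambda>x. F k x - f x) * l2_norm ?g)" for k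
    proof -
      have "cdot (h x - cnj \<mu> *s f x) (?g x) = cdot (H k x - cnj \<mu> *s F k x) (?g x)
         - cdot (H k x - h x) (?g x) + cnj \<mu> * cdot (F k x - f x) (?g x)" for x
        by (simp add: cdot_simps algebra_simps)
      then have "?X = l2_inner (\<lambda>x. H k x - cnj \<mu> *s F k x) ?g - l2_inner (\<lambda>x. H k x - h x) ?g
          + cnj \<mu> * l2_inner (\<lambda>x. F k x - f x) ?g"
        unfolding l2_inner_cdot
        by (simp add: integrable_cdot square_integrable_diff square_integrable_scale sq FH(1,2) Z)
      also have "l2_inner (\<lambda>x. H k x - cnj \<mu> *s F k x) ?g = 0"
        using compactly_supported_orthogonal[OF _ _ Z] FH(3) by blast
      finally have "cmod ?X \<le> cmod (l2_inner (\<lambda>x. H k x - h x) ?g) + cmod (cnj \<mu> * l2_inner (\<lambda>x. F k x - f x) ?g)"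
        by (metis (no_types, lifting) diff_0 norm_minus_cancel norm_triangle_ineq)
      also have "\<dots> \<le> l2_norm (\<lambda>x. H k x - h x) * l2_norm ?g + cmod \<mu> * (l2_norm (\<lambda>x. F k x - f x) * l2_norm ?g)"
        unfolding norm_mult complex_mod_cnj
        by (intro add_mono mult_left_mono l2_inner_Cauchy_Schwarz square_integrable_diff sq FH(1,2) Z) auto
      finally show ?thesis .
    qed
    have "(\<lambda>k. l2_norm (\<lambda>x. H k x - h x) * l2_norm ?g + cmod \<mu> * (l2_norm (\<lambda>x. F k x - f x) * l2_norm ?g))
       \<longlonglongrightarrow> 0 * l2_norm ?g + cmod \<mu> * (0 * l2_norm ?g)"
      by (intro tendsto_intros FH)
    then have "cmod ?X \<le> 0 * l2_norm ?g + cmod \<mu> * (0 * l2_norm ?g)"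
      by (rule LIMSEQ_le_const) (use b in auto)
    then show ?thesis by simp
  qed
  then show ?thesis unfolding defect_subspace_def using Z(2) by auto
qed

end

context quasi_expression
begin

text \<open>The function paired with \<open>g\<close> lies in the range of the minimal operator
  minus \<open>cnj \<mu>\<close>. A preimage is found by variation of constants starting from zero
  data; the moment condition says exactly that its coefficient returns to zero at
  \<open>\<beta>\<close>, which makes the preimage compactly supported.\<close>

lemma defect_test_function:
  assumes F: "fundamental (cnj \<mu>) F" and G: "fundamental \<mu> G"
    and g: "g \<in> defect_subspace (minimal_operator P Q R) \<mu>"
    and ord: "0 < \<alpha>" "\<alpha> \<le> c" "c \<le> d" "d \<le> \<beta>"
    and moment: "integral {c..d} (\<lambda>t. conj_transpose (upper (G t)) *v v)
       = integral {\<alpha>..\<beta>} (\<lambda>t. conj_transpose (upper (G t)) *v (upper (G t) *v y))"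
  shows "(LINT x|halfline. cdot (indicator {c..d} x *\<^sub>R v - indicator {\<alpha>..\<beta>} x *\<^sub>R (upper (G x) *v y)) (g x)) = 0"
proof -
  define k where "k x = indicator {c..d} x *\<^sub>R v - indicator {\<alpha>..\<beta>} x *\<^sub>R (upper (G x) *v y)" for x
  have cU: "continuous_on {0..} (\<lambda>x. upper (G x))"
    by (intro bounded_linear.continuous_on[OF bounded_linear_upper] fundamental_continuous[OF G])
  let ?\<phi> = "\<lambda>t. conj_transpose (upper (G t)) *v v"
  let ?\<psi> = "\<lambda>t. conj_transpose (upper (G t)) *v (upper (G t) *v y)"
  have c\<phi>: "continuous_on {0..} ?\<phi>" and c\<psi>: "continuous_on {0..} ?\<psi>" and cy: "continuous_on {0..} (\<lambda>x. upper (G x) *v y)"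
    by (intro mv.continuous_on bounded_linear.continuous_on[OF bounded_linear_conj_transpose] cU continuous_on_const)+
  define m where "m x = indicator {c..d} x *\<^sub>R ?\<phi> x - indicator {\<alpha>..\<beta>} x *\<^sub>R ?\<psi> x" for x
  have mk: "m x = conj_transpose (upper (G x)) *v k x" for x
    by (simp add: m_def k_def mv.diff_right mv.scaleR_right)
  have pos: "0 \<le> c" "0 \<le> \<alpha>" using ord by auto
  have int1: "(\<lambda>x. indicator {c..d} x *\<^sub>R ?\<phi> x) integrable_on {0..b}"
    and int2: "(\<lambda>x. indicator {\<alpha>..\<beta>} x *\<^sub>R ?\<psi> x) integrable_on {0..b}" for b
    by (intro piece_facts(1)[OF c\<phi> pos(1)] piece_facts(1)[OF c\<psi> pos(2)])+
  have im: "m integrable_on {0..b}" for b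
    unfolding m_def by (intro Henstock_Kurzweil_Integration.integrable_diff int1 int2)
  have Im: "integral {0..b} m = integral {0..b} (\<lambda>x. indicator {c..d} x *\<^sub>R ?\<phi> x) - integral {0..b} (\<lambda>x. indicator {\<alpha>..\<beta>} x *\<^sub>R ?\<psi> x)" for b
    unfolding m_def by (intro Henstock_Kurzweil_Integration.integral_diff int1 int2)
  have I0: "integral {0..b} m = 0" if "b < \<alpha>" for b
    unfolding Im using piece_facts(3)[OF c\<phi> pos(1)] piece_facts(3)[OF c\<psi> pos(2)] that ord by simp
  \<comment> \<open>To the right of \<open>\<beta>\<close> both indicators have been integrated
    completely, and their moments cancel.\<close>
  have I1: "integral {0..b} m = 0" if "\<beta> \<le> b" for b
    unfolding Im using piece_facts(2)[OF c\<phi> pos(1), of d b] piece_facts(2)[OF c\<psi> pos(2), of \<beta> b] that ord moment by simp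
  have bm: "\<exists>B. \<forall>x\<in>{0..b}. norm (m x) \<le> B" if b: "0 \<le> b" for b
  proof -
    obtain B1 B2 where B: "\<forall>x\<in>{0..b}. norm (indicator {c..d} x *\<^sub>R ?\<phi> x) \<le> B1"
      "\<forall>x\<in>{0..b}. norm (indicator {\<alpha>..\<beta>} x *\<^sub>R ?\<psi> x) \<le> B2"
      using piece_facts(4)[OF c\<phi> pos(1) b] piece_facts(4)[OF c\<psi> pos(2) b] by blast
    have "norm (m x) \<le> B1 + B2" if x: "x \<in> {0..b}" for x
      unfolding m_def using B x by (intro order_trans[OF norm_triangle_ineq4] add_mono) auto
    then show ?thesis by blast
  qed
  have cm: "isCont m x" if "0 < x" "x \<notin> {c, d, \<alpha>, \<beta>}" for x
    unfolding m_def
    by (intro continuous_diff isCont_piece continuous_halfline_facts(3)[OF c\<phi>] continuous_halfline_facts(3)[OF c\<psi>])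
       (use that in auto)
  \<comment> \<open>The coefficient is the integral of \<open>fundamental_inverse (G x)\<close>
    applied to \<open>stack 0 (- k x)\<close>. Its derivative may fail to exist at the jumps of the
    integrand, a finite set.\<close>
  define C where "C x = - (symplectic *v integral {0..x} m)" for x
  have bl: "bounded_linear (\<lambda>z. - ((symplectic :: complex^('n + 'n)^('n + 'n)) *v z))"
    by (intro bounded_linear_minus mv.bounded_linear_right)
  have acC: "locally_abs_continuous C"
    unfolding C_def
    by (intro locally_abs_continuous_linear[OF _ bl] indefinite_integral_locally_abs_continuous im bm)
  have dC: "\<exists>C'. (C has_vector_derivative C') (at x) \<and> F x *v C' = stack 0 (- k x)"
    if "0 \<le> x" "x \<notin> {0, c, d, \<alpha>, \<beta>}" for x
  proof (intro exI conjI)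
    show "(C has_vector_derivative - (symplectic *v m x)) (at x)"
      unfolding C_def
      by (intro bounded_linear.has_vector_derivative[OF bl] indefinite_integral_has_vector_derivative im cm)
         (use that in auto)
    have G': "fundamental (cnj (cnj \<mu>)) G" using G by simp
    have "- (symplectic *v m x) = fundamental_inverse (G x) *v stack 0 (- k x)"
      by (simp add: fundamental_inverse_stack mk mv.minus_right)
    then have "F x *v (- (symplectic *v m x)) = (F x ** fundamental_inverse (G x)) *v stack 0 (- k x)"
      by (simp add: matrix_vector_mul_assoc)
    then show "F x *v (- (symplectic *v m x)) = stack 0 (- k x)"
      by (simp add: fundamental_inverse(2)[OF F G' that(1)])
  qed
  define f where "f x = upper (F x *v C x)" for x
  have pair: "image_pair f (\<lambda>x. lower (F x *v C x)) (\<lambda>x. cnj \<mu> *s f x + k x)"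
    unfolding f_def
  proof (rule fundamental_variation[OF F acC])
    show "negligible {0, c, d, \<alpha>, \<beta>}" by (rule negligible_finite) simp
  qed (rule dC)
  have cf: "continuous_on {0..} f" by (rule image_pair_continuous(1)[OF pair])
  have f0: "f x = 0" if "x \<notin> {\<alpha>..\<beta>}" for x
    using I0[of x] I1[of x] that unfolding f_def C_def by (cases "x < \<alpha>") (auto simp: mv.zero_right block_simps)
  have sqf: "square_integrable f"
  proof (rule square_integrable_cong)
    show "square_integrable (\<lambda>x. indicator {\<alpha>..\<beta>} x *\<^sub>R f x)"
      using pos by (intro square_integrable_piece continuous_halfline_facts(1)[OF cf])
  qed (use f0 in \<open>auto simp: indicator_def\<close>)
  have sqk: "square_integrable k"
    unfolding k_def using pos
    by (intro square_integrable_diff square_integrable_piece continuous_halfline_facts(1)[OF cy]) auto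
  have supp: "compact_support_in_pos f"
  proof -
    have "closure {x. 0 \<le> x \<and> f x \<noteq> 0} \<subseteq> {\<alpha>..\<beta>}"
    proof (rule closure_minimal)
      show "{x. 0 \<le> x \<and> f x \<noteq> 0} \<subseteq> {\<alpha>..\<beta>}" using f0 by blast
    qed simp
    then show ?thesis unfolding compact_support_in_pos_def
      using compact_Int_closed[OF compact_Icc[of \<alpha> \<beta>] closed_closure[of "{x. 0 \<le> x \<and> f x \<noteq> 0}"]] ord(1)
      by (auto simp: Int_absorb1)
  qed
  have fk: "(f, \<lambda>x. cnj \<mu> *s f x + k x) \<in> maximal_operator P Q R"
    unfolding maximal_operator_def l_value_iff
    using pair sqf square_integrable_add[OF square_integrable_scale[OF sqf] sqk] by auto
  let ?h = "\<lambda>x. cnj \<mu> *s f x + k x"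
  have sqh: "square_integrable ?h"
    by (intro square_integrable_add square_integrable_scale sqf sqk)
  \<comment> \<open>The constant sequence places the pair in the closure.\<close>
  have "\<exists>F H. (\<forall>k::nat. (F k, H k) \<in> {(f, h) \<in> maximal_operator P Q R. compact_support_in_pos f}) \<and>
      (\<lambda>k. l2_norm (\<lambda>x. F k x - f x)) \<longlonglongrightarrow> 0 \<and> (\<lambda>k. l2_norm (\<lambda>x. H k x - ?h x)) \<longlonglongrightarrow> 0"
    by (rule exI[of _ "\<lambda>_. f"], rule exI[of _ "\<lambda>_. ?h"]) (use fk supp in \<open>simp add: l2_norm_norm\<close>)
  then have mem: "(f, ?h) \<in> minimal_operator P Q R"
    unfolding minimal_operator_def graph_closure_def using sqf sqh by blast
  have "\<forall>(f, h) \<in> minimal_operator P Q R. l2_inner (\<lambda>x. h x - cnj \<mu> *s f x) g = 0"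
    using g by (simp add: defect_subspace_def)
  from bspec[OF this mem] have "l2_inner (\<lambda>x. ?h x - cnj \<mu> *s f x) g = 0" by simp
  then show ?thesis by (simp add: l2_inner_cdot k_def)
qed

text \<open>Subtract from \<open>g\<close> its projection to the solutions on the interval. Every
  step function becomes an admissible test function after correction by a solution, so the
  difference is orthogonal to all step functions and hence zero.\<close>

lemma defect_subspace_local:
  assumes F: "fundamental (cnj \<mu>) F" and G: "fundamental \<mu> G"
    and g: "g \<in> defect_subspace (minimal_operator P Q R) \<mu>" and ab: "0 < \<alpha>" "\<alpha> < \<beta>"
  shows "\<exists>\<gamma>. AE x in halfline. x \<in> {\<alpha>..\<beta>} \<longrightarrow> g x = upper (G x *v \<gamma>)"
proof -
  have sg: "square_integrable g" using g by (simp add: defect_subspace_def)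
  have a0: "0 \<le> \<alpha>" using ab by simp
  have cU: "continuous_on {0..} (\<lambda>x. upper (G x))"
    by (intro bounded_linear.continuous_on[OF bounded_linear_upper] fundamental_continuous[OF G])
  have cUT: "continuous_on {0..} (\<lambda>x. conj_transpose (upper (G x)))"
    by (intro bounded_linear.continuous_on[OF bounded_linear_conj_transpose] cU)
  have cy: "continuous_on {0..} (\<lambda>x. upper (G x) *v y)" for y
    by (intro mv.continuous_on cU continuous_on_const)
  \<comment> \<open>The Gram matrix of the columns of the upper block on the interval; it is
    invertible because no nonzero solution vanishes there.\<close>
  define \<Gamma> where "\<Gamma> = integral {\<alpha>..\<beta>} (\<lambda>t. conj_transpose (upper (G t)) ** upper (G t))"
  have cG: "continuous_on {0..} (\<lambda>t. conj_transpose (upper (G t)) ** upper (G t))"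
    by (intro mm.continuous_on cU cUT)
  have \<Gamma>v: "\<Gamma> *v y = integral {\<alpha>..\<beta>} (\<lambda>t. conj_transpose (upper (G t)) *v (upper (G t) *v y))" for y
    unfolding \<Gamma>_def
    using integral_linear[OF continuous_halfline_facts(2)[OF cG a0] mv.bounded_linear_left, of \<beta> y]
    by (simp add: comp_def matrix_vector_mul_assoc)
  have "y = 0" if y: "\<Gamma> *v y = 0" for y
  proof (rule fundamental_nondegenerate[OF F G a0 ab(2)])
    have c2: "continuous_on {0..} (\<lambda>t. conj_transpose (upper (G t)) *v (upper (G t) *v y))"
      by (intro mv.continuous_on cUT cy)
    have "cdot (\<Gamma> *v y) y = integral {\<alpha>..\<beta>} (\<lambda>t. cdot (conj_transpose (upper (G t)) *v (upper (G t) *v y)) y)"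
      unfolding \<Gamma>v
      using integral_linear[OF continuous_halfline_facts(2)[OF c2 a0] cdot.bounded_linear_left, of \<beta> y]
      by (simp add: comp_def)
    also have "\<dots> = integral {\<alpha>..\<beta>} (\<lambda>t. of_real ((norm (upper (G t) *v y))\<^sup>2))"
      by (simp only: cdot_matrix_left conj_transpose_involutive cdot_self)
    also have "\<dots> = of_real (integral {\<alpha>..\<beta>} (\<lambda>t. (norm (upper (G t) *v y))\<^sup>2))"
    proof -
      have "continuous_on {0..} (\<lambda>t. (norm (upper (G t) *v y))\<^sup>2)" by (intro continuous_intros cy)
      from integral_linear[OF continuous_halfline_facts(2)[OF this a0] bounded_linear_of_real, of \<beta>]
      show ?thesis by (simp add: comp_def)
    qed
    finally have "integral {\<alpha>..\<beta>} (\<lambda>t. (norm (upper (G t) *v y))\<^sup>2) = 0"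
      using y by (simp add: cdot_simps)
    then have "\<forall>t\<in>{\<alpha>..\<beta>}. (norm (upper (G t) *v y))\<^sup>2 = 0"
      using integral_eq_0_iff[of \<alpha> \<beta> "\<lambda>t. (norm (upper (G t) *v y))\<^sup>2"] ab
      by (simp add: continuous_intros continuous_halfline_facts(1)[OF cy a0])
    then show "upper (G t *v y) = 0" if "\<alpha> < t" "t < \<beta>" for t
      using that by (simp add: block_mult)
  qed
  then obtain B where B: "B ** \<Gamma> = mat 1" using matrix_left_invertible_ker[of \<Gamma>] by blast
  then have B': "\<Gamma> ** B = mat 1" by (simp add: matrix_left_right_inverse)
  have sqy: "square_integrable (\<lambda>x. indicator {\<alpha>..\<beta>} x *\<^sub>R (upper (G x) *v y))" for y
    by (intro square_integrable_piece continuous_halfline_facts(1)[OF cy] a0)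
  have sqv: "square_integrable (\<lambda>x. indicator {c..d} x *\<^sub>R (v :: complex^'n))" if "0 \<le> c" for c d v
    using that by (intro square_integrable_piece) auto
  define l where "l y = (LINT x|halfline. cdot (indicator {\<alpha>..\<beta>} x *\<^sub>R (upper (G x) *v y)) (g x))" for y
  have ladd: "l (x + y) = l x + l y" for x y
    unfolding l_def mv.add_right scaleR_add_right cdot_simps
    by (intro Bochner_Integration.integral_add integrable_cdot sqy sg)
  have lscale: "l (e *s y) = e * l y" for e y
  proof -
    have "cdot (indicator {\<alpha>..\<beta>} x *\<^sub>R (upper (G x) *v (e *s y))) (g x) = e * cdot (indicator {\<alpha>..\<beta>} x *\<^sub>R (upper (G x) *v y)) (g x)" for x
      by (simp add: mv_scale cdot.scaleR_left cdot_simps)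
    then show ?thesis unfolding l_def by simp
  qed
  obtain b where b: "\<And>y. l y = cdot y b" using finite_riesz[of l, OF ladd lscale] by blast
  \<comment> \<open>The normal equation: \<open>\<gamma>\<close> makes the solution have the same
    products as \<open>g\<close> with all solutions on the interval.\<close>
  define \<gamma> where "\<gamma> = conj_transpose B *v b"
  have \<gamma>: "conj_transpose \<Gamma> *v \<gamma> = b"
  proof -
    have "conj_transpose \<Gamma> ** conj_transpose B = mat 1"
      unfolding conj_transpose_mult[symmetric] B by (simp add: conj_transpose_def mat_def vec_eq_iff)
    then show ?thesis by (simp add: \<gamma>_def matrix_vector_mul_assoc)
  qed
  define w' where "w' x = g x - indicator {\<alpha>..\<beta>} x *\<^sub>R (upper (G x) *v \<gamma>)" for x
  have sw: "square_integrable w'" unfolding w'_def by (intro square_integrable_diff sg sqy)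
  have "AE x in halfline. x \<in> {\<alpha>..\<beta>} \<longrightarrow> w' x = 0"
  proof (rule AE_zero_if_interval_integrals_zero[OF sw a0 ab(2)])
    fix c d and v :: "complex^'n" assume cd: "\<alpha> \<le> c" "c \<le> d" "d \<le> \<beta>"
    have c0: "0 \<le> c" using cd ab by simp
    define p where "p = integral {c..d} (\<lambda>t. conj_transpose (upper (G t)) *v v)"
    have cp: "continuous_on {0..} (\<lambda>t. conj_transpose (upper (G t)) *v v)"
      by (intro mv.continuous_on cUT continuous_on_const)
    \<comment> \<open>The correcting solution \<open>B *v p\<close> is chosen to satisfy the moment
      condition of \<open>defect_test_function\<close>.\<close>
    have "\<Gamma> *v (B *v p) = p" by (simp add: matrix_vector_mul_assoc B')
    then have "(LINT x|halfline. cdot (indicator {c..d} x *\<^sub>R v - indicator {\<alpha>..\<beta>} x *\<^sub>R (upper (G x) *v (B *v p))) (g x)) = 0"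
      using defect_test_function[OF F G g ab(1) cd, of v "B *v p"] by (simp add: p_def \<Gamma>v)
    then have "(LINT x|halfline. cdot (indicator {c..d} x *\<^sub>R v) (g x)) = l (B *v p)"
      unfolding cdot_simps l_def
      by (simp add: Bochner_Integration.integral_diff integrable_cdot sqv sqy sg c0)
    also have "\<dots> = cdot (B *v p) (conj_transpose \<Gamma> *v \<gamma>)" by (simp add: b \<gamma>)
    also have "\<dots> = cdot p \<gamma>" by (simp add: cdot_matrix_left[symmetric] matrix_vector_mul_assoc B')
    also have "\<dots> = integral {c..d} (\<lambda>t. cdot (conj_transpose (upper (G t)) *v v) \<gamma>)"
      unfolding p_def using integral_linear[OF continuous_halfline_facts(2)[OF cp c0] cdot.bounded_linear_left, of d \<gamma>]
      by (simp add: comp_def)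
    also have "\<dots> = integral {c..d} (\<lambda>t. cdot v (upper (G t) *v \<gamma>))"
      by (simp only: cdot_matrix_left conj_transpose_involutive)
    also have "\<dots> = (LINT x|halfline. indicator {c..d} x *\<^sub>R cdot v (upper (G x) *v \<gamma>))"
      by (intro integrable_halfline_piece(2)[symmetric] c0 cdot.continuous_on continuous_on_const continuous_halfline_facts(1)[OF cy])
    also have "\<dots> = (LINT x|halfline. cdot (indicator {c..d} x *\<^sub>R v) (indicator {\<alpha>..\<beta>} x *\<^sub>R (upper (G x) *v \<gamma>)))"
      by (rule Bochner_Integration.integral_cong)
         (use cd in \<open>auto simp: indicator_def cdot_simps cdot.scaleR_left cdot.scaleR_right\<close>)
    finally show "(LINT x|halfline. cdot (indicator {c..d} x *\<^sub>R v) (w' x)) = 0"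
      unfolding w'_def cdot_simps
      by (simp add: Bochner_Integration.integral_diff integrable_cdot sqv sqy sg c0)
  qed
  then have "AE x in halfline. x \<in> {\<alpha>..\<beta>} \<longrightarrow> g x = upper (G x *v \<gamma>)"
    by eventually_elim (auto simp: w'_def block_mult)
  then show ?thesis by blast
qed

lemma AE_solution_zero:
  assumes F: "fundamental (cnj \<mu>) F" and G: "fundamental \<mu> G" and "0 \<le> a" "a < b"
    and z: "AE x in halfline. x \<in> {a..b} \<longrightarrow> upper (G x *v y) = 0"
  shows "y = 0"
proof (rule fundamental_nondegenerate[OF F G assms(3,4)])
  fix t assume t: "a < t" "t < b"
  obtain S where S: "negligible S" "\<And>x. 0 \<le> x \<Longrightarrow> x \<notin> S \<Longrightarrow> x \<in> {a..b} \<longrightarrow> upper (G x *v y) = 0"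
    using z unfolding AE_halfline_iff by blast
  have "continuous_on {0..} (\<lambda>x. upper (G x *v y))"
    by (intro bounded_linear.continuous_on[OF bounded_linear_upper] mv.continuous_on fundamental_continuous[OF G] continuous_on_const)
  then have "continuous_on {a..b} (\<lambda>x. upper (G x *v y))"
    by (rule continuous_on_subset) (use assms(3) in auto)
  then show "upper (G t *v y) = 0"
    by (rule continuous_eq_from_negligible[OF S(1) assms(4) _ continuous_on_const]) (use S(2) t assms(3) in auto)
qed

text \<open>The local solutions on an exhausting sequence of intervals agree on a common
  subinterval, and a solution is determined by its values there.\<close>

lemma defect_subspace_solution:
  assumes F: "fundamental (cnj \<mu>) F" and G: "fundamental \<mu> G"
    and g: "g \<in> defect_subspace (minimal_operator P Q R) \<mu>"
  shows "\<exists>\<gamma>. AE x in halfline. g x = upper (G x *v \<gamma>)"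
proof -
  \<comment> \<open>The shift by 2 makes already the first interval \<open>{1/2..2}\<close>, which
    all others contain.\<close>
  define I where "I k = {1 / (real k + 2) .. real k + 2}" for k :: nat
  have "\<forall>k. \<exists>\<gamma>. AE x in halfline. x \<in> I k \<longrightarrow> g x = upper (G x *v \<gamma>)"
    unfolding I_def
  proof (intro allI defect_subspace_local[OF F G g])
    fix k :: nat
    have "1 / (real k + 2) \<le> 1" by simp
    then show "1 / (real k + 2) < real k + 2" by linarith
  qed simp
  from choice[OF this] obtain \<gamma> where \<gamma>: "\<And>k. AE x in halfline. x \<in> I k \<longrightarrow> g x = upper (G x *v \<gamma> k)"
    by blast
  have sub: "{1/2..2} \<subseteq> I k" for k by (auto simp: I_def field_simps)
  have eq: "\<gamma> k = \<gamma> 0" for k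
  proof -
    have "AE x in halfline. x \<in> {1/2..2} \<longrightarrow> upper (G x *v (\<gamma> k - \<gamma> 0)) = 0"
      using \<gamma>[of k] \<gamma>[of 0]
      by eventually_elim (use sub[of k] sub[of 0] in \<open>auto simp: mv.diff_right block_simps\<close>)
    then have "\<gamma> k - \<gamma> 0 = 0" by (rule AE_solution_zero[OF F G, rotated 2]) auto
    then show ?thesis by simp
  qed
  have "AE x in halfline. x \<in> I k \<longrightarrow> g x = upper (G x *v \<gamma> 0)" for k
    using \<gamma>[of k] unfolding eq[of k] .
  then have "AE x in halfline. \<forall>k. x \<in> I k \<longrightarrow> g x = upper (G x *v \<gamma> 0)"
    unfolding AE_all_countable by (rule allI)
  moreover have "AE x in halfline. x \<noteq> (0 :: real)"
    unfolding AE_halfline_iff by (intro exI[of _ "{0}"]) auto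
  moreover have "AE x in halfline. 0 \<le> (x :: real)"
    by (rule AE_I2) simp
  ultimately have "AE x in halfline. g x = upper (G x *v \<gamma> 0)"
  proof eventually_elim
    case (elim x)
    obtain k :: nat where k: "max x (1 / x) < real k" using reals_Archimedean2 by blast
    have "1 / (real k + 2) \<le> x"
      using k elim by (simp add: field_simps)
    then have "x \<in> I k" using k by (auto simp: I_def)
    then show ?case using elim by blast
  qed
  then show ?thesis by blast
qed

end

section \<open>Defect numbers\<close>

lemma norm_matrix_columns: "(norm (A :: complex^'m^'n))\<^sup>2 = (\<Sum>k\<in>UNIV. (norm (column k A))\<^sup>2)"
proof -
  have "(norm A)\<^sup>2 = (\<Sum>i\<in>UNIV. (norm (A $ i))\<^sup>2)"
    by (simp add: norm_vec_def[of A] L2_set_def sum_nonneg)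
  also have "\<dots> = (\<Sum>i\<in>UNIV. \<Sum>k\<in>UNIV. (cmod (A $ i $ k))\<^sup>2)"
    by (simp only: norm_vec_squared)
  also have "\<dots> = (\<Sum>k\<in>UNIV. \<Sum>i\<in>UNIV. (cmod (A $ i $ k))\<^sup>2)" by (rule sum.swap)
  also have "\<dots> = (\<Sum>k\<in>UNIV. (norm (column k A))\<^sup>2)"
    by (simp only: norm_vec_squared column_def vec_lambda_beta)
  finally show ?thesis .
qed

lemma bounded_energy_columns:
  fixes T :: "real \<Rightarrow> complex^'m^'n"
  assumes T: "continuous_on {0..} T"
  shows "bounded_energy T \<longleftrightarrow> (\<forall>y. bounded_energy (\<lambda>x. T x *v y))"
proof
  assume e: "bounded_energy T"
  show "\<forall>y. bounded_energy (\<lambda>x. T x *v y)"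
  proof
    fix y
    obtain k where k: "\<And>A :: complex^'m^'n. norm (A *v y) \<le> norm A * k"
      using bounded_linear.bounded[OF mv.bounded_linear_left] by blast
    show "bounded_energy (\<lambda>x. T x *v y)"
      by (rule bounded_energy_mono[OF e _ T, where c = k])
         (use k in \<open>auto intro!: mv.continuous_on T simp: mult.commute\<close>)
  qed
next
  assume e: "\<forall>y. bounded_energy (\<lambda>x. T x *v y)"
  have "\<exists>B. \<forall>b\<ge>0. integral {0..b} (\<lambda>x. (norm (T x *v axis k 1))\<^sup>2) \<le> B" for k
    using e unfolding bounded_energy_def by blast
  then have "\<forall>k. \<exists>B. \<forall>b\<ge>0. integral {0..b} (\<lambda>x. (norm (T x *v axis k 1))\<^sup>2) \<le> B" by blast
  from choice[OF this] obtain B where B: "\<And>k b. 0 \<le> b \<Longrightarrow> integral {0..b} (\<lambda>x. (norm (T x *v axis k 1))\<^sup>2) \<le> B k"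
    by blast
  have "integral {0..b} (\<lambda>x. (norm (T x))\<^sup>2) \<le> (\<Sum>k\<in>UNIV. B k)" if "0 \<le> b" for b
  proof -
    have c: "continuous_on {0..} (\<lambda>x. (norm (T x *v axis k 1))\<^sup>2)" for k
      by (intro continuous_intros mv.continuous_on T)
    have "(norm (T x))\<^sup>2 = (\<Sum>k\<in>UNIV. (norm (T x *v axis k 1))\<^sup>2)" for x
      unfolding column_mult_axis by (rule norm_matrix_columns)
    then have "integral {0..b} (\<lambda>x. (norm (T x))\<^sup>2) = integral {0..b} (\<lambda>x. \<Sum>k\<in>UNIV. (norm (T x *v axis k 1))\<^sup>2)"
      by simp
    also have "\<dots> = (\<Sum>k\<in>UNIV. integral {0..b} (\<lambda>x. (norm (T x *v axis k 1))\<^sup>2))"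
      by (rule Henstock_Kurzweil_Integration.integral_sum) (auto intro: continuous_halfline_facts(2)[OF c])
    also have "\<dots> \<le> (\<Sum>k\<in>UNIV. B k)" using B[OF that] by (intro sum_mono) auto
    finally show ?thesis .
  qed
  then show "bounded_energy T" unfolding bounded_energy_def by blast
qed

text \<open>A finite supremum of natural numbers is a maximum; \<open>p 0\<close> excludes the empty
  set, whose supremum is 0 without being attained.\<close>

lemma Sup_enat_attained:
  assumes "Sup {enat m |m. p m} = enat k" "p 0"
  shows "p k"
proof -
  define A where "A = {enat m |m. p m}"
  have "A \<noteq> {}" using assms(2) by (auto simp: A_def)
  moreover have "finite A" using assms(1) \<open>A \<noteq> {}\<close> unfolding A_def[symmetric] Sup_enat_def by (auto split: if_splits)
  ultimately have "Sup A \<in> A" unfolding Sup_enat_def by simp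
  then show ?thesis using assms(1) unfolding A_def by auto
qed

lemma independent_family_bound:
  fixes \<gamma> :: "nat \<Rightarrow> complex^'m"
  assumes ind: "\<And>c. (\<Sum>i<k. c i *s \<gamma> i) = 0 \<Longrightarrow> \<forall>i<k. c i = 0"
  shows "k \<le> CARD('m)" and "k = CARD('m) \<Longrightarrow> vec.span (\<gamma> ` {..<k}) = UNIV"
proof -
  have inj: "inj_on \<gamma> {..<k}"
  proof (rule inj_onI, rule ccontr)
    fix i j assume ij: "i \<in> {..<k}" "j \<in> {..<k}" "\<gamma> i = \<gamma> j" "i \<noteq> j"
    \<comment> \<open>If two members coincided, the difference of their coefficients would be a
      nontrivial relation. Injectivity lets the family be treated as a set.\<close>
    define c where "c l = (if l = i then 1 else 0 :: complex) - (if l = j then 1 else 0)" for l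
    have "(\<Sum>l<k. c l *s \<gamma> l) = (\<Sum>l<k. (if l = i then 1 else 0 :: complex) *s \<gamma> l) - (\<Sum>l<k. (if l = j then 1 else 0 :: complex) *s \<gamma> l)"
      by (simp add: c_def vector_sub_rdistrib sum_subtractf)
    also have "\<dots> = \<gamma> i - \<gamma> j"
    proof -
      have "(\<Sum>l<k. (if l = a then 1 else 0 :: complex) *s \<gamma> l) = \<gamma> a" if "a < k" for a
      proof -
        have "(\<Sum>l<k. (if l = a then 1 else 0 :: complex) *s \<gamma> l) = (\<Sum>l<k. if l = a then \<gamma> l else 0)"
          by (rule sum.cong) auto
        then show ?thesis using that by simp
      qed
      then show ?thesis using ij by simp
    qed
    finally have "(\<Sum>l<k. c l *s \<gamma> l) = 0" using ij(3) by simp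
    then have "c i = 0" using ind ij(1) by blast
    then show False using ij(4) by (simp add: c_def)
  qed
  have li: "vec.independent (\<gamma> ` {..<k})"
  proof (rule vec.independent_if_scalars_zero)
    fix f v assume s: "(\<Sum>x\<in>\<gamma> ` {..<k}. f x *s x) = 0" and v: "v \<in> \<gamma> ` {..<k}"
    have "(\<Sum>i<k. f (\<gamma> i) *s \<gamma> i) = 0" using s inj by (simp add: sum.reindex)
    from ind[OF this] show "f v = 0" using v by auto
  qed simp
  have card: "card (\<gamma> ` {..<k}) = k" using inj by (simp add: card_image)
  have "card (\<gamma> ` {..<k}) \<le> vec.dim (UNIV :: (complex^'m) set)"
    by (rule vec.independent_card_le_dim[OF subset_UNIV li])
  then show "k \<le> CARD('m)" by (simp only: card vec_dim_card)
  show "vec.span (\<gamma> ` {..<k}) = UNIV" if "k = CARD('m)"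
  proof -
    have "vec.dim (UNIV :: (complex^'m) set) \<le> card (\<gamma> ` {..<k})"
      unfolding card vec_dim_card using that by simp
    from vec.card_ge_dim_independent[OF subset_UNIV li this] show ?thesis by blast
  qed
qed

context quasi_expression
begin

text \<open>Elements of the defect subspace correspond to vectors of initial values, and
  independence almost everywhere implies independence of these vectors. Hence the dimension is at
  most 2n, and it is 2n precisely if every initial vector gives a square-integrable
  solution.\<close>

lemma defect_dimension:
  assumes F: "fundamental (cnj \<mu>) F" and G: "fundamental \<mu> G"
  shows "dim_ae (defect_subspace (minimal_operator P Q R) \<mu>) = enat (2 * CARD('n)) \<longleftrightarrow> bounded_energy (\<lambda>x. upper (G x))"
proof -
  let ?V = "defect_subspace (minimal_operator P Q R) \<mu>"
  let ?A = "{enat m |m. \<exists>F. (\<forall>i<m. F i \<in> ?V) \<and> independent_ae m F}"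
  have card2: "CARD('n + 'n) = 2 * CARD('n)" by simp
  have cU: "continuous_on {0..} (\<lambda>x. upper (G x))"
    by (intro bounded_linear.continuous_on[OF bounded_linear_upper] fundamental_continuous[OF G])
  have cy: "continuous_on {0..} (\<lambda>x. upper (G x *v y))" for y
    unfolding block_mult by (intro mv.continuous_on cU continuous_on_const)
  have be: "bounded_energy (\<lambda>x. upper (G x)) \<longleftrightarrow> (\<forall>y. square_integrable (\<lambda>x. upper (G x *v y)))"
    using bounded_energy_columns[OF cU] square_integrable_continuous_iff[OF cy] by (simp add: block_mult)
  have lin: "(\<Sum>i<m. c i *s upper (G x *v \<gamma> i)) = upper (G x *v (\<Sum>i<m. c i *s \<gamma> i))" for m :: nat and c \<gamma> x
  proof (induction m)
    case 0 then show ?case by (simp add: mv.zero_right block_simps)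
  next
    case (Suc m) then show ?case by (simp add: mv.add_right block_simps mv_scale block_scale)
  qed
  have rep: "\<exists>\<gamma>. (\<forall>i<m. AE x in halfline. F i x = upper (G x *v \<gamma> i)) \<and>
      (\<forall>c. (\<Sum>i<m. c i *s \<gamma> i) = 0 \<longrightarrow> (\<forall>i<m. c i = 0))"
    if FV: "\<forall>i<m. F i \<in> ?V" and ind: "independent_ae m F" for m :: nat and F
  proof -
    have "\<forall>i. \<exists>\<gamma>. i < m \<longrightarrow> (AE x in halfline. F i x = upper (G x *v \<gamma>))"
      using defect_subspace_solution[OF assms] FV by blast
    from choice[OF this] obtain \<gamma> where \<gamma>: "\<And>i. i < m \<Longrightarrow> AE x in halfline. F i x = upper (G x *v \<gamma> i)"
      by blast
    have "\<forall>i<m. c i = 0" if z: "(\<Sum>i<m. c i *s \<gamma> i) = 0" for c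
    proof -
      have "AE x in halfline. \<forall>i\<in>{..<m}. F i x = upper (G x *v \<gamma> i)"
        using \<gamma> by (intro AE_finite_allI) auto
      then have "AE x in halfline. (\<Sum>i<m. c i *s F i x) = 0"
      proof eventually_elim
        case (elim x)
        then have "(\<Sum>i<m. c i *s F i x) = (\<Sum>i<m. c i *s upper (G x *v \<gamma> i))" by simp
        then show ?case unfolding lin z by (simp add: mv.zero_right block_simps)
      qed
      then show ?thesis using ind unfolding independent_ae_def by blast
    qed
    then show ?thesis using \<gamma> by blast
  qed
  have le: "m \<le> 2 * CARD('n)" if FV: "\<forall>i<m. F i \<in> ?V" and ind: "independent_ae m F" for m :: nat and F
  proof -
    obtain \<gamma> :: "nat \<Rightarrow> complex^('n + 'n)" where li: "\<forall>c. (\<Sum>i<m. c i *s \<gamma> i) = 0 \<longrightarrow> (\<forall>i<m. c i = 0)"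
      using rep[OF FV ind] by blast
    have "m \<le> CARD('n + 'n)" by (rule independent_family_bound(1)[of \<gamma> m]) (use li in blast)
    then show ?thesis using card2 by simp
  qed
  show ?thesis
  proof
    assume "dim_ae ?V = enat (2 * CARD('n))"
    then have "\<exists>F. (\<forall>i<2 * CARD('n). F i \<in> ?V) \<and> independent_ae (2 * CARD('n)) F"
      unfolding dim_ae_def by (rule Sup_enat_attained) (simp add: independent_ae_def)
    then obtain F where FV: "\<forall>i<2 * CARD('n). F i \<in> ?V" and ind: "independent_ae (2 * CARD('n)) F" by blast
    obtain \<gamma> where \<gamma>: "\<forall>i<2 * CARD('n). AE x in halfline. F i x = upper (G x *v \<gamma> i)"
      and li: "\<forall>c. (\<Sum>i<2 * CARD('n). c i *s \<gamma> i) = 0 \<longrightarrow> (\<forall>i<2 * CARD('n). c i = 0)"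
      using rep[OF FV ind] by blast
    have span: "vec.span (\<gamma> ` {..<2 * CARD('n)}) = UNIV"
      by (rule independent_family_bound(2)[of \<gamma> "2 * CARD('n)"]) (use li card2 in auto)
    \<comment> \<open>The initial vectors of square-integrable solutions form a complex subspace. It
      contains a spanning family and is therefore the whole space.\<close>
    define W where "W = {y. square_integrable (\<lambda>x. upper (G x *v y))}"
    have "\<gamma> ` {..<2 * CARD('n)} \<subseteq> W"
    proof
      fix y assume "y \<in> \<gamma> ` {..<2 * CARD('n)}"
      then obtain i where i: "i < 2 * CARD('n)" "y = \<gamma> i" by auto
      have sF: "square_integrable (F i)" using FV i(1) by (simp add: defect_subspace_def)
      have m: "(\<lambda>x. upper (G x *v y)) \<in> borel_measurable halfline" by (rule continuous_measurable_halfline[OF cy])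
      have "integrable halfline (\<lambda>x. (norm (upper (G x *v y)))\<^sup>2)"
      proof (rule integrable_cong_AE_imp)
        show "integrable halfline (\<lambda>x. (norm (F i x))\<^sup>2)" using sF by (simp add: square_integrable_iff)
        show "(\<lambda>x. (norm (upper (G x *v y)))\<^sup>2) \<in> borel_measurable halfline"
          using m by measurable
        have "AE x in halfline. F i x = upper (G x *v y)" using \<gamma> i by blast
        then show "AE x in halfline. (norm (F i x))\<^sup>2 = (norm (upper (G x *v y)))\<^sup>2"
          by eventually_elim simp
      qed
      then show "y \<in> W" using m by (simp add: W_def square_integrable_iff)
    qed
    moreover have "vec.subspace W"
    proof (rule vec.subspaceI)
      show "0 \<in> W" by (simp add: W_def mv.zero_right block_simps square_integrable_iff)
      show "x + y \<in> W" if "x \<in> W" "y \<in> W" for x y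
        using that square_integrable_add unfolding W_def by (simp add: mv.add_right block_simps)
      show "c *s x \<in> W" if "x \<in> W" for c x
        using that square_integrable_scale unfolding W_def by (simp add: mv_scale block_scale)
    qed
    ultimately have "vec.span (\<gamma> ` {..<2 * CARD('n)}) \<subseteq> W" by (rule vec.span_minimal)
    then show "bounded_energy (\<lambda>x. upper (G x))" unfolding be using span by (auto simp: W_def)
  next
    assume "bounded_energy (\<lambda>x. upper (G x))"
    then have sq: "square_integrable (\<lambda>x. upper (G x *v y))" for y unfolding be by blast
    obtain h where "bij_betw h {0..<CARD('n + 'n)} (UNIV :: ('n + 'n) set)"
      using ex_bij_betw_nat_finite[OF finite_class.finite_UNIV] by blast
    then have h: "bij_betw h {..<2 * CARD('n)} (UNIV :: ('n + 'n) set)"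
      unfolding card2 atLeast0LessThan .
    define E where "E i = (\<lambda>x. upper (G x *v axis (h i) 1))" for i
    have EV: "\<forall>i<2 * CARD('n). E i \<in> ?V"
      unfolding E_def using solution_in_defect_subspace[OF fundamental_solves[OF G] sq] by blast
    have Eind: "independent_ae (2 * CARD('n)) E"
      unfolding independent_ae_def
    proof (intro allI impI)
      fix c i assume z: "AE x in halfline. (\<Sum>i<2 * CARD('n). c i *s E i x) = 0" and i: "i < 2 * CARD('n)"
      let ?s = "\<Sum>i<2 * CARD('n). c i *s axis (h i) 1 :: complex^('n + 'n)"
      have "AE x in halfline. x \<in> {0..1} \<longrightarrow> upper (G x *v ?s) = 0"
        using z by eventually_elim (simp add: E_def lin)
      then have s0: "?s = 0" by (rule AE_solution_zero[OF F G, rotated 2]) auto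
      have "?s $ h i = (\<Sum>j<2 * CARD('n). if j = i then c j else 0)"
        unfolding sum_component
      proof (rule sum.cong)
        fix j assume "j \<in> {..<2 * CARD('n)}"
        then have "h i = h j \<longleftrightarrow> j = i" using h i unfolding bij_betw_def inj_on_def by auto
        then show "(c j *s axis (h j) 1) $ h i = (if j = i then c j else 0)" by (simp add: axis_def)
      qed simp
      also have "\<dots> = c i" using i by simp
      finally show "c i = 0" using s0 by simp
    qed
    have "enat (2 * CARD('n)) \<in> ?A" using EV Eind by blast
    then have "enat (2 * CARD('n)) \<le> dim_ae ?V" unfolding dim_ae_def by (rule Sup_upper)
    moreover have "dim_ae ?V \<le> enat (2 * CARD('n))"
      unfolding dim_ae_def by (rule Sup_least) (use le in auto)
    ultimately show "dim_ae ?V = enat (2 * CARD('n))" by (rule order.antisym[rotated])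
  qed
qed

text \<open>Fundamental matrices for the same parameter coincide on the half-line, so it does not
  matter which one \<open>fundamental_transfer\<close> produces.\<close>

lemma bounded_energy_independent:
  assumes "fundamental \<mu> F" "fundamental \<mu> F'" "fundamental (cnj \<mu>) G" "bounded_energy (\<lambda>x. upper (F x))"
  shows "bounded_energy (\<lambda>x. upper (F' x))"
proof -
  have "F' x = F x" if "0 \<le> x" for x
  proof (rule matrix_eqI)
    fix c
    have "F' 0 = mat 1" using assms(2) by (simp add: fundamental_def)
    then show "F' x *v c = F x *v c"
      using fundamental_unique[OF assms(1,3) fundamental_solves[OF assms(2), of c] that] by simp
  qed
  then have "integral {0..b} (\<lambda>x. (norm (upper (F' x)))\<^sup>2) = integral {0..b} (\<lambda>x. (norm (upper (F x)))\<^sup>2)" for b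
    by (intro Henstock_Kurzweil_Integration.integral_cong) auto
  then show ?thesis using assms(4) unfolding bounded_energy_def by simp
qed

text \<open>From 0 to each of the parameters \<open>\<i>\<close> and \<open>- \<i>\<close> the
  matrix \<open>F\<close> is its own partner. On the way back \<open>A\<close> and \<open>B\<close>
  are partners of each other, so the energies of both have to be finite.\<close>

lemma maximal_defect_iff_bounded_energy:
  assumes F: "fundamental 0 F"
  shows "defect_number_plus (minimal_operator P Q R) = enat (2 * CARD('n)) \<and>
     defect_number_minus (minimal_operator P Q R) = enat (2 * CARD('n)) \<longleftrightarrow> bounded_energy (\<lambda>x. upper (F x))"
proof -
  have F': "fundamental (cnj 0) F" using F by simp
  obtain A where A: "fundamental \<i> A" "bounded_energy (\<lambda>x. upper (F x)) \<Longrightarrow> bounded_energy (\<lambda>x. upper (A x))"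
    using fundamental_transfer[OF F F', of \<i>] by blast
  obtain B where B: "fundamental (- \<i>) B" "bounded_energy (\<lambda>x. upper (F x)) \<Longrightarrow> bounded_energy (\<lambda>x. upper (B x))"
    using fundamental_transfer[OF F F', of "- \<i>"] by blast
  have AB: "fundamental (cnj \<i>) B" "fundamental (cnj (- \<i>)) A" using A B by simp_all
  obtain C where C: "fundamental 0 C" "bounded_energy (\<lambda>x. upper (A x)) \<Longrightarrow> bounded_energy (\<lambda>x. upper (B x)) \<Longrightarrow> bounded_energy (\<lambda>x. upper (C x))"
    using fundamental_transfer[OF A(1) AB(1), of 0] by blast
  have "bounded_energy (\<lambda>x. upper (A x)) \<and> bounded_energy (\<lambda>x. upper (B x)) \<longleftrightarrow> bounded_energy (\<lambda>x. upper (F x))"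
    using A(2) B(2) bounded_energy_independent[OF C(1) F F'] C(2) by blast
  then show ?thesis
    unfolding defect_number_plus_def defect_number_minus_def
    using defect_dimension[OF AB(1) A(1)] defect_dimension[OF AB(2) B(1)] by simp
qed

end

section \<open>Double integrals of the Cauchy function\<close>

lemma self_adjoint_normD:
  assumes "self_adjoint_matrix_norm (N :: complex^'n^'n \<Rightarrow> real)"
  shows "0 \<le> N A" "N A = 0 \<longleftrightarrow> A = 0" "N (r *\<^sub>R A) = \<bar>r\<bar> * N A" "N (A + B) \<le> N A + N B"
    "N (conj_transpose A) = N A"
proof -
  have "(\<chi> i j. complex_of_real r * A $ i $ j) = r *\<^sub>R A"
    by (simp add: vec_eq_iff scaleR_conv_of_real[where 'a=complex])
  moreover have "N (\<chi> i j. complex_of_real r * A $ i $ j) = cmod (complex_of_real r) * N A"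
    using assms unfolding self_adjoint_matrix_norm_def by blast
  ultimately show "N (r *\<^sub>R A) = \<bar>r\<bar> * N A" by simp
qed (use assms in \<open>auto simp: self_adjoint_matrix_norm_def\<close>)

text \<open>Expansion in the standard basis gives this half of the equivalence of norms, from which
  continuity of \<open>N\<close> follows. The summand 1 in the constant makes it positive.\<close>

lemma self_adjoint_norm_le:
  assumes N: "self_adjoint_matrix_norm (N :: complex^'n^'n \<Rightarrow> real)"
  shows "\<exists>k>0. \<forall>A. N A \<le> k * norm A"
proof -
  define k where "k = (\<Sum>b\<in>(Basis :: (complex^'n^'n) set). N b) + 1"
  have "0 < k" unfolding k_def using self_adjoint_normD(1)[OF N] by (intro add_nonneg_pos sum_nonneg) auto
  moreover have "N A \<le> k * norm A" for A
  proof -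
    have N0: "N 0 = 0" using self_adjoint_normD(2)[OF N] by blast
    have "N (\<Sum>b\<in>S. f b) \<le> (\<Sum>b\<in>S. N (f b))" if "finite S" for S :: "(complex^'n^'n) set" and f
      using that
    proof induction
      case (insert b S)
      then show ?case using self_adjoint_normD(4)[OF N, of "f b" "\<Sum>b\<in>S. f b"] by simp
    qed (simp add: N0)
    from this[OF finite_Basis, of "\<lambda>b. (A \<bullet> b) *\<^sub>R b"]
    have "N A \<le> (\<Sum>b\<in>Basis. \<bar>A \<bullet> b\<bar> * N b)"
      by (simp add: euclidean_representation self_adjoint_normD(3)[OF N])
    also have "\<dots> \<le> (\<Sum>b\<in>Basis. norm A * N b)"
      by (intro sum_mono mult_right_mono Basis_le_norm self_adjoint_normD(1)[OF N])
    also have "\<dots> = norm A * (k - 1)" by (simp add: k_def sum_distrib_left)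
    also have "\<dots> \<le> k * norm A" by (simp add: algebra_simps)
    finally show ?thesis .
  qed
  ultimately show ?thesis by blast
qed

lemma self_adjoint_norm_continuous:
  assumes N: "self_adjoint_matrix_norm (N :: complex^'n^'n \<Rightarrow> real)"
  shows "continuous_on S N"
proof -
  obtain k where k: "0 < k" "\<And>A. N A \<le> k * norm A" using self_adjoint_norm_le[OF N] by blast
  have d: "N A - N B \<le> k * norm (A - B)" for A B
    using self_adjoint_normD(4)[OF N, of "A - B" B] k(2)[of "A - B"] by simp
  have "\<bar>N A - N B\<bar> \<le> k * norm (A - B)" for A B
    using d[of A B] d[of B A] by (simp add: norm_minus_commute abs_le_iff)
  then have "k-lipschitz_on S N"
    using k(1) by (intro lipschitz_onI) (auto simp: dist_norm)
  then show ?thesis by (rule lipschitz_on_continuous_on)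
qed

locale normed_cauchy_expression = cauchy_quasi_expression P Q R K
  for P Q R :: "real \<Rightarrow> complex^'n^'n" and K +
  fixes N :: "complex^'n^'n \<Rightarrow> real" and F :: "real \<Rightarrow> complex^('n + 'n)^('n + 'n)"
  assumes norm_N: "self_adjoint_matrix_norm N" and F: "fundamental 0 F"
begin

definition T :: "real \<Rightarrow> complex^('n + 'n)^'n" where "T x = upper (F x)"

lemma continuous_T: "continuous_on {0..} T"
  unfolding T_def by (intro bounded_linear.continuous_on[OF bounded_linear_upper] fundamental_continuous[OF F])

lemma K_T: "0 \<le> x \<Longrightarrow> 0 \<le> t \<Longrightarrow> K x t = T x ** (symplectic ** conj_transpose (T t))"
  unfolding T_def by (rule K_formula[OF F])

lemma continuous_K_row:
  assumes "0 \<le> a" "0 \<le> x"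
  shows "continuous_on {a..b} (\<lambda>t. (N (K x t))\<^sup>2)"
proof -
  have "continuous_on {a..b} (\<lambda>t. T x ** (symplectic ** conj_transpose (T t)))"
    by (intro mm.continuous_on continuous_on_const bounded_linear.continuous_on[OF bounded_linear_conj_transpose]
        continuous_halfline_facts(1)[OF continuous_T assms(1)])
  then have "continuous_on {a..b} (\<lambda>t. K x t)"
    by (rule continuous_on_eq) (use K_T assms in auto)
  then show ?thesis
    by (intro continuous_on_power continuous_on_compose2[OF self_adjoint_norm_continuous[OF norm_N, of UNIV]]) auto
qed

definition row_energy :: "real \<Rightarrow> real \<Rightarrow> real" where
  "row_energy a x = integral {a..x} (\<lambda>t. (N (K x t))\<^sup>2)"

text \<open>
  Since \<open>K\<close> vanishes on the diagonal, the variable upper limit can be moved into the integrand,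
  which then is jointly continuous.
\<close>

lemma continuous_row_energy:
  assumes "0 \<le> a"
  shows "continuous_on {a..b} (row_energy a)"
proof -
  let ?f = "\<lambda>x t. (N (T x ** (symplectic ** conj_transpose (T (min t x)))))\<^sup>2"
  have m: "(\<lambda>p. min (snd p) (fst p)) ` ({a..b} \<times> {a..b}) \<subseteq> {a..b}" by auto
  have c1: "continuous_on ({a..b} \<times> {a..b}) (\<lambda>p. T (fst p))"
    by (rule continuous_on_compose2[OF continuous_halfline_facts(1)[OF continuous_T assms, of b]])
       (auto intro!: continuous_intros)
  have c2: "continuous_on ({a..b} \<times> {a..b}) (\<lambda>p. T (min (snd p) (fst p)))"
    by (rule continuous_on_compose2[OF continuous_halfline_facts(1)[OF continuous_T assms, of b] _ m])
       (intro continuous_intros)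
  have "continuous_on ({a..b} \<times> {a..b}) (\<lambda>p. T (fst p) ** (symplectic ** conj_transpose (T (min (snd p) (fst p)))))"
    by (intro mm.continuous_on continuous_on_const c1 bounded_linear.continuous_on[OF bounded_linear_conj_transpose] c2)
  then have "continuous_on ({a..b} \<times> {a..b}) (\<lambda>p. ?f (fst p) (snd p))"
    by (intro continuous_on_power continuous_on_compose2[OF self_adjoint_norm_continuous[OF norm_N, of UNIV]]) auto
  then have "continuous_on ({a..b} \<times> cbox a b) (\<lambda>(x, t). ?f x t)"
    by (simp add: case_prod_unfold)
  then have "continuous_on {a..b} (\<lambda>x. integral (cbox a b) (?f x))"
    by (rule integral_continuous_on_param)
  moreover have "integral (cbox a b) (?f x) = row_energy a x" if x: "x \<in> {a..b}" for x
  proof -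
    have x0: "0 \<le> x" using x assms by simp
    have e1: "?f x t = (N (K x t))\<^sup>2" if "t \<in> {a..x}" for t
      using that x0 assms K_T[of x t] by (simp add: min_def)
    have e2: "?f x t = 0" if "t \<in> {x..b}" for t
    proof -
      have "T x ** (symplectic ** conj_transpose (T (min t x))) = 0"
      proof -
        have "min t x = x" using that by simp
        then show ?thesis using K_T[OF x0 x0] K_diagonal[OF x0] by simp
      qed
      then show ?thesis using self_adjoint_normD(2)[OF norm_N, of 0] by simp
    qed
    have h1: "(?f x has_integral row_energy a x) {a..x}"
      unfolding row_energy_def
      by (rule has_integral_eq[OF _ integrable_integral[OF integrable_continuous_real[OF continuous_K_row[OF assms x0]]]])
         (use e1 in auto)
    have h2: "(?f x has_integral 0) {x..b}"
      by (rule has_integral_is_0) (use e2 in blast)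
    have "(?f x has_integral row_energy a x + 0) {a..b}"
      by (rule has_integral_combine[OF _ _ h1 h2]) (use x in auto)
    then show ?thesis by (simp add: integral_unique)
  qed
  ultimately show ?thesis by (rule continuous_on_eq)
qed

definition interval_energy :: "real \<Rightarrow> real \<Rightarrow> real" where
  "interval_energy a b = integral {a..b} (row_energy a)"

lemma interval_energy_LBINT:
  assumes "0 \<le> a" "a \<le> b"
  shows "(LBINT x=a..b. (LBINT t=a..x. (N (K x t))\<^sup>2)) = interval_energy a b"
proof -
  have "(LBINT x=a..b. (LBINT t=a..x. (N (K x t))\<^sup>2)) = (LBINT x=a..b. row_energy a x)"
  proof (rule interval_integral_cong)
    fix x assume "x \<in> einterval (min (ereal a) (ereal b)) (max (ereal a) (ereal b))"
    then have x: "a \<le> x" using assms by (simp add: einterval_def min_def max_def split: if_splits)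
    then show "(LBINT t=a..x. (N (K x t))\<^sup>2) = row_energy a x"
      unfolding row_energy_def using assms
      by (intro interval_integral_eq_integral borel_integrable_atLeastAtMost' continuous_K_row) auto
  qed
  also have "\<dots> = interval_energy a b"
    unfolding interval_energy_def using assms
    by (intro interval_integral_eq_integral borel_integrable_atLeastAtMost' continuous_row_energy)
  finally show ?thesis .
qed

text \<open>There is no condition on \<open>a\<close> and \<open>x\<close>: where the integrand
  fails to be integrable, the integral has its default value 0.\<close>

lemma row_energy_nonneg: "0 \<le> row_energy a x"
  unfolding row_energy_def by (cases "(\<lambda>t. (N (K x t))\<^sup>2) integrable_on {a..x}")
    (auto intro: integral_nonneg simp: not_integrable_integral)

lemma interval_energy_nonneg: "0 \<le> a \<Longrightarrow> 0 \<le> interval_energy a b"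
  unfolding interval_energy_def
  by (intro integral_nonneg integrable_continuous_real continuous_row_energy row_energy_nonneg)

lemma T_norm_integrable: "0 \<le> a \<Longrightarrow> (\<lambda>x. (norm (T x))\<^sup>2) integrable_on {a..b}"
  by (intro continuous_halfline_facts(2) continuous_intros continuous_T)

section \<open>Upper and lower estimates, convergence and divergence of the series\<close>

text \<open>The norm of \<open>K x t\<close> is at most a constant times the product of the norms of
  \<open>T x\<close> and \<open>T t\<close>. After the inner integral is extended to
  \<open>{a..b}\<close>, the double integral is bounded by a square, which the square root in the
  series undoes.\<close>

lemma interval_energy_upper:
  "\<exists>q\<ge>0. \<forall>a b. 0 \<le> a \<longrightarrow> sqrt (interval_energy a b) \<le> q * integral {a..b} (\<lambda>x. (norm (T x))\<^sup>2)"
proof -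
  obtain k where k: "0 < k" "\<And>A. N A \<le> k * norm A" using self_adjoint_norm_le[OF norm_N] by blast
  obtain k1 where k1: "0 < k1" "\<And>(A :: complex^('n + 'n)^'n) (B :: complex^'n^('n + 'n)). norm (A ** B) \<le> norm A * norm B * k1"
    using mm.pos_bounded by blast
  have "bounded_linear (\<lambda>A :: complex^('n + 'n)^'n. symplectic ** conj_transpose A)"
    by (rule bounded_linear_compose[OF mm.bounded_linear_right bounded_linear_conj_transpose])
  then obtain k2 where k2: "0 < k2" "\<And>A :: complex^('n + 'n)^'n. norm (symplectic ** conj_transpose A) \<le> norm A * k2"
    using bounded_linear.pos_bounded by blast
  define q where "q = k * k1 * k2"
  have q0: "0 \<le> q" unfolding q_def using k k1 k2 by simp
  have Kb: "N (K x t) \<le> q * (norm (T x) * norm (T t))" if "0 \<le> x" "0 \<le> t" for x t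
  proof -
    have "N (K x t) \<le> k * norm (T x ** (symplectic ** conj_transpose (T t)))" using k(2) K_T[OF that] by simp
    also have "\<dots> \<le> k * (norm (T x) * norm (symplectic ** conj_transpose (T t)) * k1)"
      using k(1) by (intro mult_left_mono k1) auto
    also have "\<dots> \<le> k * (norm (T x) * (norm (T t) * k2) * k1)"
      using k(1) k1(1) by (intro mult_left_mono mult_right_mono k2) auto
    finally show ?thesis by (simp add: q_def mult_ac)
  qed
  have "sqrt (interval_energy a b) \<le> q * integral {a..b} (\<lambda>x. (norm (T x))\<^sup>2)" if a: "0 \<le> a" for a b
  proof -
    define s where "s = integral {a..b} (\<lambda>x. (norm (T x))\<^sup>2)"
    have s0: "0 \<le> s" unfolding s_def by (intro integral_nonneg T_norm_integrable a) auto
    have row: "row_energy a x \<le> q\<^sup>2 * s * (norm (T x))\<^sup>2" if x: "x \<in> {a..b}" for x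
    proof -
      have "row_energy a x \<le> integral {a..x} (\<lambda>t. (q\<^sup>2 * (norm (T x))\<^sup>2) * (norm (T t))\<^sup>2)"
        unfolding row_energy_def
      proof (rule integral_le)
        show "(\<lambda>t. (N (K x t))\<^sup>2) integrable_on {a..x}"
          using x a by (intro integrable_continuous_real continuous_K_row) auto
        show "(\<lambda>t. (q\<^sup>2 * (norm (T x))\<^sup>2) * (norm (T t))\<^sup>2) integrable_on {a..x}"
          by (intro integrable_on_mult_right T_norm_integrable a)
        fix t assume "t \<in> {a..x}"
        then have "(N (K x t))\<^sup>2 \<le> (q * (norm (T x) * norm (T t)))\<^sup>2"
          using x a by (intro power_mono Kb self_adjoint_normD(1)[OF norm_N]) auto
        then show "(N (K x t))\<^sup>2 \<le> (q\<^sup>2 * (norm (T x))\<^sup>2) * (norm (T t))\<^sup>2" by (simp add: power_mult_distrib mult_ac)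
      qed
      also have "\<dots> = (q\<^sup>2 * (norm (T x))\<^sup>2) * integral {a..x} (\<lambda>t. (norm (T t))\<^sup>2)" by simp
      also have "\<dots> \<le> (q\<^sup>2 * (norm (T x))\<^sup>2) * s"
        unfolding s_def using x a by (intro mult_left_mono integral_subset_le T_norm_integrable) auto
      finally show ?thesis by (simp add: mult_ac)
    qed
    have "interval_energy a b \<le> integral {a..b} (\<lambda>x. q\<^sup>2 * s * (norm (T x))\<^sup>2)"
      unfolding interval_energy_def
      by (intro integral_le integrable_continuous_real continuous_row_energy a row integrable_on_mult_right T_norm_integrable)
    also have "\<dots> = q\<^sup>2 * s * s"
      by (simp only: Henstock_Kurzweil_Integration.integral_mult_right s_def[symmetric])
    also have "\<dots> = (q * s)\<^sup>2" by (simp add: power2_eq_square)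
    finally show ?thesis using q0 s0 unfolding s_def[symmetric] by (intro real_le_lsqrt) auto
  qed
  then show ?thesis using q0 by blast
qed

text \<open>The adjoint of \<open>K x t\<close> is \<open>T t ** A\<close>, where \<open>A\<close>
  depends on \<open>x\<close> alone. The integral over the fixed window \<open>{a..a+1}\<close> is
  thus a continuous function of \<open>A\<close>, positive off 0 and homogeneous of degree 2, and
  compactness of the unit sphere bounds it from below.\<close>

lemma row_energy_lower:
  assumes a: "0 \<le> a"
  shows "\<exists>\<delta>>0. \<forall>x\<ge>a + 1. \<delta> * (norm (T x))\<^sup>2 \<le> row_energy a x"
proof -
  define q where "q A = integral {a..a+1} (\<lambda>t. (N (T t ** A))\<^sup>2)" for A :: "complex^'n^('n + 'n)"
  have cT: "continuous_on {a..a+1} T" by (rule continuous_halfline_facts(1)[OF continuous_T a])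
  have cq: "continuous_on {a..a+1} (\<lambda>t. (N (T t ** A))\<^sup>2)" for A :: "complex^'n^('n + 'n)"
    by (intro continuous_on_power continuous_on_compose2[OF self_adjoint_norm_continuous[OF norm_N, of UNIV]]
        mm.continuous_on cT continuous_on_const) auto
  have "continuous_on (UNIV \<times> {a..a+1}) (\<lambda>p. T (snd p) ** (fst p :: complex^'n^('n + 'n)))"
    by (intro mm.continuous_on continuous_on_compose2[OF cT] continuous_intros) auto
  then have "continuous_on (UNIV \<times> cbox a (a+1)) (\<lambda>(A, t). (N (T t ** (A :: complex^'n^('n + 'n))))\<^sup>2)"
    unfolding case_prod_unfold
    by (intro continuous_on_power continuous_on_compose2[OF self_adjoint_norm_continuous[OF norm_N, of UNIV]]) auto
  from integral_continuous_on_param[OF this] have contq: "continuous_on UNIV q" by (simp add: q_def[abs_def])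
  \<comment> \<open>If the integral were 0, every column of \<open>A\<close> would be the initial
    vector of a solution that vanishes on the window.\<close>
  have qpos: "0 < q A" if A: "A \<noteq> 0" for A
  proof (rule ccontr)
    assume "\<not> 0 < q A"
    moreover have "0 \<le> q A" unfolding q_def by (intro integral_nonneg integrable_continuous_real cq) auto
    ultimately have "integral {a..a+1} (\<lambda>t. (N (T t ** A))\<^sup>2) = 0" unfolding q_def by simp
    then have "\<forall>t\<in>{a..a+1}. (N (T t ** A))\<^sup>2 = 0"
      using integral_eq_0_iff[OF cq[of A]] by simp
    then have TA: "T t ** A = 0" if "a \<le> t" "t \<le> a + 1" for t
      using that self_adjoint_normD(2)[OF norm_N] by auto
    have F': "fundamental (cnj 0) F" using F by simp
    have "A *v v = 0" for v
    proof (rule fundamental_nondegenerate[OF F' F a, of "a + 1"])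
      fix t assume t: "a < t" "t < a + 1"
      have "upper (F t *v (A *v v)) = (T t ** A) *v v"
        by (simp add: T_def block_mult matrix_vector_mul_assoc)
      then show "upper (F t *v (A *v v)) = 0" using TA[of t] t by (simp add: mv.zero_left)
    qed simp
    then have "A = 0" by (intro matrix_eqI) (simp add: mv.zero_left)
    then show False using A by simp
  qed
  have qscale: "q (r *\<^sub>R A) = r\<^sup>2 * q A" for r A
    unfolding q_def mm.scaleR_right self_adjoint_normD(3)[OF norm_N] power_mult_distrib by simp
  define S where "S = sphere (0 :: complex^'n^('n + 'n)) 1"
  have S: "compact S" "S \<noteq> {}" unfolding S_def by (simp_all add: sphere_eq_empty)
  obtain A0 where A0: "A0 \<in> S" "\<And>A. A \<in> S \<Longrightarrow> q A0 \<le> q A"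
    using continuous_attains_inf[OF S continuous_on_subset[OF contq subset_UNIV]] by blast
  define d where "d = q A0"
  have d: "0 < d" unfolding d_def using A0(1) by (intro qpos) (auto simp: S_def)
  have qd: "d * (norm A)\<^sup>2 \<le> q A" for A
  proof (cases "A = 0")
    case True then show ?thesis using qscale[of 0 0] by simp
  next
    case False
    have "inverse (norm A) *\<^sub>R A \<in> S" using False by (simp add: S_def)
    then have "d \<le> (inverse (norm A))\<^sup>2 * q A" unfolding d_def using A0(2) qscale by metis
    then have "d * (norm A)\<^sup>2 \<le> (inverse (norm A))\<^sup>2 * q A * (norm A)\<^sup>2" by (rule mult_right_mono) simp
    then show ?thesis using False by (simp add: field_simps)
  qed
  have bl: "bounded_linear (\<lambda>A :: complex^'n^('n + 'n). conj_transpose (symplectic ** A))"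
    by (rule bounded_linear_compose[OF bounded_linear_conj_transpose mm.bounded_linear_right])
  \<comment> \<open>\<open>T x\<close> is recovered from \<open>A\<close> by this linear map, so a
    lower bound in terms of \<open>A\<close> is one in terms of \<open>T x\<close>.\<close>
  obtain k where k: "0 < k" "\<And>A :: complex^'n^('n + 'n). norm (conj_transpose (symplectic ** A)) \<le> norm A * k"
    using bounded_linear.pos_bounded[OF bl] by blast
  have "(d / k\<^sup>2) * (norm (T x))\<^sup>2 \<le> row_energy a x" if x: "a + 1 \<le> x" for x
  proof -
    have x0: "0 \<le> x" using x a by simp
    define A where "A = conj_transpose (T x ** symplectic)"
    have KA: "conj_transpose (K x t) = T t ** A" if "0 \<le> t" for t
      using K_T[OF x0 that] by (simp add: A_def conj_transpose_mult conj_transpose_involutive matrix_mul_assoc)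
    have "symplectic ** A = conj_transpose (T x)"
      by (simp add: A_def conj_transpose_mult conj_transpose_symplectic matrix_mul_assoc mm.minus_left mm.minus_right symplectic_square)
    then have "T x = conj_transpose (symplectic ** A)" by (simp add: conj_transpose_involutive)
    then have "norm (T x) \<le> norm A * k" using k(2)[of A] by simp
    then have "(norm (T x))\<^sup>2 \<le> (norm A * k)\<^sup>2" by (intro power_mono) auto
    then have "(d / k\<^sup>2) * (norm (T x))\<^sup>2 \<le> (d / k\<^sup>2) * (norm A * k)\<^sup>2"
      using d by (intro mult_left_mono) auto
    also have "\<dots> = d * (norm A)\<^sup>2" using k(1) by (simp add: power_mult_distrib)
    also have "\<dots> \<le> q A" by (rule qd)
    also have "\<dots> = integral {a..a+1} (\<lambda>t. (N (K x t))\<^sup>2)"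
      unfolding q_def
    proof (rule Henstock_Kurzweil_Integration.integral_cong)
      fix t assume "t \<in> {a..a+1}"
      then have "N (T t ** A) = N (conj_transpose (K x t))" using KA a by simp
      \<comment> \<open>Here the invariance of \<open>N\<close> under adjoints returns from the
        adjoint to \<open>K x t\<close> itself.\<close>
      then show "(N (T t ** A))\<^sup>2 = (N (K x t))\<^sup>2" by (simp add: self_adjoint_normD(5)[OF norm_N])
    qed
    also have "\<dots> \<le> row_energy a x"
      unfolding row_energy_def using x a x0
      by (intro integral_subset_le integrable_continuous_real continuous_K_row) auto
    finally show ?thesis .
  qed
  moreover have "0 < d / k\<^sup>2" using d k by simp
  ultimately show ?thesis by blast
qed

lemma interval_energy_unbounded:
  assumes "\<not> bounded_energy T" and a: "0 \<le> a"
  shows "\<exists>b>a. 1 \<le> interval_energy a b"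
proof -
  obtain \<delta> where \<delta>: "0 < \<delta>" "\<And>x. a + 1 \<le> x \<Longrightarrow> \<delta> * (norm (T x))\<^sup>2 \<le> row_energy a x"
    using row_energy_lower[OF a] by blast
  let ?g = "\<lambda>x. (norm (T x))\<^sup>2"
  \<comment> \<open>The energy left beyond the window then exceeds \<open>1 / \<delta>\<close>, and
    the lower bound turns this into 1.\<close>
  obtain b where b: "0 \<le> b" "integral {0..a+1} ?g + 1 / \<delta> < integral {0..b} ?g"
    using assms(1) unfolding bounded_energy_def by (meson not_le)
  have ab: "a + 1 < b"
  proof (rule ccontr)
    assume "\<not> a + 1 < b"
    then have "integral {0..b} ?g \<le> integral {0..a+1} ?g"
      using b(1) by (intro integral_subset_le T_norm_integrable) auto
    then show False using b(2) \<delta>(1) by (smt (verit) divide_pos_pos)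
  qed
  have "integral {0..a+1} ?g + integral {a+1..b} ?g = integral {0..b} ?g"
    using ab a by (intro Henstock_Kurzweil_Integration.integral_combine T_norm_integrable) auto
  then have "1 / \<delta> \<le> integral {a+1..b} ?g" using b(2) by simp
  then have "1 \<le> \<delta> * integral {a+1..b} ?g" using \<delta>(1) by (simp add: field_simps)
  also have "\<dots> = integral {a+1..b} (\<lambda>x. \<delta> * ?g x)" by simp
  also have "\<dots> \<le> integral {a+1..b} (row_energy a)"
    using a by (intro integral_le integrable_on_mult_right T_norm_integrable integrable_continuous_real
        continuous_on_subset[OF continuous_row_energy[OF a, of b]] \<delta>) auto
  also have "\<dots> \<le> interval_energy a b"
    unfolding interval_energy_def using a
    by (intro integral_subset_le integrable_continuous_real continuous_row_energy row_energy_nonneg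
        continuous_on_subset[OF continuous_row_energy[OF a, of b]]) (auto simp: row_energy_nonneg)
  finally show ?thesis using ab by (intro exI[of _ b]) auto
qed

lemma divergent_intervals:
  assumes nb: "\<not> bounded_energy T"
  shows "\<exists>a b :: nat \<Rightarrow> real. (\<forall>k. 0 \<le> a k \<and> a k < b k) \<and> disjoint_family (\<lambda>k. {a k<..<b k}) \<and>
        (\<Sum>k. ennreal (sqrt (interval_energy (a k) (b k)))) = \<infinity>"
proof -
  have "\<forall>a. \<exists>b. 0 \<le> a \<longrightarrow> a < b \<and> 1 \<le> interval_energy a b"
    using interval_energy_unbounded[OF nb] by blast
  from choice[OF this] obtain B where B: "\<And>a. 0 \<le> a \<Longrightarrow> a < B a \<and> 1 \<le> interval_energy a (B a)" by blast
  \<comment> \<open>Each interval begins where the preceding one ends, and each contributes at least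
    1 to the series.\<close>
  define a where "a k = (B ^^ k) 0" for k
  have aS: "a (Suc k) = B (a k)" for k by (simp add: a_def)
  have a0: "0 \<le> a k" for k
  proof (induction k)
    case (Suc k) then show ?case using B[of "a k"] by (simp add: aS)
  qed (simp add: a_def)
  have lt: "a k < a (Suc k)" and E: "1 \<le> interval_energy (a k) (a (Suc k))" for k
    using B[OF a0] by (simp_all add: aS)
  have "incseq a" by (rule incseq_SucI) (use lt less_imp_le in blast)
  then have mono: "a i \<le> a j" if "i \<le> j" for i j using that by (simp add: incseq_def)
  have dis: "disjoint_family (\<lambda>k. {a k<..<a (Suc k)})"
    unfolding disjoint_family_on_def
  proof (intro ballI impI)
    fix i j :: nat assume "i \<noteq> j"
    then consider "Suc i \<le> j" | "Suc j \<le> i" by linarith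
    then show "{a i<..<a (Suc i)} \<inter> {a j<..<a (Suc j)} = {}"
      by cases (use mono in \<open>fastforce+\<close>)
  qed
  let ?s = "\<lambda>k. ennreal (sqrt (interval_energy (a k) (a (Suc k))))"
  have s1: "1 \<le> ?s k" for k
    using E[of k] by simp
  have div: "(\<Sum>k. ?s k) = \<infinity>"
  proof (rule ccontr)
    assume "(\<Sum>k. ?s k) \<noteq> \<infinity>"
    then have "(\<Sum>k. ?s k) < top" by (simp add: top.not_eq_extremum)
    then obtain n where n: "(\<Sum>k. ?s k) < of_nat n" using ennreal_Ex_less_of_nat by blast
    have "of_nat n = (\<Sum>k<n. 1 :: ennreal)" by simp
    also have "\<dots> \<le> (\<Sum>k<n. ?s k)" by (intro sum_mono s1)
    also have "\<dots> \<le> (\<Sum>k. ?s k)" by (intro sum_le_suminf) auto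
    finally show False using n by simp
  qed
  show ?thesis
    by (intro exI[of _ a] exI[of _ "\<lambda>k. a (Suc k)"] conjI allI a0 lt dis div)
qed

text \<open>Each term is at most a constant times the energy of \<open>T\<close> on its interval,
  and over disjoint intervals these energies add up to no more than the total.\<close>

lemma convergent_intervals:
  assumes be: "bounded_energy T" and ab: "\<And>k. 0 \<le> a k \<and> a k < b k"
    and dis: "disjoint_family (\<lambda>k :: nat. {a k<..<b k})"
  shows "(\<Sum>k. ennreal (sqrt (interval_energy (a k) (b k)))) \<noteq> \<infinity>"
proof -
  obtain q where q: "0 \<le> q" "\<And>a b. 0 \<le> a \<Longrightarrow> sqrt (interval_energy a b) \<le> q * integral {a..b} (\<lambda>x. (norm (T x))\<^sup>2)"
    using interval_energy_upper by blast
  let ?g = "\<lambda>x. (norm (T x))\<^sup>2"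
  have cg: "continuous_on {0..} ?g" by (intro continuous_intros continuous_T)
  have gi: "integrable halfline ?g"
    using be integrable_halfline_iff_bounded[OF cg] unfolding bounded_energy_def by simp
  define I where "I = (LINT x|halfline. ?g x)"
  have sI: "(\<Sum>k<m. integral {a k..b k} ?g) \<le> I" for m
  proof -
    have pi: "integrable halfline (\<lambda>x. indicator {a k..b k} x *\<^sub>R ?g x)" for k
      using ab by (intro integrable_halfline_piece(1) continuous_halfline_facts(1)[OF cg]) auto
    have "(\<Sum>k<m. integral {a k..b k} ?g) = (\<Sum>k<m. LINT x|halfline. indicator {a k..b k} x *\<^sub>R ?g x)"
      using ab by (intro sum.cong refl halfline_piece_integral[OF gi, symmetric]) auto
    also have "\<dots> = (LINT x|halfline. (\<Sum>k<m. indicator {a k..b k} x *\<^sub>R ?g x))"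
      by (rule Bochner_Integration.integral_sum[symmetric]) (rule pi)
    also have "\<dots> \<le> I"
      unfolding I_def
    proof (rule integral_mono_AE)
      show "integrable halfline (\<lambda>x. \<Sum>k<m. indicator {a k..b k} x *\<^sub>R ?g x)"
        by (intro Bochner_Integration.integrable_sum pi)
      \<comment> \<open>The closed intervals may share end points, so the indicators add up to at
        most 1 only off the finite set of end points.\<close>
      have "(\<Sum>k<m. indicator {a k..b k} x *\<^sub>R ?g x) \<le> ?g x" if x: "x \<notin> a ` {..<m} \<union> b ` {..<m}" for x
      proof -
        have "(\<Sum>k<m. indicator {a k..b k} x *\<^sub>R ?g x) = (\<Sum>k<m. indicator {a k<..<b k} x) * ?g x"
          unfolding sum_distrib_right using x by (intro sum.cong) (auto simp: indicator_def)
        also have "(\<Sum>k<m. indicator {a k<..<b k} x) = (indicator (\<Union>k\<in>{..<m}. {a k<..<b k}) x :: real)"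
          using disjoint_family_on_mono[OF subset_UNIV dis, of "{..<m}"]
          by (intro indicator_UN_disjoint[symmetric]) auto
        also have "\<dots> * ?g x \<le> ?g x" by (simp add: indicator_def)
        finally show ?thesis .
      qed
      moreover have "negligible (a ` {..<m} \<union> b ` {..<m})" by (intro negligible_finite) auto
      ultimately show "AE x in halfline. (\<Sum>k<m. indicator {a k..b k} x *\<^sub>R ?g x) \<le> ?g x"
        unfolding AE_halfline_iff by blast
    qed (rule gi)
    finally show ?thesis .
  qed
  have nn: "0 \<le> sqrt (interval_energy (a k) (b k))" for k
    using ab by (intro real_sqrt_ge_zero interval_energy_nonneg) auto
  have "summable (\<lambda>k. sqrt (interval_energy (a k) (b k)))"
  proof (rule summableI_nonneg_bounded)
    fix m
    have "(\<Sum>k<m. sqrt (interval_energy (a k) (b k))) \<le> (\<Sum>k<m. q * integral {a k..b k} ?g)"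
      using ab by (intro sum_mono q(2)) auto
    also have "\<dots> = q * (\<Sum>k<m. integral {a k..b k} ?g)" by (simp add: sum_distrib_left)
    also have "\<dots> \<le> q * I" using sI q(1) by (intro mult_left_mono) auto
    finally show "(\<Sum>k<m. sqrt (interval_energy (a k) (b k))) \<le> q * I" .
  qed (rule nn)
  from suminf_ennreal_eq[OF nn summable_sums[OF this]] show ?thesis by simp
qed

end

theorem mainTheorem1:
  fixes P Q R :: "real \<Rightarrow> complex^'n^'n"
    and N :: "complex^'n^'n \<Rightarrow> real"
    and K :: "real \<Rightarrow> real \<Rightarrow> complex^'n^'n"
  assumes "\<And>x. 0 \<le> x \<Longrightarrow> invertible (P x)"
    and "\<And>x. 0 \<le> x \<Longrightarrow> hermitian_matrix (P x)"
    and "\<And>x. 0 \<le> x \<Longrightarrow> hermitian_matrix (Q x)"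
    and "locally_summable_entries (\<lambda>x. matrix_inv (P x))"
    and "locally_summable_entries Q"
    and "locally_summable_entries R"
    and "self_adjoint_matrix_norm N"
    and "cauchy_function P Q R K"
  shows "\<not> (defect_number_plus (minimal_operator P Q R) = enat (2 * CARD('n)) \<and>
            defect_number_minus (minimal_operator P Q R) = enat (2 * CARD('n)))
     \<longleftrightarrow>
     (\<exists>a b :: nat \<Rightarrow> real.
        (\<forall>k. 0 \<le> a k \<and> a k < b k) \<and>
        disjoint_family (\<lambda>k. {a k<..<b k}) \<and>
        (\<Sum>k. ennreal (sqrt (LBINT x=a k..b k. (LBINT t=a k..x. (N (K x t))\<^sup>2)))) = \<infinity>)"
proof -
  interpret cauchy_quasi_expression P Q R K
    by unfold_locales (use assms in \<open>auto simp: hermitian_matrix_def\<close>)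
  obtain F where F: "fundamental 0 F" using fundamental_exists by blast
  interpret normed_cauchy_expression P Q R K N F
    by unfold_locales (use assms F in auto)
  have T: "bounded_energy (\<lambda>x. upper (F x)) \<longleftrightarrow> bounded_energy T" by (simp add: T_def[abs_def])
  have eq: "(\<Sum>k. ennreal (sqrt (LBINT x=a k..b k. (LBINT t=a k..x. (N (K x t))\<^sup>2))))
      = (\<Sum>k. ennreal (sqrt (interval_energy (a k) (b k))))"
    \<comment> \<open>The ordering of the end points is what lets the oriented integrals of the
      statement be read as integrals over \<open>{a k..b k}\<close>.\<close>
    if "\<forall>k. 0 \<le> a k \<and> a k < b k" for a b :: "nat \<Rightarrow> real"
    using that by (simp add: interval_energy_LBINT less_imp_le)
  show ?thesis
    unfolding maximal_defect_iff_bounded_energy[OF F] T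
  proof
    assume "\<not> bounded_energy T"
    then obtain a b where ab: "\<forall>k. 0 \<le> a k \<and> a k < b k" "disjoint_family (\<lambda>k. {a k<..<b k})"
      "(\<Sum>k. ennreal (sqrt (interval_energy (a k) (b k)))) = \<infinity>"
      using divergent_intervals by blast
    then show "\<exists>a b :: nat \<Rightarrow> real. (\<forall>k. 0 \<le> a k \<and> a k < b k) \<and> disjoint_family (\<lambda>k. {a k<..<b k}) \<and>
        (\<Sum>k. ennreal (sqrt (LBINT x=a k..b k. (LBINT t=a k..x. (N (K x t))\<^sup>2)))) = \<infinity>"
      using eq[OF ab(1)] by (intro exI[of _ a] exI[of _ b] conjI) simp_all
  next
    assume "\<exists>a b :: nat \<Rightarrow> real. (\<forall>k. 0 \<le> a k \<and> a k < b k) \<and> disjoint_family (\<lambda>k. {a k<..<b k}) \<and>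
        (\<Sum>k. ennreal (sqrt (LBINT x=a k..b k. (LBINT t=a k..x. (N (K x t))\<^sup>2)))) = \<infinity>"
    then obtain a b :: "nat \<Rightarrow> real" where ab: "\<forall>k. 0 \<le> a k \<and> a k < b k" "disjoint_family (\<lambda>k. {a k<..<b k})"
      "(\<Sum>k. ennreal (sqrt (LBINT x=a k..b k. (LBINT t=a k..x. (N (K x t))\<^sup>2)))) = \<infinity>"
      by blast
    show "\<not> bounded_energy T"
    proof
      assume "bounded_energy T"
      then have "(\<Sum>k. ennreal (sqrt (interval_energy (a k) (b k)))) \<noteq> \<infinity>"
        by (rule convergent_intervals) (use ab in auto)
      then show False using ab(3) eq[OF ab(1)] by simp
    qed
  qed
qed

end
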